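(* (1) Let $V$ be a nontrivial irreducible weight $\mathcal{L}$-module with weight multiplicity one, i.e. $\dim V_\lambda=1$ for every $\lambda\in\mathrm{Supp}(V)$. Then there exist $\alpha,\beta\in\mathbb{C}$ such that $V\simeq\mathcal{A}_{\alpha,\beta,0}$, or $V\simeq\mathcal{A}'_{0,0,0}$. (2) Consider weight $\mathcal{L}$-modules $V=\bigoplus_{i\in\mathbb{Z}}V_{\alpha+i}$, for some $\alpha\in\mathbb{C}$, with $\dim V_{\alpha+i}=1$ for all $i\in\mathbb{Z}$. Up to isomorphism, the indecomposable modules of this kind are exactly the modules $\mathcal{A}_{a,b,0}$, $\mathcal{A}(a,0)$ and $\mathcal{B}(a,0)$ with $a,b\in\mathbb{C}$.
   Context: $\mathcal{L}=W(2,2)$ is the complex Lie algebra with basis $\{x_n,I(n),C,C_1\mid n\in\mathbb{Z}\}$ and brackets $[x_n,x_m]=(m-n)x_{n+m}+\delta_{n,-m}\frac{n^3-n}{12}C$, $[x_n,I(m)]=(m-n)I(n+m)+\delta_{n,-m}\frac{n^3-n}{12}C_1$, $[I(n),I(m)]=0$, and $C,C_1$ central. For an $\mathcal{L}$-module $V$ and $\lambda\in\mathbb{C}$, $V_\lambda=\{v\in V\mid x_0v=\lambda v\}$ is the weight space of weight $\lambda$; $V$ is a weight module if it is the sum of its weight spaces; $\mathrm{Supp}(V)=\{\lambda\mid V_\lambda\neq0\}$. A module is trivial if $\mathcal{L}$ acts by zero on it. Let $a,b\in\mathbb{C}$. Each of the following modules has basis $\{v_i\mid i\in\mathbb{Z}\}$,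 and $C$, $C_1$ and all $I(n)$, $n\in\mathbb{Z}$, act by zero; the action of $x_m$ ($m\in\mathbb{Z}$) is: - $\mathcal{A}_{a,b,0}$: $x_mv_i=(a+i+bm)v_{m+i}$; - $\mathcal{A}(a,0)$: $x_mv_i=(i+m)v_{m+i}$ if $i\neq0$, and $x_mv_0=m(m+a)v_m$; - $\mathcal{B}(a,0)$: $x_mv_i=iv_{m+i}$ if $i\neq-m$, and $x_mv_{-m}=-m(m+a)v_0$. $\mathcal{A}'_{0,0,0}$ denotes the unique nontrivial simple subquotient of $\mathcal{A}_{0,0,0}$. *)

theory Defs
  imports Complex_Main "HOL-Library.Poly_Mapping"
begin

section \<open>Complex vector spaces with a given basis\<close>

text \<open>
  The complex vector space with basis indexed by \<open>'i\<close> is \<open>'i \<Rightarrow>\<^sub>0 complex\<close>; the basis vector of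
  index \<open>i\<close> is \<open>Poly_Mapping.single i 1\<close>.
\<close>

definition pm_scale :: "complex \<Rightarrow> ('i \<Rightarrow>\<^sub>0 complex) \<Rightarrow> ('i \<Rightarrow>\<^sub>0 complex)"
  where "pm_scale c p = Poly_Mapping.map ((*) c) p"

lemma lookup_pm_scale [simp]: "Poly_Mapping.lookup (pm_scale c p) i = c * Poly_Mapping.lookup p i"
  by (simp add: pm_scale_def Poly_Mapping.map.rep_eq when_def)

lemma vector_space_pm_scale: "vector_space pm_scale"
  by unfold_locales (auto intro!: poly_mapping_eqI simp: lookup_add algebra_simps)

lemma pm_scale_add: "pm_scale c (p + q) = pm_scale c p + pm_scale c q"
  by (auto intro!: poly_mapping_eqI simp: lookup_add algebra_simps)

lemma pm_scale_minus: "pm_scale c (- p) = - pm_scale c p"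
  by (auto intro!: poly_mapping_eqI)

definition bilinear_extension ::
    "('i \<Rightarrow> 'j \<Rightarrow> ('k \<Rightarrow>\<^sub>0 complex)) \<Rightarrow> ('i \<Rightarrow>\<^sub>0 complex) \<Rightarrow> ('j \<Rightarrow>\<^sub>0 complex) \<Rightarrow> ('k \<Rightarrow>\<^sub>0 complex)"
  where "bilinear_extension g x y =
    (\<Sum>i\<in>Poly_Mapping.keys x. \<Sum>j\<in>Poly_Mapping.keys y.
       pm_scale (Poly_Mapping.lookup x i * Poly_Mapping.lookup y j) (g i j))"

lemma bilinear_extension_basis:
  "bilinear_extension g (Poly_Mapping.single i 1) (Poly_Mapping.single j 1) = g i j"
  by (auto intro!: poly_mapping_eqI simp: bilinear_extension_def)

lemma bilinear_extension_superset:
  assumes "finite A" "Poly_Mapping.keys x \<subseteq> A" "finite B" "Poly_Mapping.keys y \<subseteq> B"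
  shows "bilinear_extension g x y =
    (\<Sum>i\<in>A. \<Sum>j\<in>B. pm_scale (Poly_Mapping.lookup x i * Poly_Mapping.lookup y j) (g i j))"
proof -
  have z: "pm_scale 0 p = 0" for p :: "'c \<Rightarrow>\<^sub>0 complex"
    by (auto intro!: poly_mapping_eqI)
  have "(\<Sum>j\<in>Poly_Mapping.keys y. pm_scale (Poly_Mapping.lookup x i * Poly_Mapping.lookup y j) (g i j)) =
        (\<Sum>j\<in>B. pm_scale (Poly_Mapping.lookup x i * Poly_Mapping.lookup y j) (g i j))" for i
    by (rule sum.mono_neutral_left) (use assms in \<open>auto simp: z in_keys_iff\<close>)
  moreover have "(\<Sum>i\<in>Poly_Mapping.keys x. \<Sum>j\<in>B. pm_scale (Poly_Mapping.lookup x i * Poly_Mapping.lookup y j) (g i j)) =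
        (\<Sum>i\<in>A. \<Sum>j\<in>B. pm_scale (Poly_Mapping.lookup x i * Poly_Mapping.lookup y j) (g i j))"
    by (rule sum.mono_neutral_left) (use assms in \<open>auto simp: z in_keys_iff\<close>)
  ultimately show ?thesis
    by (simp add: bilinear_extension_def)
qed

lemma linear_bilinear_extension_left:
  fixes g :: "'a \<Rightarrow> 'b \<Rightarrow> ('c \<Rightarrow>\<^sub>0 complex)"
  shows "Vector_Spaces.linear pm_scale pm_scale (\<lambda>x. bilinear_extension g x y)"
proof -
  interpret vs2: vector_space "pm_scale :: complex \<Rightarrow> ('c \<Rightarrow>\<^sub>0 complex) \<Rightarrow> _"
    by (rule vector_space_pm_scale)
  show ?thesis
    unfolding Vector_Spaces.linear_iff
  proof (intro conjI allI vector_space_pm_scale)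
    fix x x' :: "'a \<Rightarrow>\<^sub>0 complex" and c
    let ?A = "Poly_Mapping.keys x \<union> Poly_Mapping.keys x'"
    have "Poly_Mapping.keys (x + x') \<subseteq> ?A"
      by (rule Poly_Mapping.keys_add)
    then show "bilinear_extension g (x + x') y = bilinear_extension g x y + bilinear_extension g x' y"
      by (simp add: bilinear_extension_superset[of ?A _ "Poly_Mapping.keys y"] lookup_add
          distrib_right vs2.scale_left_distrib sum.distrib)
    have "Poly_Mapping.keys (pm_scale c x) \<subseteq> Poly_Mapping.keys x"
      by (auto simp: in_keys_iff)
    then show "bilinear_extension g (pm_scale c x) y = pm_scale c (bilinear_extension g x y)"
      by (simp add: bilinear_extension_superset[of "Poly_Mapping.keys x" _ "Poly_Mapping.keys y"]
          vs2.scale_sum_right mult.assoc)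
  qed
qed

lemma linear_bilinear_extension_right:
  fixes g :: "'a \<Rightarrow> 'b \<Rightarrow> ('c \<Rightarrow>\<^sub>0 complex)"
  shows "Vector_Spaces.linear pm_scale pm_scale (bilinear_extension g x)"
proof -
  interpret vs2: vector_space "pm_scale :: complex \<Rightarrow> ('c \<Rightarrow>\<^sub>0 complex) \<Rightarrow> _"
    by (rule vector_space_pm_scale)
  show ?thesis
    unfolding Vector_Spaces.linear_iff
  proof (intro conjI allI vector_space_pm_scale)
    fix y y' :: "'b \<Rightarrow>\<^sub>0 complex" and c
    let ?B = "Poly_Mapping.keys y \<union> Poly_Mapping.keys y'"
    have "Poly_Mapping.keys (y + y') \<subseteq> ?B"
      by (rule Poly_Mapping.keys_add)
    then show "bilinear_extension g x (y + y') = bilinear_extension g x y + bilinear_extension g x y'"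
      by (simp add: bilinear_extension_superset[of "Poly_Mapping.keys x" _ ?B] lookup_add
          distrib_left vs2.scale_left_distrib sum.distrib)
    have "Poly_Mapping.keys (pm_scale c y) \<subseteq> Poly_Mapping.keys y"
      by (auto simp: in_keys_iff)
    then show "bilinear_extension g x (pm_scale c y) = pm_scale c (bilinear_extension g x y)"
      by (simp add: bilinear_extension_superset[of "Poly_Mapping.keys x" _ "Poly_Mapping.keys y"]
          vs2.scale_sum_right mult.left_commute)
  qed
qed

lemma pm_basis_induct [case_names zero add scale basis]:
  fixes x :: "'i \<Rightarrow>\<^sub>0 complex"
  assumes "P 0" and "\<And>x y. P x \<Longrightarrow> P y \<Longrightarrow> P (x + y)" and "\<And>c x. P x \<Longrightarrow> P (pm_scale c x)"
    and "\<And>i. P (Poly_Mapping.single i 1)"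
  shows "P x"
proof (induction x rule: update_induct)
  case const
  show ?case by (rule assms(1))
next
  case (update f k v)
  have "Poly_Mapping.update k v f = f + pm_scale v (Poly_Mapping.single k 1)"
    using update(1)
    by (auto intro!: poly_mapping_eqI
        simp: lookup_update lookup_add lookup_single when_def in_keys_iff)
  then show ?case
    using assms update by metis
qed


section \<open>The Lie algebra W(2,2)\<close>

datatype w22_index = Xi int | Ii int | Ci | C1i

type_synonym w22 = "w22_index \<Rightarrow>\<^sub>0 complex"

fun w22_basis_bracket :: "w22_index \<Rightarrow> w22_index \<Rightarrow> w22" where
  "w22_basis_bracket (Xi n) (Xi m) =
     Poly_Mapping.single (Xi (n + m)) (of_int (m - n)) +
     (if n = - m then Poly_Mapping.single Ci (of_int (n ^ 3 - n) / 12) else 0)"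
| "w22_basis_bracket (Xi n) (Ii m) =
     Poly_Mapping.single (Ii (n + m)) (of_int (m - n)) +
     (if n = - m then Poly_Mapping.single C1i (of_int (n ^ 3 - n) / 12) else 0)"
| "w22_basis_bracket (Ii m) (Xi n) =
     - (Poly_Mapping.single (Ii (n + m)) (of_int (m - n)) +
        (if n = - m then Poly_Mapping.single C1i (of_int (n ^ 3 - n) / 12) else 0))"
| "w22_basis_bracket _ _ = 0"

definition w22_bracket :: "w22 \<Rightarrow> w22 \<Rightarrow> w22"
  where "w22_bracket = bilinear_extension w22_basis_bracket"

text \<open>The bracket is bilinear, alternating and satisfies the Jacobi identity.\<close>

lemmas linear_w22_bracket_left =
  linear_bilinear_extension_left[of w22_basis_bracket, folded w22_bracket_def]

lemmas linear_w22_bracket_right =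
  linear_bilinear_extension_right[of w22_basis_bracket, folded w22_bracket_def]

interpretation w22_bracket_left: Vector_Spaces.linear pm_scale pm_scale "\<lambda>x. w22_bracket x y" for y
  by (rule linear_w22_bracket_left)

interpretation w22_bracket_right: Vector_Spaces.linear pm_scale pm_scale "w22_bracket x" for x
  by (rule linear_w22_bracket_right)

lemma w22_bracket_basis:
  "w22_bracket (Poly_Mapping.single g 1) (Poly_Mapping.single h 1) = w22_basis_bracket g h"
  by (simp add: w22_bracket_def bilinear_extension_basis)

lemma w22_basis_bracket_antisym: "w22_basis_bracket g h = - w22_basis_bracket h g"
  by (cases g; cases h; intro poly_mapping_eqI)
    (auto simp: lookup_add lookup_minus lookup_single when_def power3_eq_cube add.commute
       field_simps)

lemma w22_bracket_antisym: "w22_bracket x y = - w22_bracket y x"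
proof (induction x rule: pm_basis_induct)
  case (basis i)
  show ?case
    by (induction y rule: pm_basis_induct)
      (simp_all add: w22_bracket_left.add w22_bracket_right.add w22_bracket_left.scale
        w22_bracket_right.scale w22_bracket_left.zero w22_bracket_right.zero w22_bracket_basis
        pm_scale_minus w22_basis_bracket_antisym[of i])
qed (simp_all add: w22_bracket_left.add w22_bracket_right.add w22_bracket_left.scale
        w22_bracket_right.scale w22_bracket_left.zero w22_bracket_right.zero
        pm_scale_minus)

lemma w22_bracket_self: "w22_bracket x x = 0"
proof (rule poly_mapping_eqI)
  fix k
  have "Poly_Mapping.lookup (w22_bracket x x) k = - Poly_Mapping.lookup (w22_bracket x x) k"
    by (metis w22_bracket_antisym lookup_uminus)
  then show "Poly_Mapping.lookup (w22_bracket x x) k = Poly_Mapping.lookup 0 k"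
    by simp
qed

lemma single_eq_pm_scale: "Poly_Mapping.single k v = pm_scale v (Poly_Mapping.single k 1)"
  by (auto intro!: poly_mapping_eqI simp: lookup_single when_def)

lemma w22_bracket_basis_single:
  "w22_bracket (Poly_Mapping.single g 1) (Poly_Mapping.single h v) = pm_scale v (w22_basis_bracket g h)"
  by (subst single_eq_pm_scale) (simp add: w22_bracket_right.scale w22_bracket_basis)

lemma w22_jacobi_basis:
  "w22_bracket (Poly_Mapping.single g 1) (w22_basis_bracket h k) +
   w22_bracket (Poly_Mapping.single h 1) (w22_basis_bracket k g) +
   w22_bracket (Poly_Mapping.single k 1) (w22_basis_bracket g h) = 0"
proof -
  show ?thesis
    apply (cases g; cases h; cases k)
    apply (simp_all add: w22_bracket_right.add w22_bracket_right.neg w22_bracket_right.zero w22_bracket_basis_single w22_bracket_right.diff if_distrib[of "w22_bracket _"] cong: if_cong)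
    apply (simp_all only: add.assoc add.commute add.left_commute)
    apply (safe)
    apply (auto intro!: poly_mapping_eqI simp: lookup_add lookup_minus lookup_single when_def)
    apply (auto simp: field_simps power3_eq_cube)
    subgoal premises p for n m l
    proof -
      have "n = - l - m"
        using p by simp
      then show ?thesis
        unfolding \<open>n = - l - m\<close> by (simp add: algebra_simps)
    qed
    done
qed

lemma w22_jacobi:
  "w22_bracket x (w22_bracket y z) + w22_bracket y (w22_bracket z x) + w22_bracket z (w22_bracket x y) = 0"
    (is "?J x y z = 0")
proof -
  note lin = w22_bracket_left.add w22_bracket_right.add w22_bracket_left.scale
    w22_bracket_right.scale w22_bracket_left.zero w22_bracket_right.zero
  have add1: "?J (x + x') y z = ?J x y z + ?J x' y z" for x x' y z
    by (simp add: lin)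
  have scale1: "?J (pm_scale c x) y z = pm_scale c (?J x y z)" for c x y z
    by (simp add: lin pm_scale_add)
  have cyc: "?J x y z = ?J y z x" for x y z
    by (simp add: add.assoc add.commute)
  have "?J (Poly_Mapping.single g 1) (Poly_Mapping.single h 1) z = 0" for g h z
  proof (induction z rule: pm_basis_induct)
    case (basis k)
    show ?case
      using w22_jacobi_basis[of g h k] by (simp only: w22_bracket_basis)
  qed (simp_all only: cyc[of "Poly_Mapping.single h 1"] cyc[of "Poly_Mapping.single g 1"] add1 scale1,
       simp_all add: lin)
  then have "?J (Poly_Mapping.single g 1) y z = 0" for g y z
  proof (induction y rule: pm_basis_induct)
  qed (simp_all only: cyc[of "Poly_Mapping.single g 1"] add1 scale1, simp_all add: lin)
  then show ?thesis
    by (induction x rule: pm_basis_induct) (simp_all only: add1 scale1, simp_all add: lin)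
qed

definition x0 :: w22
  where "x0 = Poly_Mapping.single (Xi 0) 1"


section \<open>Modules over W(2,2)\<close>

text \<open>
  A module is a complex vector space, given by its scalar multiplication \<open>scale\<close> on a type, with
  an action \<open>act\<close> of W(2,2).  The notions below that do not require the module axioms are stated
  for an arbitrary pair \<open>(scale, act)\<close>.
\<close>

locale w22_module = vector_space scale
  for scale :: "complex \<Rightarrow> 'v \<Rightarrow> 'v::ab_group_add" +
  fixes act :: "w22 \<Rightarrow> 'v \<Rightarrow> 'v"
  assumes act_linear_left: "Vector_Spaces.linear pm_scale scale (\<lambda>x. act x v)"
    and act_linear_right: "Vector_Spaces.linear scale scale (act x)"
    and act_bracket: "act (w22_bracket x y) v = act x (act y v) - act y (act x v)"

definition w22_trivial :: "(w22 \<Rightarrow> 'v \<Rightarrow> 'v::ab_group_add) \<Rightarrow> bool"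
  where "w22_trivial act \<longleftrightarrow> (\<forall>x v. act x v = 0)"

definition w22_submodule ::
    "(complex \<Rightarrow> 'v \<Rightarrow> 'v::ab_group_add) \<Rightarrow> (w22 \<Rightarrow> 'v \<Rightarrow> 'v) \<Rightarrow> 'v set \<Rightarrow> bool"
  where "w22_submodule scale act U \<longleftrightarrow>
    module.subspace scale U \<and> (\<forall>x. \<forall>u\<in>U. act x u \<in> U)"

definition w22_irreducible ::
    "(complex \<Rightarrow> 'v \<Rightarrow> 'v::ab_group_add) \<Rightarrow> (w22 \<Rightarrow> 'v \<Rightarrow> 'v) \<Rightarrow> bool"
  where "w22_irreducible scale act \<longleftrightarrow>
    (UNIV :: 'v set) \<noteq> {0} \<and> (\<forall>U. w22_submodule scale act U \<longrightarrow> U = {0} \<or> U = UNIV)"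

definition w22_indecomposable ::
    "(complex \<Rightarrow> 'v \<Rightarrow> 'v::ab_group_add) \<Rightarrow> (w22 \<Rightarrow> 'v \<Rightarrow> 'v) \<Rightarrow> bool"
  where "w22_indecomposable scale act \<longleftrightarrow>
    (UNIV :: 'v set) \<noteq> {0} \<and>
    (\<forall>U W. w22_submodule scale act U \<longrightarrow> w22_submodule scale act W \<longrightarrow>
       U \<inter> W = {0} \<longrightarrow> {u + w | u w. u \<in> U \<and> w \<in> W} = UNIV \<longrightarrow> U = {0} \<or> W = {0})"

definition weight_space ::
    "(complex \<Rightarrow> 'v \<Rightarrow> 'v) \<Rightarrow> (w22 \<Rightarrow> 'v \<Rightarrow> 'v) \<Rightarrow> complex \<Rightarrow> 'v set"
  where "weight_space scale act \<mu> = {v. act x0 v = scale \<mu> v}"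

definition weight_module ::
    "(complex \<Rightarrow> 'v \<Rightarrow> 'v::ab_group_add) \<Rightarrow> (w22 \<Rightarrow> 'v \<Rightarrow> 'v) \<Rightarrow> bool"
  where "weight_module scale act \<longleftrightarrow>
    module.span scale (\<Union>\<mu>. weight_space scale act \<mu>) = UNIV"

definition Supp ::
    "(complex \<Rightarrow> 'v \<Rightarrow> 'v::ab_group_add) \<Rightarrow> (w22 \<Rightarrow> 'v \<Rightarrow> 'v) \<Rightarrow> complex set"
  where "Supp scale act = {\<mu>. weight_space scale act \<mu> \<noteq> {0}}"

text \<open>The whole space is the internal direct sum of the family \<open>S\<close>.\<close>

definition is_direct_sum :: "('i \<Rightarrow> 'v::ab_group_add set) \<Rightarrow> bool"
  where "is_direct_sum S \<longleftrightarrow>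
    (\<forall>v. \<exists>!f. (\<forall>i. f i \<in> S i) \<and> finite {i. f i \<noteq> 0} \<and> v = (\<Sum>i | f i \<noteq> 0. f i))"

text \<open>
  Weight modules \<open>V\<close> that are the direct sum of the weight spaces of weight \<open>\<alpha> + i\<close>, with \<open>i\<close> an
  integer, all of these weight spaces being one-dimensional.
\<close>

definition multiplicity_one_coset_module ::
    "(complex \<Rightarrow> 'v \<Rightarrow> 'v::ab_group_add) \<Rightarrow> (w22 \<Rightarrow> 'v \<Rightarrow> 'v) \<Rightarrow> bool"
  where "multiplicity_one_coset_module scale act \<longleftrightarrow>
    w22_module scale act \<and> weight_module scale act \<and>
    (\<exists>\<alpha>. is_direct_sum (\<lambda>i::int. weight_space scale act (\<alpha> + of_int i)) \<and>
         (\<forall>i::int. vector_space.dim scale (weight_space scale act (\<alpha> + of_int i)) = 1))"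

definition w22_isomorphic ::
    "(complex \<Rightarrow> 'v \<Rightarrow> 'v::ab_group_add) \<Rightarrow> (w22 \<Rightarrow> 'v \<Rightarrow> 'v) \<Rightarrow>
     (complex \<Rightarrow> 'w \<Rightarrow> 'w::ab_group_add) \<Rightarrow> (w22 \<Rightarrow> 'w \<Rightarrow> 'w) \<Rightarrow> bool"
  where "w22_isomorphic scale act scale' act' \<longleftrightarrow>
    (\<exists>f. Vector_Spaces.linear scale scale' f \<and> bij f \<and> (\<forall>x v. f (act x v) = act' x (f v)))"

text \<open>
  The first module is isomorphic to the quotient \<open>M / N\<close> of submodules \<open>N \<subseteq> M\<close> of the second one.
  The elements of \<open>M / N\<close> are the cosets \<open>(+) w ` N\<close> with \<open>w \<in> M\<close>, and its operations are those of
  coset representatives.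
\<close>

definition w22_isomorphic_quotient ::
    "(complex \<Rightarrow> 'v \<Rightarrow> 'v::ab_group_add) \<Rightarrow> (w22 \<Rightarrow> 'v \<Rightarrow> 'v) \<Rightarrow>
     (complex \<Rightarrow> 'w \<Rightarrow> 'w::ab_group_add) \<Rightarrow> (w22 \<Rightarrow> 'w \<Rightarrow> 'w) \<Rightarrow> 'w set \<Rightarrow> 'w set \<Rightarrow> bool"
  where "w22_isomorphic_quotient scale act scale' act' M N \<longleftrightarrow>
    (\<exists>f. bij_betw f UNIV ((\<lambda>w. (+) w ` N) ` M) \<and>
      (\<forall>u v. \<forall>w\<in>M. \<forall>z\<in>M. f u = (+) w ` N \<longrightarrow> f v = (+) z ` N \<longrightarrow>
         f (u + v) = (+) (w + z) ` N) \<and>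
      (\<forall>c u. \<forall>w\<in>M. f u = (+) w ` N \<longrightarrow> f (scale c u) = (+) (scale' c w) ` N) \<and>
      (\<forall>x u. \<forall>w\<in>M. f u = (+) w ` N \<longrightarrow> f (act x u) = (+) (act' x w) ` N))"

definition is_nontrivial_simple_subquotient ::
    "(complex \<Rightarrow> 'v \<Rightarrow> 'v::ab_group_add) \<Rightarrow> (w22 \<Rightarrow> 'v \<Rightarrow> 'v) \<Rightarrow>
     (complex \<Rightarrow> 'w \<Rightarrow> 'w::ab_group_add) \<Rightarrow> (w22 \<Rightarrow> 'w \<Rightarrow> 'w) \<Rightarrow> bool"
  where "is_nontrivial_simple_subquotient scale act scale' act' \<longleftrightarrow>
    w22_irreducible scale act \<and> \<not> w22_trivial act \<and>
    (\<exists>M N. w22_submodule scale' act' M \<and> w22_submodule scale' act' N \<and> N \<subseteq> M \<and>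
           w22_isomorphic_quotient scale act scale' act' M N)"


section \<open>The modules of the intermediate series\<close>

text \<open>
  The basis vector \<open>v\<^sub>i\<close> is \<open>Poly_Mapping.single i 1\<close>.  Given coefficients \<open>c\<close>, the element \<open>x\<^sub>m\<close>
  sends \<open>v\<^sub>i\<close> to \<open>c m i\<close> times \<open>v\<^sub>m\<^sub>+\<^sub>i\<close>, and the other basis elements of W(2,2) act by zero.
\<close>

definition series_action ::
    "(int \<Rightarrow> int \<Rightarrow> complex) \<Rightarrow> w22 \<Rightarrow> (int \<Rightarrow>\<^sub>0 complex) \<Rightarrow> (int \<Rightarrow>\<^sub>0 complex)"
  where "series_action c = bilinear_extension
    (\<lambda>g i. case g of Xi m \<Rightarrow> Poly_Mapping.single (m + i) (c m i) | _ \<Rightarrow> 0)"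

definition act_A_ab0 :: "complex \<Rightarrow> complex \<Rightarrow> w22 \<Rightarrow> (int \<Rightarrow>\<^sub>0 complex) \<Rightarrow> (int \<Rightarrow>\<^sub>0 complex)"
  where "act_A_ab0 a b = series_action (\<lambda>m i. a + of_int i + b * of_int m)"

definition act_A_a0 :: "complex \<Rightarrow> w22 \<Rightarrow> (int \<Rightarrow>\<^sub>0 complex) \<Rightarrow> (int \<Rightarrow>\<^sub>0 complex)"
  where "act_A_a0 a = series_action
    (\<lambda>m i. if i \<noteq> 0 then of_int (i + m) else of_int m * (of_int m + a))"

definition act_B_a0 :: "complex \<Rightarrow> w22 \<Rightarrow> (int \<Rightarrow>\<^sub>0 complex) \<Rightarrow> (int \<Rightarrow>\<^sub>0 complex)"
  where "act_B_a0 a = series_action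
    (\<lambda>m i. if i \<noteq> - m then of_int i else - of_int m * (of_int m + a))"

text \<open>
  \<open>\<A>'\<^sub>0\<^sub>,\<^sub>0\<^sub>,\<^sub>0\<close> is determined up to isomorphism as the nontrivial simple subquotient of
  \<open>\<A>\<^sub>0\<^sub>,\<^sub>0\<^sub>,\<^sub>0\<close>, so being isomorphic to it is expressed by the following predicate.
\<close>

definition isomorphic_A'_000 ::
    "(complex \<Rightarrow> 'v \<Rightarrow> 'v::ab_group_add) \<Rightarrow> (w22 \<Rightarrow> 'v \<Rightarrow> 'v) \<Rightarrow> bool"
  where "isomorphic_A'_000 scale act \<longleftrightarrow>
    is_nontrivial_simple_subquotient scale act pm_scale (act_A_ab0 0 0)"

end

theory Submission
  imports Defs "HOL-Computational_Algebra.Polynomial"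
begin

text \<open>
  In a module with one-dimensional weight spaces \<open>\<complex> v\<^sub>i\<close> of weight \<open>\<alpha> + i\<close> everything is a matter of
  scalars.  First, \<open>I(0)\<close> acts diagonally, and \<open>m I(m) = [I(0), x\<^sub>m]\<close> together with
  \<open>[I(0), I(m)] = 0\<close> forces all \<open>I(m)\<close>, and then \<open>C\<^sub>1\<close>, to act by zero (\<open>I_acts_zero\<close>).  It remains to
  classify the Virasoro actions \<open>x\<^sub>m v\<^sub>i = f m i v\<^sub>i\<^sub>+\<^sub>m\<close>.

  The coefficients depend on the choice of the \<open>v\<^sub>i\<close>, but the eigenvalues of degree zero products such
  as \<open>p = x\<^sub>-\<^sub>1 x\<^sub>1\<close>, \<open>q = x\<^sub>-\<^sub>2 x\<^sub>2\<close>, \<open>r = x\<^sub>-\<^sub>2 x\<^sub>1 x\<^sub>1\<close> and \<open>r' = x\<^sub>-\<^sub>1 x\<^sub>-\<^sub>1 x\<^sub>2\<close> do not.  Brackets turn into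
  difference equations, so \<open>p\<close>, \<open>r\<close> and \<open>r'\<close> are polynomials in the weight, of degree two, three
  and three, and \<open>q\<close> is quadratic along every second weight as long as \<open>C\<close> acts by a scalar.
  Since factors commute, \<open>r(i) r'(i) = q(i) p(i) p(i+1)\<close>, an identity between polynomials which makes
  \<open>C\<close> vanish and shows that all four invariants are those of a density module \<open>\<A>\<^sub>\<alpha>\<^sub>,\<^sub>b\<^sub>,\<^sub>0\<close> (\<open>tail_invariants\<close>, \<open>invariants\<close>).

  If all weights \<open>\<alpha> + i\<close> occur, the invariants determine \<open>f\<close> up to rescaling
  (\<open>density_normal_form\<close>), except for \<open>b \<in> {0, 1}\<close> and integral weights.  In that case the maps
  into and out of \<open>v\<^sub>0\<close> are not controlled; each of the two sets is a two-parameter family, one of the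
  sets vanishes, and the other one yields \<open>\<A>(a,0)\<close>, \<open>\<B>(a,0)\<close>, a density module, or the sum of a trivial
  line and \<open>\<A>'\<^sub>0\<^sub>,\<^sub>0\<^sub>,\<^sub>0\<close> (\<open>vir_coeffs_classification\<close>).  The last module is decomposable, and a
  graph argument shows that the others are not (\<open>series_indecomposable\<close>).

  If a weight is missing, the invariants vanish at the gap.  Their polynomial form excludes all supports
  but the weight \<open>0\<close> alone, which gives a trivial module, and all weights of \<open>\<int>\<close> other than \<open>0\<close>
  (\<open>support_cases\<close>).  In the latter case a trivial line can be added at the weight \<open>0\<close>; the sum is then the
  decomposable normal form, and the module is \<open>\<A>'\<^sub>0\<^sub>,\<^sub>0\<^sub>,\<^sub>0\<close>.
\<close>

section \<open>Structure constants and their invariants\<close>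

text \<open>
  Precomposing the transposed action with the anti-involution \<open>x\<^sub>m \<mapsto> x\<^sub>-\<^sub>m\<close> gives an action on the
  restricted dual, with the same weights; these are its coefficients in the dual basis.  The passage
  exchanges maps into a weight space with maps out of it, so each argument below about one of them
  yields the corresponding statement about the other.
\<close>

definition transpose_coeffs :: "(int \<Rightarrow> int \<Rightarrow> complex) \<Rightarrow> int \<Rightarrow> int \<Rightarrow> complex"
  where "transpose_coeffs f m i = f (- m) (i + m)"

text \<open>
  The eigenvalues on \<open>v\<^sub>i\<close> of the degree zero operators \<open>x\<^sub>-\<^sub>1 x\<^sub>1\<close>, \<open>x\<^sub>-\<^sub>2 x\<^sub>2\<close> and \<open>x\<^sub>-\<^sub>2 x\<^sub>1 x\<^sub>1\<close>.
  Contrary to the coefficients themselves they do not depend on the choice of the weight vectors.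
\<close>

definition inv11 :: "(int \<Rightarrow> int \<Rightarrow> complex) \<Rightarrow> int \<Rightarrow> complex"
  where "inv11 f i = f 1 i * f (- 1) (i + 1)"

definition inv22 :: "(int \<Rightarrow> int \<Rightarrow> complex) \<Rightarrow> int \<Rightarrow> complex"
  where "inv22 f i = f 2 i * f (- 2) (i + 2)"

definition inv112 :: "(int \<Rightarrow> int \<Rightarrow> complex) \<Rightarrow> int \<Rightarrow> complex"
  where "inv112 f i = f 1 i * f 1 (i + 1) * f (- 2) (i + 2)"

text \<open>
  Structure constants of a Virasoro action with one-dimensional weight spaces:
  \<open>x\<^sub>m v\<^sub>i = f m i v\<^sub>i\<^sub>+\<^sub>m\<close> and \<open>C v\<^sub>i = c i v\<^sub>i\<close>, where \<open>i\<close> stands for the weight \<open>\<alpha> + i\<close>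
  and runs over \<open>S\<close>.  Coefficients are \<open>0\<close> when one of the two weights is missing, so that the
  bracket relation can be required for all indices.
\<close>

locale vir_coeffs =
  fixes S :: "int set" and \<alpha> :: complex and f :: "int \<Rightarrow> int \<Rightarrow> complex" and c :: "int \<Rightarrow> complex"
  assumes outside_source: "i \<notin> S \<Longrightarrow> f m i = 0"
    and outside_target: "i + m \<notin> S \<Longrightarrow> f m i = 0"
    and weight: "i \<in> S \<Longrightarrow> f 0 i = \<alpha> + of_int i"
    and bracket: "f m i * f n (i + m) - f n i * f m (i + n) =
      of_int (m - n) * f (m + n) i + (if n = - m then of_int (n ^ 3 - n) / 12 * c i else 0)"
    and central: "f m i * c (i + m) = f m i * c i"

lemma vir_coeffs_transpose:
  assumes "vir_coeffs S \<alpha> f c"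
  shows "vir_coeffs S \<alpha> (transpose_coeffs f) c"
proof -
  interpret vir_coeffs S \<alpha> f c by fact
  show ?thesis
  proof
    fix m n i
    show "transpose_coeffs f m i * transpose_coeffs f n (i + m) - transpose_coeffs f n i * transpose_coeffs f m (i + n)
      = of_int (m - n) * transpose_coeffs f (m + n) i + (if n = - m then of_int (n ^ 3 - n) / 12 * c i else 0)"
      using bracket[of "- n" "i + m + n" "- m"]
      by (simp add: transpose_coeffs_def algebra_simps split: if_splits)
    show "transpose_coeffs f m i * c (i + m) = transpose_coeffs f m i * c i"
      using central[of "- m" "i + m"] by (auto simp: transpose_coeffs_def)
  qed (simp_all add: transpose_coeffs_def weight outside_source outside_target)
qed

lemma transpose_coeffs_transpose_coeffs [simp]: "transpose_coeffs (transpose_coeffs f) = f"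
  by (intro ext) (simp add: transpose_coeffs_def)

lemma inv11_transpose [simp]: "inv11 (transpose_coeffs f) = inv11 f"
  by (intro ext) (simp add: transpose_coeffs_def inv11_def)

lemma inv22_transpose [simp]: "inv22 (transpose_coeffs f) = inv22 f"
  by (intro ext) (simp add: transpose_coeffs_def inv22_def)

lemma inv112_transpose: "inv112 (transpose_coeffs f) i = f 2 i * f (- 1) (i + 1) * f (- 1) (i + 2)"
  by (simp add: transpose_coeffs_def inv112_def add.assoc)

text \<open>
  The operator \<open>x\<^sub>-\<^sub>1 x\<^sub>-\<^sub>1 x\<^sub>2\<close> has the eigenvalue \<open>inv112 (transpose_coeffs f)\<close>.  Since everything
  happens in one-dimensional spaces, factors may be regrouped freely; the resulting relation between
  the invariants is what forces the central charge to vanish.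
\<close>

lemma inv112_mult_transpose:
  "inv112 f i * inv112 (transpose_coeffs f) i = inv22 f i * (inv11 f i * inv11 f (i + 1))"
  unfolding inv112_transpose by (simp add: inv112_def inv22_def inv11_def add.assoc)

context vir_coeffs
begin

abbreviation wt :: "int \<Rightarrow> complex" where "wt i \<equiv> \<alpha> + of_int i"

text \<open>
  Three recursions: the invariants are discrete primitives, because the brackets
  \<open>[x\<^sub>-\<^sub>1, x\<^sub>1]\<close>, \<open>[x\<^sub>1, x\<^sub>-\<^sub>2]\<close> and \<open>[x\<^sub>-\<^sub>2, x\<^sub>2]\<close> reproduce \<open>x\<^sub>0\<close>, \<open>x\<^sub>-\<^sub>1\<close> and \<open>x\<^sub>0\<close> with \<open>C\<close>.
  So \<open>inv11\<close> is quadratic in the weight and \<open>inv112\<close> cubic, with no condition on the vanishing of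
  single coefficients.
\<close>

lemma inv11_step: "i \<in> S \<Longrightarrow> inv11 f i = inv11 f (i - 1) + 2 * wt i"
  using bracket[of 1 i "- 1"] weight[of i] by (simp add: inv11_def algebra_simps)

lemma inv112_step: "inv112 f i = inv112 f (i - 1) + 3 * inv11 f i"
proof -
  have *: "f (- 2) (i + 1) * f 1 (i - 1) - f 1 (i + 1) * f (- 2) (i + 2) = - 3 * f (- 1) (i + 1)"
    using bracket[of "- 2" "i + 1" 1] by (simp add: algebra_simps)
  have "f 1 i * (f (- 2) (i + 1) * f 1 (i - 1) - f 1 (i + 1) * f (- 2) (i + 2)) = f 1 i * (- 3 * f (- 1) (i + 1))"
    by (simp only: *)
  then show ?thesis by (simp add: inv112_def inv11_def algebra_simps)
qed

lemma inv22_step: "i \<in> S \<Longrightarrow> inv22 f i = inv22 f (i - 2) + 4 * wt i - c i / 2"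
  using bracket[of 2 i "- 2"] weight[of i] by (simp add: inv22_def algebra_simps)

lemma central_step: "inv11 f i \<noteq> 0 \<Longrightarrow> c (i + 1) = c i"
  using central[of 1 i] by (auto simp: inv11_def)

end

lemma int_step_const:
  fixes g :: "int \<Rightarrow> 'a"
  assumes "l \<le> i" and "\<And>i. l < i \<Longrightarrow> i \<le> u \<Longrightarrow> g i = g (i - 1)" and "i \<le> u"
  shows "g i = g l"
  using assms(1,3)
proof (induction i rule: int_ge_induct)
  case (step i)
  then show ?case using assms(2)[of "i + 1"] by simp
qed simp

lemma int_step_const_all:
  fixes g :: "int \<Rightarrow> 'a"
  assumes "\<And>i. g i = g (i - 1)"
  shows "g i = g 0"
proof (cases "0 \<le> i")
  case True
  then show ?thesis using int_step_const[of 0 i i g] assms by blast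
next
  case False
  then have "i \<le> 0" by simp
  then have "g 0 = g i" using int_step_const[of i 0 0 g] assms by blast
  then show ?thesis ..
qed


context vir_coeffs
begin

lemma inv11_interval:
  assumes "\<And>k. l < k \<Longrightarrow> k \<le> u \<Longrightarrow> k \<in> S"
    and "inv11 f l = wt l * (wt l + 1) + \<rho>" and i: "l \<le> i" "i \<le> u"
  shows "inv11 f i = wt i * (wt i + 1) + \<rho>"
proof -
  have "inv11 f i - wt i * (wt i + 1) = inv11 f l - wt l * (wt l + 1)"
  proof (rule int_step_const[OF i(1) _ i(2), of "\<lambda>i. inv11 f i - wt i * (wt i + 1)"])
    fix i assume "l < i" "i \<le> u"
    then show "inv11 f i - wt i * (wt i + 1) = inv11 f (i - 1) - wt (i - 1) * (wt (i - 1) + 1)"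
      using inv11_step[of i] assms(1)[of i] by (simp add: algebra_simps)
  qed
  then show ?thesis using assms(2) by (simp add: algebra_simps)
qed

text \<open>
  The primitive of \<open>3 (w (w + 1) + \<rho>)\<close>, normalised to be odd about \<open>w = -1\<close>.
\<close>

definition cubic :: "complex \<Rightarrow> int \<Rightarrow> complex"
  where "cubic \<rho> i = (wt i + 1) ^ 3 + (3 * \<rho> - 1) * (wt i + 1)"

lemma cubic_step: "cubic \<rho> i = cubic \<rho> (i - 1) + 3 * (wt i * (wt i + 1) + \<rho>)"
proof -
  have "(w + 1) ^ 3 + (3 * \<rho> - 1) * (w + 1) = w ^ 3 + (3 * \<rho> - 1) * w + 3 * (w * (w + 1) + \<rho>)" for w
    by (simp add: algebra_simps eval_nat_numeral)
  then show ?thesis by (simp add: cubic_def)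
qed

text \<open>
  For \<open>D\<close> of this form the two cubics \<open>cubic \<rho> \<plusminus> D\<close> have as product the quadratic
  \<open>(w + 1)\<^sup>2 + 4 \<rho> - 1\<close> times two consecutive values of \<open>inv11\<close>; it is the candidate for \<open>inv22\<close>.
\<close>

lemma cubic_square:
  assumes "D\<^sup>2 = (1 - 4 * \<rho>) * \<rho>\<^sup>2"
  shows "(cubic \<rho> i)\<^sup>2 - D\<^sup>2 =
    ((wt i + 1)\<^sup>2 + 4 * \<rho> - 1) * ((wt i * (wt i + 1) + \<rho>) * (wt (i + 1) * (wt (i + 1) + 1) + \<rho>))"
proof -
  have "((w + 1) ^ 3 + (3 * \<rho> - 1) * (w + 1))\<^sup>2 - (1 - 4 * \<rho>) * \<rho>\<^sup>2 =
    ((w + 1)\<^sup>2 + 4 * \<rho> - 1) * ((w * (w + 1) + \<rho>) * ((w + 1) * (w + 1 + 1) + \<rho>))" for w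
    by (simp add: algebra_simps eval_nat_numeral)
  then show ?thesis unfolding assms cubic_def by (simp add: add.assoc[of \<alpha>, symmetric])
qed

lemma inv112_interval:
  assumes "\<And>k. l < k \<Longrightarrow> k \<le> u \<Longrightarrow> inv11 f k = wt k * (wt k + 1) + \<rho>"
    and D: "inv112 f l = cubic \<rho> l + D" and i: "l \<le> i" "i \<le> u"
  shows "inv112 f i = cubic \<rho> i + D"
proof -
  have "inv112 f i - cubic \<rho> i = inv112 f l - cubic \<rho> l"
  proof (rule int_step_const[OF i(1) _ i(2), of "\<lambda>i. inv112 f i - cubic \<rho> i"])
    fix i assume "l < i" "i \<le> u"
    then have "inv112 f i = inv112 f (i - 1) + 3 * (wt i * (wt i + 1) + \<rho>)"
      using assms(1)[of i] inv112_step[of i] by simp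
    then show "inv112 f i - cubic \<rho> i = inv112 f (i - 1) - cubic \<rho> (i - 1)"
      using cubic_step[of \<rho> i] by simp
  qed
  then show ?thesis using D by (simp add: algebra_simps)
qed

end

lemma quintic_vanishing_on_progression:
  fixes a0 a1 a2 a3 a4 a5 x :: complex
  assumes "\<And>k::nat. poly [:a0, a1, a2, a3, a4, a5:] (x + 2 * of_nat k) = 0"
  shows "a0 = 0 \<and> a1 = 0 \<and> a2 = 0 \<and> a3 = 0 \<and> a4 = 0 \<and> a5 = 0"
proof -
  let ?P = "[:a0, a1, a2, a3, a4, a5:]"
  have "range (\<lambda>k::nat. x + 2 * of_nat k) \<subseteq> {z. poly ?P z = 0}" using assms by blast
  moreover have "infinite (range (\<lambda>k::nat. x + 2 * of_nat k))"
    by (rule range_inj_infinite) (auto intro!: injI)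
  ultimately have "?P = 0"
    using poly_roots_finite finite_subset by blast
  then show ?thesis by simp
qed

text \<open>
  On an upper half line where \<open>inv11\<close> does not vanish, \<open>C\<close> acts as a scalar and \<open>inv22\<close> is a
  quadratic polynomial along every second weight.  The relation \<open>inv112_mult_transpose\<close> then is
  an identity between polynomials of degree six at infinitely many points.  Its coefficient of degree
  five is the central charge, and the others relate the constants of integration \<open>D\<close> and \<open>E\<close>.
\<close>

lemma (in vir_coeffs) tail_invariants:
  assumes S: "\<And>i. N \<le> i \<Longrightarrow> i \<in> S"
    and p: "\<And>i. N \<le> i \<Longrightarrow> inv11 f i = wt i * (wt i + 1) + \<rho>"
    and p0: "\<And>i. N \<le> i \<Longrightarrow> inv11 f i \<noteq> 0"
    and R: "\<And>i. N \<le> i \<Longrightarrow> inv112 f i = cubic \<rho> i + D"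
    and R': "\<And>i. N \<le> i \<Longrightarrow> inv112 (transpose_coeffs f) i = cubic \<rho> i + E"
  shows "E = - D" and "D\<^sup>2 = (1 - 4 * \<rho>) * \<rho>\<^sup>2" and "N \<le> i \<Longrightarrow> c i = 0"
proof -
  have c: "c i = c N" if "N \<le> i" for i
  proof (rule int_step_const[OF that _ order_refl, of c])
    fix j assume "N < j"
    then show "c j = c (j - 1)" using central_step[of "j - 1"] p0[of "j - 1"] by simp
  qed
  define \<gamma> where "\<gamma> = c N / 4"
  define \<tau> where "\<tau> = wt N + 1"
  define \<kappa> where "\<kappa> = inv22 f N - \<tau>\<^sup>2 + \<gamma> * \<tau>"
  have Q: "inv22 f (N + 2 * int k) = (\<tau> + 2 * of_nat k)\<^sup>2 - \<gamma> * (\<tau> + 2 * of_nat k) + \<kappa>" for k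
  proof (induction k)
    case (Suc k)
    have *: "inv22 f (N + 2 * int (Suc k)) = inv22 f (N + 2 * int k) + 4 * wt (N + 2 * int (Suc k)) - 2 * \<gamma>"
      using inv22_step[of "N + 2 * int (Suc k)"] S[of "N + 2 * int (Suc k)"] c[of "N + 2 * int (Suc k)"]
      by (simp add: \<gamma>_def)
    show ?case unfolding * Suc.IH \<tau>_def
      by (simp add: algebra_simps power2_eq_square)
  qed (simp add: \<kappa>_def)
  \<comment> \<open>The difference of the two sides of the relation as a polynomial in \<open>t = w + 1\<close>; the terms of degree six cancel.\<close>
  have "poly [:D * E - \<kappa> * \<rho>\<^sup>2, (3 * \<rho> - 1) * (D + E) + \<gamma> * \<rho>\<^sup>2, (3 * \<rho> - 1)\<^sup>2 - \<rho>\<^sup>2 - \<kappa> * (2 * \<rho> - 1),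
      D + E + \<gamma> * (2 * \<rho> - 1), 4 * \<rho> - 1 - \<kappa>, \<gamma>:] (\<tau> + 2 * of_nat k) = 0" for k
  proof -
    define t where "t = \<tau> + 2 * of_nat k"
    let ?i = "N + 2 * int k"
    have w: "wt ?i = t - 1" "wt (?i + 1) = t" by (simp_all add: t_def \<tau>_def)
    have "inv112 f ?i * inv112 (transpose_coeffs f) ?i = inv22 f ?i * (inv11 f ?i * inv11 f (?i + 1))"
      by (rule inv112_mult_transpose)
    moreover have "inv112 f ?i = t^3 + (3 * \<rho> - 1) * t + D"
      by (subst R, simp, unfold cubic_def w, simp)
    moreover have "inv112 (transpose_coeffs f) ?i = t^3 + (3 * \<rho> - 1) * t + E"
      by (subst R', simp, unfold cubic_def w, simp)
    moreover have "inv11 f ?i = (t - 1) * t + \<rho>" "inv11 f (?i + 1) = t * (t + 1) + \<rho>"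
      by (subst p, simp, unfold w, simp)+
    moreover have "inv22 f ?i = t\<^sup>2 - \<gamma> * t + \<kappa>"
      unfolding t_def by (rule Q)
    ultimately have "(t^3 + (3 * \<rho> - 1) * t + D) * (t^3 + (3 * \<rho> - 1) * t + E) =
        (t\<^sup>2 - \<gamma> * t + \<kappa>) * (((t - 1) * t + \<rho>) * (t * (t + 1) + \<rho>))"
      by simp
    then show ?thesis unfolding t_def[symmetric]
      by (simp add: algebra_simps eval_nat_numeral)
  qed
  then have coeffs: "D * E - \<kappa> * \<rho>\<^sup>2 = 0" "D + E + \<gamma> * (2 * \<rho> - 1) = 0" "4 * \<rho> - 1 - \<kappa> = 0" "\<gamma> = 0"
    using quintic_vanishing_on_progression by blast+
  then show ED: "E = - D" by (simp add: eq_neg_iff_add_eq_0 add.commute)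
  have \<kappa>: "\<kappa> = 4 * \<rho> - 1" using coeffs(3) by simp
  have "D\<^sup>2 = - (D * E)" by (simp add: ED power2_eq_square)
  also have "D * E = \<kappa> * \<rho>\<^sup>2" using coeffs(1) by (simp only: right_minus_eq)
  also have "- (\<kappa> * \<rho>\<^sup>2) = (1 - 4 * \<rho>) * \<rho>\<^sup>2"
    unfolding \<kappa> by (simp add: left_diff_distrib)
  finally show "D\<^sup>2 = (1 - 4 * \<rho>) * \<rho>\<^sup>2" .
  show "N \<le> i \<Longrightarrow> c i = 0" using c[of i] coeffs(4) by (simp add: \<gamma>_def)
qed

text \<open>
  The curve given by the assumption is rational, with parameter \<open>b\<close>; the involution \<open>b \<mapsto> 1 - b\<close>
  fixes \<open>\<rho>\<close> and changes the sign of \<open>D\<close>.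
\<close>

lemma obtain_density_parameter:
  fixes \<rho> D :: complex
  assumes "D\<^sup>2 = (1 - 4 * \<rho>) * \<rho>\<^sup>2"
  obtains b where "\<rho> = b * (1 - b)" "D = b * (b - 1) * (1 - 2 * b)"
proof -
  define s where "s = csqrt (1 - 4 * \<rho>)"
  have s: "s\<^sup>2 = 1 - 4 * \<rho>" by (simp add: s_def)
  have "D\<^sup>2 = (s * \<rho>)\<^sup>2"
    using assms s by (simp add: power_mult_distrib)
  then consider "D = s * \<rho>" | "D = - (s * \<rho>)"
    unfolding power2_eq_iff by blast
  then obtain r where r: "r\<^sup>2 = 1 - 4 * \<rho>" "D = - (r * \<rho>)"
    using s by cases (metis minus_mult_left minus_minus power2_minus, metis)
  define b where "b = (1 - r) / 2"
  have rb: "r = 1 - 2 * b" by (simp add: b_def field_simps)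
  have \<rho>: "\<rho> = b * (1 - b)"
  proof -
    have "4 * \<rho> = 4 * (b * (1 - b))"
      using r(1) unfolding rb by (simp add: algebra_simps power2_eq_square)
    then show ?thesis by simp
  qed
  show thesis
    by (rule that[OF \<rho>]) (simp add: r(2) \<rho> rb algebra_simps)
qed

lemma finite_quadratic_zeros: "finite {i::int. (\<alpha> + of_int i) * (\<alpha> + of_int i + 1) + \<rho> = (0::complex)}"
proof -
  have "of_int ` {i::int. (\<alpha> + of_int i) * (\<alpha> + of_int i + 1) + \<rho> = 0}
      \<subseteq> {z. poly [:\<alpha> * (\<alpha> + 1) + \<rho>, 2 * \<alpha> + 1, 1:] z = 0}"
    by (auto simp: algebra_simps)
  then have "finite (complex_of_int ` {i::int. (\<alpha> + of_int i) * (\<alpha> + of_int i + 1) + \<rho> = 0})"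
    by (rule finite_subset) (rule poly_roots_finite, simp)
  then show ?thesis
    by (rule finite_imageD) (simp add: inj_on_def)
qed

lemma quadratic_zeros_bounded:
  obtains N where "\<And>i. N \<le> i \<Longrightarrow> (\<alpha> + of_int i) * (\<alpha> + of_int i + 1) + \<rho> \<noteq> (0::complex)"
proof -
  obtain M where "\<forall>i\<in>{i::int. (\<alpha> + of_int i) * (\<alpha> + of_int i + 1) + \<rho> = 0}. i \<le> M"
    using bdd_above_finite[OF finite_quadratic_zeros] unfolding bdd_above_def by blast
  then have "(\<alpha> + of_int i) * (\<alpha> + of_int i + 1) + \<rho> \<noteq> 0" if "M + 1 \<le> i" for i
    using that by force
  then show thesis by (rule that)
qed

text \<open>
  The sum of the two roots is \<open>-1\<close>, so a second integer zero is determined by the first one.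
\<close>

lemma quadratic_zeros_cases [case_names none some]:
  obtains "\<And>i::int. (\<alpha> + of_int i) * (\<alpha> + of_int i + 1) + \<rho> \<noteq> (0::complex)"
  | l u :: int where "l \<le> u"
      "\<And>i. (\<alpha> + of_int i) * (\<alpha> + of_int i + 1) + \<rho> = 0 \<longleftrightarrow> i = l \<or> i = u"
proof (cases "\<exists>l::int. (\<alpha> + of_int l) * (\<alpha> + of_int l + 1) + \<rho> = 0")
  case False
  then show thesis using that(1) by blast
next
  let ?w = "\<lambda>i::int. \<alpha> + of_int i"
  case True
  then obtain l :: int where l: "?w l * (?w l + 1) + \<rho> = 0" by blast
  have rt: "?w i * (?w i + 1) + \<rho> = 0 \<longleftrightarrow> i = l \<or> ?w i = - 1 - ?w l" for i
  proof -
    have "?w i * (?w i + 1) + \<rho> = (?w i - ?w l) * (?w i + ?w l + 1) + (?w l * (?w l + 1) + \<rho>)"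
      by (simp add: algebra_simps)
    then have "?w i * (?w i + 1) + \<rho> = 0 \<longleftrightarrow> (?w i - ?w l) * (?w i + ?w l + 1) = 0"
      unfolding l by simp
    also have "\<dots> \<longleftrightarrow> i = l \<or> ?w i = - 1 - ?w l"
      by (simp only: mult_eq_0_iff) (simp add: eq_diff_eq eq_neg_iff_add_eq_0)
    finally show ?thesis .
  qed
  show thesis
  proof (cases "\<exists>u. ?w u = - 1 - ?w l")
    case True
    then obtain u where u: "?w u = - 1 - ?w l" by blast
    then have "?w i = - 1 - ?w l \<longleftrightarrow> i = u" for i
      by (metis add_left_imp_eq of_int_eq_iff)
    then have zeros: "?w i * (?w i + 1) + \<rho> = 0 \<longleftrightarrow> i = l \<or> i = u" for i
      unfolding rt by blast
    show thesis
      by (rule that(2)[of "min l u" "max l u"]) (unfold zeros, auto simp: min_def max_def)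
  next
    case False
    then have "?w i * (?w i + 1) + \<rho> = 0 \<longleftrightarrow> i = l \<or> i = l" for i
      unfolding rt by blast
    then show thesis by (rule that(2)[OF order_refl])
  qed
qed

text \<open>
  All invariants agree with those of a density module \<open>\<A>\<^sub>\<alpha>\<^sub>,\<^sub>b\<^sub>,\<^sub>0\<close>.  For \<open>inv11\<close> and \<open>inv112\<close>
  this is integration of the recursions.  The relation \<open>inv112_mult_transpose\<close> gives \<open>inv22\<close> except
  next to the at most two zeros \<open>l \<le> u\<close> of \<open>inv11\<close>.  The recursion of \<open>inv22\<close> reaches the exceptional
  indices near \<open>u\<close> from above and those near \<open>l\<close> from below, because \<open>C\<close> is constant on each
  interval between zeros and vanishes on the two unbounded ones.
\<close>

lemma (in vir_coeffs) invariants: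
  assumes full: "S = UNIV"
  obtains b where
    "\<And>i. inv11 f i = (wt i + b) * (wt i + 1 - b)"
    "\<And>i. inv22 f i = (wt i + 2 * b) * (wt i + 2 - 2 * b)"
    "\<And>i. inv112 f i = (wt i + b) * (wt i + 1 + b) * (wt i + 2 - 2 * b)"
    "\<And>i. inv112 (transpose_coeffs f) i = (wt i + 1 - b) * (wt i + 2 - b) * (wt i + 2 * b)"
    "\<And>i. c i = 0"
proof -
  interpret T: vir_coeffs S \<alpha> "transpose_coeffs f" c
    by (rule vir_coeffs_transpose) (rule vir_coeffs_axioms)
  define \<rho> where "\<rho> = inv11 f 0 - wt 0 * (wt 0 + 1)"
  define D where "D = inv112 f 0 - cubic \<rho> 0"
  define E where "E = inv112 (transpose_coeffs f) 0 - cubic \<rho> 0"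
  have p: "inv11 f i = wt i * (wt i + 1) + \<rho>" for i
  proof -
    have "inv11 f i - wt i * (wt i + 1) = inv11 f 0 - wt 0 * (wt 0 + 1)"
    proof (rule int_step_const_all[of "\<lambda>i. inv11 f i - wt i * (wt i + 1)"])
      fix i
      show "inv11 f i - wt i * (wt i + 1) = inv11 f (i - 1) - wt (i - 1) * (wt (i - 1) + 1)"
        using inv11_step[of i] by (simp add: full algebra_simps)
    qed
    then show ?thesis unfolding \<rho>_def by (simp add: algebra_simps)
  qed
  have R_general: "inv112 g i = cubic \<rho> i + (inv112 g 0 - cubic \<rho> 0)"
    if "\<And>i. inv112 g i = inv112 g (i - 1) + 3 * inv11 f i" for g i
  proof -
    have "inv112 g i - cubic \<rho> i = inv112 g 0 - cubic \<rho> 0"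
    proof (rule int_step_const_all[of "\<lambda>i. inv112 g i - cubic \<rho> i"])
      fix i
      show "inv112 g i - cubic \<rho> i = inv112 g (i - 1) - cubic \<rho> (i - 1)"
        using that[of i] p[of i] cubic_step[of \<rho> i] by simp
    qed
    then show ?thesis by (simp add: algebra_simps)
  qed
  have R: "inv112 f i = cubic \<rho> i + D" for i
    unfolding D_def by (rule R_general) (rule inv112_step)
  have R': "inv112 (transpose_coeffs f) i = cubic \<rho> i + E" for i
    unfolding E_def by (rule R_general) (rule T.inv112_step[unfolded inv11_transpose])
  obtain N where N: "\<And>i. N \<le> i \<Longrightarrow> inv11 f i \<noteq> 0"
    unfolding p using quadratic_zeros_bounded by blast
  note tail = tail_invariants[OF _ p _ R R']
  have ED: "E = - D" and D2: "D\<^sup>2 = (1 - 4 * \<rho>) * \<rho>\<^sup>2"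
    using tail(1,2)[of N] N full by blast+
  define q where "q i = (wt i + 1)\<^sup>2 + 4 * \<rho> - 1" for i
  have RR: "inv22 f i * (inv11 f i * inv11 f (i + 1)) = q i * (inv11 f i * inv11 f (i + 1))" for i
  proof -
    have "inv22 f i * (inv11 f i * inv11 f (i + 1)) = (cubic \<rho> i)\<^sup>2 - D\<^sup>2"
      unfolding inv112_mult_transpose[symmetric] R R' ED by (simp add: power2_eq_square algebra_simps)
    also have "\<dots> = q i * (inv11 f i * inv11 f (i + 1))"
      unfolding cubic_square[OF D2] p q_def ..
    finally show ?thesis .
  qed
  have q1: "inv22 f i = q i" if "inv11 f i \<noteq> 0" "inv11 f (i + 1) \<noteq> 0" for i
    using RR[of i] that by simp
  have q_step: "q i = q (i - 2) + 4 * wt i" for i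
    by (simp add: q_def power2_eq_square algebra_simps)
  have cq: "c i = 0" if "inv22 f i = q i" "inv22 f (i - 2) = q (i - 2)" for i
    using inv22_step[of i] q_step[of i] that full by simp
  have Q: "inv22 f i = q i" for i
  proof (cases \<alpha> \<rho> rule: quadratic_zeros_cases)
    case none
    then have "inv11 f j \<noteq> 0" for j unfolding p by blast
    then show ?thesis using q1 by blast
  next
    case (some l u)
    then have nz: "inv11 f i \<noteq> 0 \<longleftrightarrow> i \<noteq> l \<and> i \<noteq> u" for i by (simp add: p)
    have q2: "inv22 f i = q i" if "i \<noteq> l" "i \<noteq> u" "i \<noteq> l - 1" "i \<noteq> u - 1" for i
      using that q1[of i] nz by auto
    have cu: "c i = 0" if "u < i" for i
      using tail(3)[of "u + 1" i] nz some(1) that full by auto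
    have "c (l - 2) = 0"
      using cq[of "l - 2"] q2[of "l - 2"] q2[of "l - 4"] some(1) by auto
    then have cl: "c l = 0" "c (l - 1) = 0"
      using central_step[of "l - 1"] central_step[of "l - 2"] nz some(1) by auto
    \<comment> \<open>Reached from below, with \<open>C\<close> vanishing at \<open>l\<close> and \<open>l - 1\<close>.\<close>
    have "inv22 f l = q l" "inv22 f (l - 1) = q (l - 1)"
      using inv22_step[of l] inv22_step[of "l - 1"] q_step[of l] q_step[of "l - 1"] cl some(1)
        q2[of "l - 2"] q2[of "l - 3"] full by auto
    \<comment> \<open>Reached from above, with \<open>C\<close> vanishing beyond \<open>u\<close>.\<close>
    moreover have "inv22 f u = q u" "inv22 f (u - 1) = q (u - 1)"
      using inv22_step[of "u + 2"] inv22_step[of "u + 1"] q_step[of "u + 2"] q_step[of "u + 1"]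
        cu[of "u + 1"] cu[of "u + 2"] some(1) q2[of "u + 2"] q2[of "u + 1"] full by auto
    ultimately show ?thesis using q2[of i] by auto
  qed
  obtain b where b: "\<rho> = b * (1 - b)" "D = b * (b - 1) * (1 - 2 * b)"
    using D2 by (rule obtain_density_parameter)
  show thesis
  proof (rule that[of b])
    fix i
    show "inv11 f i = (wt i + b) * (wt i + 1 - b)"
      unfolding p b by (simp add: algebra_simps)
    show "inv22 f i = (wt i + 2 * b) * (wt i + 2 - 2 * b)"
      unfolding Q q_def b by (simp add: algebra_simps power2_eq_square)
    have "(w + 1) ^ 3 + (3 * (b * (1 - b)) - 1) * (w + 1) + b * (b - 1) * (1 - 2 * b) =
      (w + b) * (w + 1 + b) * (w + 2 - 2 * b)"
      "(w + 1) ^ 3 + (3 * (b * (1 - b)) - 1) * (w + 1) - b * (b - 1) * (1 - 2 * b) =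
      (w + 1 - b) * (w + 2 - b) * (w + 2 * b)" for w :: complex
      by (simp_all add: algebra_simps eval_nat_numeral)
    then show "inv112 f i = (wt i + b) * (wt i + 1 + b) * (wt i + 2 - 2 * b)"
      "inv112 (transpose_coeffs f) i = (wt i + 1 - b) * (wt i + 2 - b) * (wt i + 2 * b)"
      unfolding R R' ED cubic_def b by simp_all
    show "c i = 0" by (rule cq) (rule Q)+
  qed
qed

section \<open>Rescaling the weight vectors\<close>

text \<open>
  The coefficients after replacing \<open>v\<^sub>i\<close> by \<open>v\<^sub>i / \<mu> i\<close>.
\<close>

definition gauge :: "(int \<Rightarrow> complex) \<Rightarrow> (int \<Rightarrow> int \<Rightarrow> complex) \<Rightarrow> int \<Rightarrow> int \<Rightarrow> complex"
  where "gauge \<mu> f m i = f m i * \<mu> (i + m) / \<mu> i"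

definition gauge_equiv :: "(int \<Rightarrow> int \<Rightarrow> complex) \<Rightarrow> (int \<Rightarrow> int \<Rightarrow> complex) \<Rightarrow> bool"
  where "gauge_equiv f F \<longleftrightarrow> (\<exists>\<mu>. (\<forall>i. \<mu> i \<noteq> 0) \<and> gauge \<mu> f = F)"

lemma gauge_equiv_refl: "gauge_equiv f f"
  unfolding gauge_equiv_def by (rule exI[of _ "\<lambda>_. 1"]) (auto simp: gauge_def fun_eq_iff)

lemma gauge_equivI: "(\<And>i. \<mu> i \<noteq> 0) \<Longrightarrow> gauge_equiv f (gauge \<mu> f)"
  unfolding gauge_equiv_def by (rule exI[of _ \<mu>]) simp

lemma gauge_equiv_trans:
  assumes "gauge_equiv f g" "gauge_equiv g h" shows "gauge_equiv f h"
proof -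
  obtain \<mu> \<nu> where "\<And>i. \<mu> i \<noteq> 0" "gauge \<mu> f = g" "\<And>i. \<nu> i \<noteq> 0" "gauge \<nu> g = h"
    using assms unfolding gauge_equiv_def by blast
  moreover have "gauge (\<lambda>i. \<nu> i * \<mu> i) f = gauge \<nu> (gauge \<mu> f)"
    by (simp add: gauge_def fun_eq_iff field_simps)
  ultimately show ?thesis using gauge_equivI[of "\<lambda>i. \<nu> i * \<mu> i" f] by simp
qed

lemma gauge_equiv_transpose:
  assumes "gauge_equiv (transpose_coeffs f) F" shows "gauge_equiv f (transpose_coeffs F)"
proof -
  obtain \<mu> where \<mu>: "\<And>i. \<mu> i \<noteq> 0" and F: "gauge \<mu> (transpose_coeffs f) = F"
    using assms unfolding gauge_equiv_def by blast
  have "gauge (\<lambda>i. inverse (\<mu> i)) f = transpose_coeffs F"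
    unfolding F[symmetric] by (simp add: gauge_def transpose_coeffs_def fun_eq_iff field_simps \<mu>)
  then show ?thesis using gauge_equivI[of "\<lambda>i. inverse (\<mu> i)" f] \<mu> by simp
qed

lemma vir_coeffs_gauge:
  assumes "vir_coeffs S \<alpha> f c" and \<mu>: "\<And>i. \<mu> i \<noteq> 0"
  shows "vir_coeffs S \<alpha> (gauge \<mu> f) c"
proof -
  interpret vir_coeffs S \<alpha> f c by fact
  show ?thesis
  proof
    fix m n i
    have "gauge \<mu> f m i * gauge \<mu> f n (i + m) - gauge \<mu> f n i * gauge \<mu> f m (i + n) =
      (f m i * f n (i + m) - f n i * f m (i + n)) * \<mu> (i + (m + n)) / \<mu> i"
      by (simp add: gauge_def \<mu> add.assoc add.commute[of n m] field_simps)
    then show "gauge \<mu> f m i * gauge \<mu> f n (i + m) - gauge \<mu> f n i * gauge \<mu> f m (i + n) =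
      of_int (m - n) * gauge \<mu> f (m + n) i + (if n = - m then of_int (n ^ 3 - n) / 12 * c i else 0)"
      unfolding bracket using \<mu> by (simp add: gauge_def field_simps)
    show "gauge \<mu> f m i * c (i + m) = gauge \<mu> f m i * c i"
      using central[of m i] by (auto simp: gauge_def)
  qed (simp_all add: gauge_def \<mu> outside_source outside_target weight)
qed

definition same_invariants :: "(int \<Rightarrow> int \<Rightarrow> complex) \<Rightarrow> (int \<Rightarrow> int \<Rightarrow> complex) \<Rightarrow> bool"
  where "same_invariants f F \<longleftrightarrow> inv11 f = inv11 F \<and> inv22 f = inv22 F \<and> inv112 f = inv112 F \<and>
    inv112 (transpose_coeffs f) = inv112 (transpose_coeffs F)"

lemma same_invariants_transpose:
  "same_invariants f F \<Longrightarrow> same_invariants (transpose_coeffs f) (transpose_coeffs F)"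
  by (simp add: same_invariants_def)

lemma same_invariants_gauge:
  assumes "\<And>i. \<mu> i \<noteq> 0" shows "same_invariants (gauge \<mu> f) F \<longleftrightarrow> same_invariants f F"
proof -
  have "inv11 (gauge \<mu> f) = inv11 f" "inv22 (gauge \<mu> f) = inv22 f" "inv112 (gauge \<mu> f) = inv112 f"
    "inv112 (transpose_coeffs (gauge \<mu> f)) = inv112 (transpose_coeffs f)"
    by (simp_all add: fun_eq_iff inv112_transpose, simp_all add: inv11_def inv22_def inv112_def gauge_def assms add_ac)
  then show ?thesis by (simp add: same_invariants_def)
qed

text \<open>
  The elements of degree \<open>\<plusminus>1\<close> and \<open>\<plusminus>2\<close> generate all \<open>x\<^sub>m\<close> with \<open>m \<noteq> 0\<close>; no central term
  occurs in the brackets of \<open>x\<^sub>1\<close> with \<open>x\<^sub>m\<close> and of \<open>x\<^sub>-\<^sub>1\<close> with \<open>x\<^sub>-\<^sub>m\<close> for \<open>m \<ge> 2\<close>.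
\<close>

lemma vir_coeffs_eqI:
  assumes "vir_coeffs S \<alpha> f c" "vir_coeffs S \<alpha> F c'"
    and eq: "\<And>i. f 1 i = F 1 i" "\<And>i. f (- 1) i = F (- 1) i" "\<And>i. f 2 i = F 2 i" "\<And>i. f (- 2) i = F (- 2) i"
  shows "f = F"
proof -
  interpret f: vir_coeffs S \<alpha> f c by fact
  interpret F: vir_coeffs S \<alpha> F c' by fact
  have pos: "f (int n) i = F (int n) i \<and> f (- int n) i = F (- int n) i" if "2 \<le> n" for n i
    using that
  proof (induction n arbitrary: i rule: nat_induct_at_least)
    case base
    then show ?case using eq by simp
  next
    case (Suc n)
    have "of_int (int n - 1) * f (int n + 1) i = of_int (int n - 1) * F (int n + 1) i"
      using f.bracket[of "int n" i 1] F.bracket[of "int n" i 1] Suc eq by simp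
    moreover have "of_int (- int n + 1) * f (- int n - 1) i = of_int (- int n + 1) * F (- int n - 1) i"
      using f.bracket[of "- int n" i "- 1"] F.bracket[of "- int n" i "- 1"] Suc eq by simp
    moreover have "complex_of_int (int n - 1) \<noteq> 0" "complex_of_int (- int n + 1) \<noteq> 0"
      using Suc.hyps by auto
    ultimately show ?case
      by (metis mult_left_cancel add.commute of_nat_Suc minus_add_distrib uminus_add_conv_diff diff_conv_add_uminus)
  qed
  show ?thesis
  proof (intro ext)
    fix m i
    consider "m = 0" | "m = 1" | "m = - 1" | "m = int (nat m)" "2 \<le> nat m" | "m = - int (nat (- m))" "2 \<le> nat (- m)"
      by linarith
    then show "f m i = F m i"
    proof cases
      case 1
      then show ?thesis using f.weight F.weight f.outside_source F.outside_source by (cases "i \<in> S") auto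
    qed (use eq pos in metis)+
  qed
qed

section \<open>Normal form by density modules\<close>

definition density_coeffs :: "complex \<Rightarrow> complex \<Rightarrow> int \<Rightarrow> int \<Rightarrow> complex"
  where "density_coeffs a b m i = a + of_int i + b * of_int m"

lemma vir_coeffs_density: "vir_coeffs UNIV a (density_coeffs a b) (\<lambda>_. 0)"
  by unfold_locales (simp_all add: density_coeffs_def algebra_simps)

lemma transpose_density: "transpose_coeffs (density_coeffs a b) = density_coeffs a (1 - b)"
  by (intro ext) (simp add: transpose_coeffs_def density_coeffs_def algebra_simps)

lemma density_invariants:
  "inv11 (density_coeffs a b) i = (a + of_int i + b) * (a + of_int i + 1 - b)"
  "inv22 (density_coeffs a b) i = (a + of_int i + 2 * b) * (a + of_int i + 2 - 2 * b)"
  "inv112 (density_coeffs a b) i = (a + of_int i + b) * (a + of_int i + 1 + b) * (a + of_int i + 2 - 2 * b)"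
  by (simp_all add: inv11_def inv22_def inv112_def density_coeffs_def algebra_simps)

lemma (in vir_coeffs) same_invariants_density:
  assumes "S = UNIV"
  obtains b where "same_invariants f (density_coeffs \<alpha> b)" "\<And>i. c i = 0"
proof -
  obtain b where b: "\<And>i. inv11 f i = (wt i + b) * (wt i + 1 - b)"
    "\<And>i. inv22 f i = (wt i + 2 * b) * (wt i + 2 - 2 * b)"
    "\<And>i. inv112 f i = (wt i + b) * (wt i + 1 + b) * (wt i + 2 - 2 * b)"
    "\<And>i. inv112 (transpose_coeffs f) i = (wt i + 1 - b) * (wt i + 2 - b) * (wt i + 2 * b)"
    "\<And>i. c i = 0"
    using invariants[OF assms] by blast
  have "same_invariants f (density_coeffs \<alpha> b)"
    unfolding same_invariants_def fun_eq_iff transpose_density density_invariants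
    using b(1-4) by (auto simp: algebra_simps)
  then show thesis using b(5) that by blast
qed

lemma exists_cumulative_product:
  fixes r :: "int \<Rightarrow> complex"
  assumes r: "\<And>i. r i \<noteq> 0"
  obtains \<mu> where "\<And>i. \<mu> i \<noteq> 0" "\<And>i. \<mu> (i + 1) = r i * \<mu> i"
proof
  let ?\<mu> = "\<lambda>i. if 0 \<le> i then \<Prod>k<nat i. r (int k) else inverse (\<Prod>k<nat (- i). r (- 1 - int k))"
  show "?\<mu> i \<noteq> 0" for i by (simp add: r)
  show "?\<mu> (i + 1) = r i * ?\<mu> i" for i
  proof (cases "0 \<le> i")
    case True
    then have "nat (i + 1) = Suc (nat i)" by simp
    then show ?thesis using True by simp
  next
    case False
    then obtain n where n: "i = - int (Suc n)"
      by (metis int_cases linorder_not_le not_le of_nat_0_le_iff)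
    have "nat (- i) = Suc n" "nat (- (i + 1)) = n" "- 1 - int n = i" using n by auto
    then show ?thesis using r[of i] False by (cases "i + 1 = 0") auto
  qed
qed

text \<open>
  The invariant \<open>inv11\<close> only tells that one of \<open>x\<^sub>1\<close> on \<open>v\<^sub>i\<close> and \<open>x\<^sub>-\<^sub>1\<close> on \<open>v\<^sub>i\<^sub>+\<^sub>1\<close> vanishes.
  At such an index the two cubic invariants are usually not both zero, and this decides which one it
  is.  For \<open>b = 1/2\<close> they do both vanish, but there \<open>inv22\<close> is not zero, so both maps vanish.  The cases
  \<open>b \<in> {0, 1}\<close> with integral weights are the ones in which no invariant helps.
\<close>

lemma degree_one_zeros:
  assumes inv: "same_invariants f (density_coeffs a b)" and reg: "b \<in> {0, 1} \<Longrightarrow> a \<notin> \<int>"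
  shows "f 1 i = 0 \<longleftrightarrow> density_coeffs a b 1 i = 0"
proof -
  let ?w = "a + of_int i"
  have int: "a \<in> \<int>" if "?w \<in> \<int>"
    using Ints_diff[OF that, of "of_int i"] by simp
  have 11: "f 1 j * f (- 1) (j + 1) = (a + of_int j + b) * (a + of_int j + 1 - b)" for j
    using inv by (simp add: same_invariants_def density_invariants flip: inv11_def)
  have 22: "f 2 i * f (- 2) (i + 2) = (?w + 2 * b) * (?w + 2 - 2 * b)"
    using inv by (simp add: same_invariants_def density_invariants flip: inv22_def)
  have 112: "f 1 i * f 1 (i + 1) * f (- 2) (i + 2) = (?w + b) * (?w + 1 + b) * (?w + 2 - 2 * b)"
    using inv by (simp add: same_invariants_def density_invariants flip: inv112_def)
  have e112t: "f 2 i * f (- 1) (i + 1) * f (- 1) (i + 2) = (?w + 1 - b) * (?w + 2 - b) * (?w + 2 * b)"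
    using inv unfolding inv112_transpose[symmetric]
    by (simp add: same_invariants_def transpose_density) (simp add: density_invariants algebra_simps)
  have d: "density_coeffs a b 1 i = 0 \<longleftrightarrow> ?w + b = 0"
    by (simp add: density_coeffs_def)
  show ?thesis unfolding d
  proof
    assume f: "f 1 i = 0"
    show "?w + b = 0"
    proof (rule ccontr)
      assume nz: "?w + b \<noteq> 0"
      then have w: "?w = b - 1" using 11[of i] f by (simp add: eq_diff_eq)
      have "(2 * b - 1) * (2 * b) * (1 - b) = 0"
        using 112 f unfolding w by simp
      moreover have "2 * b - 1 \<noteq> 0" using nz unfolding w by (simp add: algebra_simps)
      ultimately have "b \<in> {0, 1}" by auto
      then show False using reg int w by auto
    qed
  next
    assume "?w + b = 0"
    then have w: "?w = - b" by (simp add: eq_neg_iff_add_eq_0)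
    show "f 1 i = 0"
    proof (cases "b = 1/2")
      case True
      have "f 1 (i + 1) \<noteq> 0" using 11[of "i + 1"] w True by (auto simp: add.assoc[symmetric])
      moreover have "f (- 2) (i + 2) \<noteq> 0" using 22 unfolding w True by auto
      ultimately show ?thesis using 112 unfolding w by auto
    next
      case False
      have "b \<notin> {0, 1}" using reg int unfolding w by auto
      moreover have "1 - 2 * b \<noteq> 0" using False by (simp add: field_simps)
      ultimately have "(1 - 2 * b) * (2 - 2 * b) * b \<noteq> 0" by simp
      then have "f (- 1) (i + 1) \<noteq> 0" using e112t unfolding w by (auto simp: algebra_simps)
      then show ?thesis using 11[of i] unfolding w by simp
    qed
  qed
qed

lemma degree_one_normalization:
  assumes inv: "same_invariants f (density_coeffs a b)" and reg: "b \<in> {0, 1} \<Longrightarrow> a \<notin> \<int>"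
  obtains \<mu> where "\<And>i. \<mu> i \<noteq> 0" "\<And>i. gauge \<mu> f 1 i = density_coeffs a b 1 i"
    "\<And>i. gauge \<mu> f (- 1) i = density_coeffs a b (- 1) i"
proof -
  let ?F = "density_coeffs a b"
  have z1: "f 1 i = 0 \<longleftrightarrow> ?F 1 i = 0" for i
    by (rule degree_one_zeros[OF inv reg])
  have z2: "f (- 1) (i + 1) = 0 \<longleftrightarrow> ?F (- 1) (i + 1) = 0" for i
    using degree_one_zeros[of "transpose_coeffs f" a "1 - b" i] same_invariants_transpose[OF inv] reg
    unfolding transpose_density[symmetric] by (auto simp: transpose_coeffs_def)
  have 11: "f 1 i * f (- 1) (i + 1) = ?F 1 i * ?F (- 1) (i + 1)" for i
    using inv by (simp add: same_invariants_def flip: inv11_def)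
  \<comment> \<open>If both coefficients between \<open>i\<close> and \<open>i + 1\<close> vanish, the ratio is arbitrary.\<close>
  define r where "r i = (if ?F 1 i \<noteq> 0 then ?F 1 i / f 1 i else
      if ?F (- 1) (i + 1) \<noteq> 0 then f (- 1) (i + 1) / ?F (- 1) (i + 1) else 1)" for i
  have "r i \<noteq> 0" for i using z1[of i] z2[of i] by (auto simp: r_def)
  then obtain \<mu> where \<mu>: "\<And>i. \<mu> i \<noteq> 0" "\<And>i. \<mu> (i + 1) = r i * \<mu> i"
    using exists_cumulative_product[of r] by blast
  show thesis
  proof (rule that[OF \<mu>(1)])
    show "gauge \<mu> f 1 i = ?F 1 i" for i
      using z1[of i] by (auto simp: gauge_def \<mu> r_def)
    have "gauge \<mu> f (- 1) (i + 1) = ?F (- 1) (i + 1)" for i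
    proof -
      have "gauge \<mu> f (- 1) (i + 1) = f (- 1) (i + 1) / r i"
        using \<mu>(1)[of i] by (simp add: gauge_def \<mu>(2))
      then show ?thesis
        using z1[of i] z2[of i] 11[of i] by (auto simp: r_def divide_simps mult.commute)
    qed
    from this[of "i - 1" for i] show "gauge \<mu> f (- 1) i = ?F (- 1) i" for i by simp
  qed
qed

text \<open>
  Where \<open>x\<^sub>1\<close> acts twice without a zero the cubic invariant determines \<open>x\<^sub>-\<^sub>2\<close>.  Next to a zero of \<open>x\<^sub>1\<close>
  the transposed cubic invariant determines \<open>x\<^sub>2\<close> instead, with a nonzero value, and then \<open>inv22\<close>
  determines \<open>x\<^sub>-\<^sub>2\<close>.
\<close>

lemma degree_minus_two_eq:
  assumes inv: "same_invariants f (density_coeffs a b)" and reg: "b \<in> {0, 1} \<Longrightarrow> a \<notin> \<int>"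
    and half: "b = 1/2 \<Longrightarrow> density_coeffs a b 1 i \<noteq> 0 \<and> density_coeffs a b 1 (i + 1) \<noteq> 0"
    and eq: "\<And>i. f 1 i = density_coeffs a b 1 i" "\<And>i. f (- 1) i = density_coeffs a b (- 1) i"
  shows "f (- 2) (i + 2) = density_coeffs a b (- 2) (i + 2)"
proof (cases "density_coeffs a b 1 i \<noteq> 0 \<and> density_coeffs a b 1 (i + 1) \<noteq> 0")
  case True
  have "inv112 f i = inv112 (density_coeffs a b) i"
    using inv by (simp add: same_invariants_def)
  then show ?thesis using True by (simp add: inv112_def eq)
next
  case False
  let ?F = "density_coeffs a b" and ?w = "a + of_int i"
  have w: "?w = - b \<or> ?w = - 1 - b"
    using False by (auto simp: density_coeffs_def eq_neg_iff_add_eq_0 algebra_simps)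
  then have "a = - b - of_int i \<or> a = - 1 - b - of_int i"
    by (auto simp: eq_diff_eq)
  then have "b \<in> \<int> \<Longrightarrow> a \<in> \<int>" by auto
  then have b: "b \<noteq> 0" "b \<noteq> 1" "b \<noteq> 1/2" using reg half False by auto
  then have "1 - 2 * b \<noteq> 0" by (simp add: field_simps)
  have "?F (- 1) (i + 1) = ?w + 1 - b" "?F (- 1) (i + 2) = ?w + 2 - b" "?F 2 i = ?w + 2 * b"
    by (simp_all add: density_coeffs_def)
  then consider "?F (- 1) (i + 1) = 1 - 2 * b" "?F (- 1) (i + 2) = 2 * (1 - b)" "?F 2 i = b"
    | "?F (- 1) (i + 1) = - (2 * b)" "?F (- 1) (i + 2) = 1 - 2 * b" "?F 2 i = b - 1"
    using w by fastforce
  then have nz: "?F (- 1) (i + 1) \<noteq> 0 \<and> ?F (- 1) (i + 2) \<noteq> 0 \<and> ?F 2 i \<noteq> 0"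
  proof cases
    case 1
    show ?thesis unfolding 1 using b \<open>1 - 2 * b \<noteq> 0\<close> by simp
  next
    case 2
    show ?thesis unfolding 2 using b \<open>1 - 2 * b \<noteq> 0\<close> by simp
  qed
  have "inv112 (transpose_coeffs f) i = inv112 (transpose_coeffs ?F) i" and 22: "inv22 f i = inv22 ?F i"
    using inv by (simp_all add: same_invariants_def)
  then have "f 2 i = ?F 2 i" using nz by (simp add: inv112_transpose eq)
  then show ?thesis using 22 nz by (simp add: inv22_def)
qed

text \<open>
  Once the part of degree one is normalised, \<open>degree_minus_two_eq\<close> and its transpose give the part of
  degree two.  For \<open>b = 1/2\<close> with a zero of \<open>x\<^sub>1\<close> at \<open>k\<close>, both maps between \<open>k\<close> and \<open>k + 1\<close> vanish and the degree one
  part splits in two.  The relative scale of the two halves is free and is fixed by one coefficient of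
  \<open>x\<^sub>2\<close> that crosses the gap; the bracket \<open>[x\<^sub>-\<^sub>1, x\<^sub>2]\<close> gives the other coefficient that crosses it.
\<close>

lemma density_normal_form:
  assumes "vir_coeffs UNIV a f c"
    and inv: "same_invariants f (density_coeffs a b)" and reg: "b \<in> {0, 1} \<Longrightarrow> a \<notin> \<int>"
  shows "gauge_equiv f (density_coeffs a b)"
proof -
  let ?F = "density_coeffs a b"
  obtain \<mu> where \<mu>: "\<And>i. \<mu> i \<noteq> 0"
    and eq: "\<And>i. gauge \<mu> f 1 i = ?F 1 i" "\<And>i. gauge \<mu> f (- 1) i = ?F (- 1) i"
    using degree_one_normalization[OF inv reg] by blast
  define g where "g = gauge \<mu> f"
  note eq = eq[folded g_def]
  have g: "vir_coeffs UNIV a g c" unfolding g_def by (rule vir_coeffs_gauge) fact+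
  have ginv: "same_invariants g ?F" unfolding g_def same_invariants_gauge[of \<mu>, OF \<mu>] by (rule inv)
  have fg: "gauge_equiv f g" unfolding g_def by (rule gauge_equivI) (rule \<mu>)
  show ?thesis
  proof (cases "\<exists>k. b = 1/2 \<and> ?F 1 k = 0")
    case False
    have down: "g (- 2) (i + 2) = ?F (- 2) (i + 2)" for i
      by (rule degree_minus_two_eq[OF ginv reg _ eq]) (use False in auto)
    have up: "transpose_coeffs g (- 2) (i + 2) = density_coeffs a (1 - b) (- 2) (i + 2)" for i
    proof (rule degree_minus_two_eq)
      show "same_invariants (transpose_coeffs g) (density_coeffs a (1 - b))"
        using same_invariants_transpose[OF ginv] by (simp add: transpose_density)
      show "1 - b \<in> {0, 1} \<Longrightarrow> a \<notin> \<int>" using reg by auto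
      show "1 - b = 1/2 \<Longrightarrow> density_coeffs a (1 - b) 1 i \<noteq> 0 \<and> density_coeffs a (1 - b) 1 (i + 1) \<noteq> 0"
      proof -
        assume "1 - b = 1/2"
        then have b: "b = 1/2" by (simp add: field_simps)
        have "1 - b = b" unfolding b by simp
        then show ?thesis unfolding \<open>1 - b = b\<close> using False b by blast
      qed
      show "transpose_coeffs g 1 j = density_coeffs a (1 - b) 1 j"
        "transpose_coeffs g (- 1) j = density_coeffs a (1 - b) (- 1) j" for j
        unfolding transpose_density[symmetric] by (simp_all add: transpose_coeffs_def eq)
    qed
    have "g = ?F"
    proof (rule vir_coeffs_eqI[OF g vir_coeffs_density eq])
      show "g 2 i = ?F 2 i" for i
        using up[of i] by (simp add: transpose_coeffs_def density_coeffs_def algebra_simps)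
      show "g (- 2) i = ?F (- 2) i" for i using down[of "i - 2"] by simp
    qed
    then show ?thesis using fg by simp
  next
    case True
    then obtain k where b: "b = 1/2" and k: "?F 1 k = 0" by blast
    have "a + of_int k + 1/2 = 0" using k by (simp add: density_coeffs_def b)
    then have a: "a = - of_int k - 1/2" by (simp add: eq_diff_eq eq_neg_iff_add_eq_0 add_ac)
    have F: "?F m i = of_int (i - k) + (of_int m - 1) / 2" for m i
      unfolding density_coeffs_def a b by (simp add: field_simps)
    have F2: "?F 2 i \<noteq> 0" for i
    proof
      assume "?F 2 i = 0"
      then have "complex_of_int (2 * (i - k) + 1) = 0" unfolding F by (simp add: field_simps)
      then show False unfolding of_int_eq_0_iff by presburger
    qed
    have 22: "g 2 i * g (- 2) (i + 2) = ?F 2 i * ?F (- 2) (i + 2)" for i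
      using ginv by (simp add: same_invariants_def flip: inv22_def)
    have F': "?F (- 2) (i + 2) = ?F 2 i" for i unfolding F by (simp add: field_simps)
    have g2: "g 2 i \<noteq> 0" for i using 22[of i] F2[of i] unfolding F' by auto
    \<comment> \<open>Rescales the upper half; coefficients of degree one are not affected.\<close>
    define \<nu> where "\<nu> i = (if i \<le> k then 1 else ?F 2 (k - 1) / g 2 (k - 1))" for i
    have \<nu>: "\<nu> i \<noteq> 0" for i using F2 g2 by (simp add: \<nu>_def)
    define h where "h = gauge \<nu> g"
    have h: "vir_coeffs UNIV a h c" unfolding h_def by (rule vir_coeffs_gauge[OF g \<nu>])
    interpret h: vir_coeffs UNIV a h c by (rule h)
    have hinv: "same_invariants h ?F" unfolding h_def same_invariants_gauge[of \<nu>, OF \<nu>] by (rule ginv)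
    have h1: "h 1 i = ?F 1 i" for i
    proof (cases "i = k")
      case False
      then have "\<nu> (i + 1) = \<nu> i" by (simp add: \<nu>_def)
      then show ?thesis by (simp add: h_def gauge_def \<nu> eq)
    qed (simp add: h_def gauge_def eq k)
    have h1': "h (- 1) i = ?F (- 1) i" for i
    proof (cases "i = k + 1")
      case False
      then have "\<nu> (i - 1) = \<nu> i" by (auto simp: \<nu>_def)
      then show ?thesis by (simp add: h_def gauge_def \<nu> eq)
    qed (simp add: h_def gauge_def eq F)
    have h2_prev: "h 2 (k - 1) = ?F 2 (k - 1)"
      using g2[of "k - 1"] by (simp add: h_def gauge_def \<nu>_def)
    have h2: "h 2 i = ?F 2 i" for i
    proof -
      consider "i = k - 1" | "i = k" | "i \<noteq> k - 1" "i \<noteq> k" by blast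
      then show ?thesis
      proof cases
        case 2
        have "h 2 k * h (- 1) (k + 2) - h (- 1) k * h 2 (k - 1) = 3 * h 1 k"
          using h.bracket[of 2 k "- 1"] by simp
        then show ?thesis unfolding h1 h1' h2_prev 2 by (simp add: F)
      next
        case 3
        have "inv112 (transpose_coeffs h) i = inv112 (transpose_coeffs ?F) i"
          using hinv by (simp add: same_invariants_def)
        moreover have "?F (- 1) (i + 1) \<noteq> 0" "?F (- 1) (i + 2) \<noteq> 0"
          using 3 unfolding F by (auto simp flip: of_int_add of_int_diff)
        ultimately show ?thesis by (simp add: inv112_transpose h1')
      qed (simp add: h2_prev)
    qed
    have h2': "h (- 2) i = ?F (- 2) i" for i
    proof -
      have "inv22 h (i - 2) = inv22 ?F (i - 2)" using hinv by (simp add: same_invariants_def)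
      then show ?thesis using F2 by (simp add: inv22_def h2)
    qed
    have "h = ?F" by (rule vir_coeffs_eqI[OF h vir_coeffs_density h1 h1' h2 h2'])
    moreover have "gauge_equiv g h" unfolding h_def by (rule gauge_equivI) (rule \<nu>)
    ultimately show ?thesis using fg gauge_equiv_trans by blast
  qed
qed


section \<open>Integral weights with b equal to 0 or 1\<close>

text \<open>
  The module \<open>\<A>\<^sub>0\<^sub>,\<^sub>1\<^sub>,\<^sub>0\<close> with the maps out of \<open>v\<^sub>0\<close> replaced by a quadratic polynomial in \<open>m\<close> without
  constant term.  For \<open>\<kappa> = 1\<close> it is \<open>\<A>(\<rho>,0)\<close>, for \<open>\<kappa> = 0\<close> and \<open>\<rho> \<noteq> 0\<close> it is isomorphic to
  \<open>\<A>\<^sub>0\<^sub>,\<^sub>1\<^sub>,\<^sub>0\<close>, and for \<open>\<kappa> = \<rho> = 0\<close> the line of \<open>v\<^sub>0\<close> splits off as a trivial summand.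
\<close>

definition jump_coeffs :: "complex \<Rightarrow> complex \<Rightarrow> int \<Rightarrow> int \<Rightarrow> complex"
  where "jump_coeffs \<kappa> \<rho> m i =
    (if i \<noteq> 0 then of_int (i + m) else of_int m * (\<kappa> * of_int m + \<rho>))"

lemma vir_coeffs_jump: "vir_coeffs UNIV 0 (jump_coeffs \<kappa> \<rho>) (\<lambda>_. 0)"
proof
  fix m n i
  show "jump_coeffs \<kappa> \<rho> m i * jump_coeffs \<kappa> \<rho> n (i + m) - jump_coeffs \<kappa> \<rho> n i * jump_coeffs \<kappa> \<rho> m (i + n) =
    of_int (m - n) * jump_coeffs \<kappa> \<rho> (m + n) i + (if n = - m then of_int (n ^ 3 - n) / 12 * 0 else 0)"
  proof (cases "i = 0")
    case True
    have "jump_coeffs \<kappa> \<rho> m 0 * jump_coeffs \<kappa> \<rho> n m = of_int m * (\<kappa> * of_int m + \<rho>) * of_int (m + n)" for m n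
      by (simp add: jump_coeffs_def)
    then show ?thesis unfolding True by (simp add: algebra_simps) (simp add: jump_coeffs_def algebra_simps)
  next
    case False
    have "jump_coeffs \<kappa> \<rho> m i * jump_coeffs \<kappa> \<rho> n (i + m) = of_int (i + m) * of_int (i + m + n)" for m n
      using False by (simp add: jump_coeffs_def flip: of_int_add)
    then show ?thesis using False by (simp only:) (simp add: jump_coeffs_def algebra_simps)
  qed
qed (simp_all add: jump_coeffs_def)

text \<open>
  The case left open by the density normal form.  The densities with \<open>b = 0\<close> and with \<open>b = 1\<close> have the
  same invariants, and integral weights are shifted so that the weight \<open>0\<close> has the index \<open>0\<close>.
\<close>

locale singular_coeffs = vir_coeffs UNIV 0 f c for f c +
  assumes singular: "same_invariants f (density_coeffs 0 0)"
begin

lemma singular_invariants: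
  "inv11 f i = of_int (i * (i + 1))" "inv22 f i = of_int (i * (i + 2))"
  "inv112 f i = of_int (i * (i + 1) * (i + 2))"
  "inv112 (transpose_coeffs f) i = of_int (i * (i + 1) * (i + 2))"
  using singular
  by (simp_all add: same_invariants_def density_invariants transpose_density)

text \<open>
  The invariants vanish only where index \<open>0\<close> is involved, so away from it the module has the shape
  of \<open>\<A>\<^sub>0\<^sub>,\<^sub>1\<^sub>,\<^sub>0\<close>.  Negative and positive indices are linked by \<open>x\<^sub>2\<close> on \<open>v\<^sub>-\<^sub>1\<close>.
\<close>

lemma singular_normalization:
  obtains \<mu> where "\<And>i. \<mu> i \<noteq> 0"
    "\<And>m i. m \<in> {1, - 1, 2, - 2} \<Longrightarrow> i \<noteq> 0 \<Longrightarrow> i + m \<noteq> 0 \<Longrightarrow> gauge \<mu> f m i = of_int (i + m)"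
proof -
  have f1: "f 1 i \<noteq> 0" if "i \<noteq> 0" "i \<noteq> - 1" for i
  proof -
    have "i * (i + 1) \<noteq> 0" using that by (simp add: eq_neg_iff_add_eq_0)
    then show ?thesis using singular_invariants(1)[of i] by (auto simp: inv11_def simp del: of_int_mult)
  qed
  have f2: "f 2 (- 1) \<noteq> 0"
    using singular_invariants(2)[of "- 1"] by (auto simp: inv22_def)
  \<comment> \<open>The steps from \<open>-1\<close> to \<open>0\<close> and from \<open>0\<close> to \<open>1\<close> are only constrained by their product.\<close>
  define r where "r i = (if i = 0 then 1 / f 2 (- 1) else if i = - 1 then 1 else of_int (i + 1) / f 1 i)" for i
  have "r i \<noteq> 0" for i using f1[of i] f2 by (simp add: r_def eq_neg_iff_add_eq_0 flip: of_int_add)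
  then obtain \<mu> where \<mu>: "\<And>i. \<mu> i \<noteq> 0" "\<And>i. \<mu> (i + 1) = r i * \<mu> i"
    using exists_cumulative_product[of r] by blast
  define g where "g = gauge \<mu> f"
  have "same_invariants g (density_coeffs 0 0)"
    unfolding g_def same_invariants_gauge[of \<mu>, OF \<mu>(1)] by (rule singular)
  then have g11: "g 1 i * g (- 1) (i + 1) = of_int (i * (i + 1))"
    and g22: "g 2 i * g (- 2) (i + 2) = of_int (i * (i + 2))"
    and g112: "g 1 i * g 1 (i + 1) * g (- 2) (i + 2) = of_int (i * (i + 1) * (i + 2))" for i
    by (simp_all add: same_invariants_def density_invariants flip: inv11_def inv22_def inv112_def)
  have g1: "g 1 i = of_int (i + 1)" if "i \<noteq> 0" "i \<noteq> - 1" for i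
    using that f1[OF that] \<mu>(1)[of i] by (simp add: g_def gauge_def \<mu>(2) r_def)
  have g2: "g 2 (- 1) = 1"
    using f2 \<mu>(1)[of "- 1"] \<mu>(2)[of "- 1"] \<mu>(2)[of 0] by (simp add: g_def gauge_def r_def)
  have g1': "g (- 1) (i + 1) = of_int i" if "i \<noteq> 0" "i \<noteq> - 1" for i
  proof -
    have "of_int (i + 1) * g (- 1) (i + 1) = of_int (i + 1) * of_int i"
      using g11[of i] g1[OF that] by (simp add: mult.commute)
    moreover have "complex_of_int (i + 1) \<noteq> 0" using that by (simp add: eq_neg_iff_add_eq_0 del: of_int_add)
    ultimately show ?thesis using mult_left_cancel by blast
  qed
  have g2': "g (- 2) (i + 2) = of_int i" if "i \<noteq> 0" "i \<noteq> - 2" for i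
  proof (cases "i = - 1")
    case True
    then show ?thesis using g22[of "- 1"] g2 by simp
  next
    case False
    have "of_int ((i + 1) * (i + 2)) * g (- 2) (i + 2) = of_int ((i + 1) * (i + 2)) * of_int i"
      using g112[of i] g1[of i] g1[of "i + 1"] that False by (simp add: mult_ac add.assoc eq_neg_iff_add_eq_0)
    moreover have "complex_of_int ((i + 1) * (i + 2)) \<noteq> 0"
      using that False by (simp add: eq_neg_iff_add_eq_0 del: of_int_add of_int_mult)
    ultimately show ?thesis using mult_left_cancel by blast
  qed
  have g2'': "g 2 i = of_int (i + 2)" if "i \<noteq> 0" "i \<noteq> - 2" for i
    using g22[of i] g2'[OF that] that by (simp add: mult.commute)
  show thesis
  proof (rule that[OF \<mu>(1)])
    fix m i :: int assume m: "m \<in> {1, - 1, 2, - 2}" and i: "i \<noteq> 0" "i + m \<noteq> 0"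
    from m consider "m = 1" | "m = - 1" | "m = 2" | "m = - 2" by blast
    then have "g m i = of_int (i + m)"
    proof cases
      case 1
      with i show ?thesis using g1[of i] by auto
    next
      case 2
      with i show ?thesis using g1'[of "i - 1"] by auto
    next
      case 3
      with i show ?thesis using g2''[of i] by auto
    next
      case 4
      with i show ?thesis using g2'[of "i - 2"] by auto
    qed
    then show "gauge \<mu> f m i = of_int (i + m)" unfolding g_def .
  qed
qed

text \<open>
  The maps out of \<open>v\<^sub>0\<close> form a two-parameter family, and so do the maps into it.  By \<open>inv11\<close> and
  \<open>inv22\<close> four products of an outgoing and an incoming coefficient vanish, whereas a nonzero member
  of either family vanishes in at most one of the degrees \<open>\<plusminus>1\<close>, \<open>\<plusminus>2\<close>.
\<close>

lemma outgoing_or_incoming_zero: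
  "(\<forall>m\<in>{1, - 1, 2, - 2}. f m 0 = 0) \<or> (\<forall>m\<in>{1, - 1, 2, - 2}. f m (- m) = 0)"
proof -
  obtain \<mu> where \<mu>: "\<And>i. \<mu> i \<noteq> 0"
    and g: "\<And>m i. m \<in> {1, - 1, 2, - 2} \<Longrightarrow> i \<noteq> 0 \<Longrightarrow> i + m \<noteq> 0 \<Longrightarrow> gauge \<mu> f m i = of_int (i + m)"
    using singular_normalization by blast
  interpret g: vir_coeffs UNIV 0 "gauge \<mu> f" c
    by (rule vir_coeffs_gauge[OF vir_coeffs_axioms \<mu>])
  define a where "a m = gauge \<mu> f m 0" for m
  define b where "b m = gauge \<mu> f m (- m)" for m
  have a2: "a 2 = 3 * a 1 + a (- 1)" and a2': "a (- 2) = a 1 + 3 * a (- 1)"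
    using g.bracket[of 2 0 "- 1"] g.bracket[of "- 2" 0 1] by (simp_all add: a_def g algebra_simps)
  have b2: "2 * b 2 = 3 * b 1 - b (- 1)" and b2': "2 * b (- 2) = 3 * b (- 1) - b 1"
    using g.bracket[of 2 "- 1" "- 1"] g.bracket[of "- 2" 1 1] by (simp_all add: b_def g algebra_simps)
  have "same_invariants (gauge \<mu> f) (density_coeffs 0 0)"
    unfolding same_invariants_gauge[of \<mu>, OF \<mu>] by (rule singular)
  then have g11: "gauge \<mu> f 1 i * gauge \<mu> f (- 1) (i + 1) = of_int (i * (i + 1))"
    and g22: "gauge \<mu> f 2 i * gauge \<mu> f (- 2) (i + 2) = of_int (i * (i + 2))" for i
    by (simp_all add: same_invariants_def density_invariants flip: inv11_def inv22_def)
  have ab: "a 1 * b (- 1) = 0" "b 1 * a (- 1) = 0" "a 2 * b (- 2) = 0" "b 2 * a (- 2) = 0"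
    using g11[of 0] g11[of "- 1"] g22[of 0] g22[of "- 2"] by (simp_all add: a_def b_def)
  have "(a 1 = 0 \<and> a (- 1) = 0) \<or> (b 1 = 0 \<and> b (- 1) = 0)"
  proof (cases "a 1 = 0")
    case True
    show ?thesis
    proof (cases "a (- 1) = 0")
      case False
      then have "b 1 = 0" "a 2 \<noteq> 0" using ab a2 True by auto
      then show ?thesis using ab(3) b2' by auto
    qed (use True in simp)
  next
    case False
    then have b: "b (- 1) = 0" using ab by simp
    show ?thesis
    proof (cases "a (- 1) = 0")
      case True
      then show ?thesis using ab(4) a2' b2 b False by auto
    qed (use b ab in simp)
  qed
  then have "(\<forall>m\<in>{1, - 1, 2, - 2}. a m = 0) \<or> (\<forall>m\<in>{1, - 1, 2, - 2}. b m = 0)"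
    using a2 a2' b2 b2' by auto
  then show ?thesis using \<mu> by (auto simp: a_def b_def gauge_def)
qed

lemma jump_normal_form:
  assumes "\<And>m. m \<in> {1, - 1, 2, - 2} \<Longrightarrow> f m (- m) = 0"
  obtains \<kappa> \<rho> where "gauge_equiv f (jump_coeffs \<kappa> \<rho>)"
proof -
  obtain \<mu> where \<mu>: "\<And>i. \<mu> i \<noteq> 0"
    and g: "\<And>m i. m \<in> {1, - 1, 2, - 2} \<Longrightarrow> i \<noteq> 0 \<Longrightarrow> i + m \<noteq> 0 \<Longrightarrow> gauge \<mu> f m i = of_int (i + m)"
    using singular_normalization by blast
  have gv: "vir_coeffs UNIV 0 (gauge \<mu> f) c"
    by (rule vir_coeffs_gauge[OF vir_coeffs_axioms \<mu>])
  interpret g: vir_coeffs UNIV 0 "gauge \<mu> f" c by (rule gv)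
  define a where "a m = gauge \<mu> f m 0" for m
  have a2: "a 2 = 3 * a 1 + a (- 1)" and a2': "a (- 2) = a 1 + 3 * a (- 1)"
    using g.bracket[of 2 0 "- 1"] g.bracket[of "- 2" 0 1] by (simp_all add: a_def g algebra_simps)
  define \<kappa> where "\<kappa> = (a 1 + a (- 1)) / 2"
  define \<rho> where "\<rho> = (a 1 - a (- 1)) / 2"
  have a1: "a 1 = \<kappa> + \<rho>" "a (- 1) = \<kappa> - \<rho>" by (simp_all add: \<kappa>_def \<rho>_def field_simps)
  have eq: "gauge \<mu> f m i = jump_coeffs \<kappa> \<rho> m i" if m: "m \<in> {1, - 1, 2, - 2}" for m i
  proof -
    consider "i = 0" | "i \<noteq> 0" "i + m = 0" | "i \<noteq> 0" "i + m \<noteq> 0" by blast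
    then show ?thesis
    proof cases
      case 1
      have "a m = of_int m * (\<kappa> * of_int m + \<rho>)"
        using m a1 a2 a2' by (auto simp: algebra_simps)
      then show ?thesis using 1 by (simp add: a_def jump_coeffs_def)
    next
      case 2
      then have "i = - m" by simp
      then have "gauge \<mu> f m i = 0" using assms[OF m] by (simp add: gauge_def)
      moreover have "jump_coeffs \<kappa> \<rho> m i = 0" using 2 by (simp add: jump_coeffs_def del: of_int_add)
      ultimately show ?thesis by simp
    next
      case 3
      then show ?thesis using g[OF m] by (simp add: jump_coeffs_def)
    qed
  qed
  have "gauge \<mu> f = jump_coeffs \<kappa> \<rho>"
    by (rule vir_coeffs_eqI[OF gv vir_coeffs_jump]) (use eq in auto)
  moreover have "gauge_equiv f (gauge \<mu> f)" by (rule gauge_equivI) (rule \<mu>)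
  ultimately show thesis using that by simp
qed

end

lemma jump_scale:
  assumes "t \<noteq> 0" shows "gauge_equiv (jump_coeffs \<kappa> \<rho>) (jump_coeffs (t * \<kappa>) (t * \<rho>))"
proof -
  have "gauge (\<lambda>i. if i = 0 then 1 / t else 1) (jump_coeffs \<kappa> \<rho>) = jump_coeffs (t * \<kappa>) (t * \<rho>)"
    using assms by (auto simp: fun_eq_iff gauge_def jump_coeffs_def distrib_left mult_ac simp del: of_int_add)
  moreover have "gauge_equiv (jump_coeffs \<kappa> \<rho>) (gauge (\<lambda>i. if i = 0 then 1 / t else 1) (jump_coeffs \<kappa> \<rho>))"
    by (rule gauge_equivI) (simp add: assms)
  ultimately show ?thesis by simp
qed

text \<open>
  The second conclusion of the first case is the one that is needed after transposition.
\<close>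

lemma jump_cases:
  obtains a where "gauge_equiv (jump_coeffs \<kappa> \<rho>) (jump_coeffs 1 a)"
    "gauge_equiv (jump_coeffs \<kappa> \<rho>) (jump_coeffs (- 1) (- a))"
  | "gauge_equiv (jump_coeffs \<kappa> \<rho>) (density_coeffs 0 1)"
  | "\<kappa> = 0" "\<rho> = 0"
proof -
  consider "\<kappa> \<noteq> 0" | "\<kappa> = 0" "\<rho> \<noteq> 0" | "\<kappa> = 0" "\<rho> = 0" by blast
  then show thesis
  proof cases
    case 1
    then show ?thesis
      using jump_scale[of "1 / \<kappa>" \<kappa> \<rho>] jump_scale[of "- 1 / \<kappa>" \<kappa> \<rho>] that(1)[of "\<rho> / \<kappa>"] by simp
  next
    case 2
    have "jump_coeffs 0 1 = density_coeffs 0 1"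
      by (auto simp: fun_eq_iff jump_coeffs_def density_coeffs_def)
    then show ?thesis using jump_scale[of "1 / \<rho>" 0 \<rho>] 2 that(2) by simp
  qed (use that(3) in blast)
qed

lemma transpose_jump_zero: "gauge_equiv (transpose_coeffs (jump_coeffs 0 0)) (jump_coeffs 0 0)"
proof -
  let ?\<mu> = "\<lambda>i. if i = 0 then 1 else complex_of_int i"
  have "gauge ?\<mu> (transpose_coeffs (jump_coeffs 0 0)) = jump_coeffs 0 0"
    by (auto simp: fun_eq_iff gauge_def transpose_coeffs_def jump_coeffs_def simp del: of_int_add)
  moreover have "gauge_equiv (transpose_coeffs (jump_coeffs 0 0)) (gauge ?\<mu> (transpose_coeffs (jump_coeffs 0 0)))"
    by (rule gauge_equivI) simp
  ultimately show ?thesis by simp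
qed

text \<open>
  The structure constants of \<open>\<A>\<^sub>a\<^sub>,\<^sub>b\<^sub>,\<^sub>0\<close>, \<open>\<A>(a,0)\<close> and \<open>\<B>(a,0)\<close>; the last one is the transpose of a jump
  module.
\<close>

definition intermediate_series :: "(int \<Rightarrow> int \<Rightarrow> complex) \<Rightarrow> bool"
  where "intermediate_series F \<longleftrightarrow> (\<exists>a b. F = density_coeffs a b) \<or>
    (\<exists>a. F = jump_coeffs 1 a) \<or> (\<exists>a. F = transpose_coeffs (jump_coeffs (- 1) a))"

lemma (in singular_coeffs) singular_classification:
  obtains F where "gauge_equiv f F" "intermediate_series F \<or> F = jump_coeffs 0 0"
proof -
  have ST: "singular_coeffs (transpose_coeffs f) c"
  proof -
    have "same_invariants (transpose_coeffs f) (density_coeffs 0 0)"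
      unfolding same_invariants_def fun_eq_iff
      by (simp add: singular_invariants density_invariants transpose_density)
    then show ?thesis
      by (intro singular_coeffs.intro vir_coeffs_transpose vir_coeffs_axioms singular_coeffs_axioms.intro)
  qed
  consider "\<And>m. m \<in> {1, - 1, 2, - 2} \<Longrightarrow> f m 0 = 0" | "\<And>m. m \<in> {1, - 1, 2, - 2} \<Longrightarrow> f m (- m) = 0"
    using outgoing_or_incoming_zero by blast
  then show thesis
  proof cases
    case 1
    have "transpose_coeffs f m (- m) = 0" if "m \<in> {1, - 1, 2, - 2}" for m
      using that 1[of "- m"] by (auto simp: transpose_coeffs_def)
    then obtain \<kappa> \<rho> where "gauge_equiv (transpose_coeffs f) (jump_coeffs \<kappa> \<rho>)"
      using singular_coeffs.jump_normal_form[OF ST] by blast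
    then have *: "gauge_equiv f (transpose_coeffs F)" if "gauge_equiv (jump_coeffs \<kappa> \<rho>) F" for F
      using that gauge_equiv_trans gauge_equiv_transpose by blast
    show thesis
    proof (cases \<kappa> \<rho> rule: jump_cases)
      case (1 a)
      then show thesis using * that unfolding intermediate_series_def by blast
    next
      case 2
      then show thesis using *[of "density_coeffs 0 1"] that[of "density_coeffs 0 0"]
        by (auto simp: transpose_density intermediate_series_def)
    next
      case 3
      then show thesis using *[OF gauge_equiv_refl] transpose_jump_zero gauge_equiv_trans that by blast
    qed
  next
    case 2
    then obtain \<kappa> \<rho> where "gauge_equiv f (jump_coeffs \<kappa> \<rho>)" using jump_normal_form by blast
    then have *: "gauge_equiv f F" if "gauge_equiv (jump_coeffs \<kappa> \<rho>) F" for F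
      using that gauge_equiv_trans by blast
    show thesis
    proof (cases \<kappa> \<rho> rule: jump_cases)
      case (1 a)
      then show thesis using * that unfolding intermediate_series_def by blast
    next
      case 2
      then show thesis using * that unfolding intermediate_series_def by blast
    next
      case 3
      then show thesis using *[OF gauge_equiv_refl] that by blast
    qed
  qed
qed

lemma vir_coeffs_shift:
  assumes "vir_coeffs UNIV (of_int k) f c"
  shows "vir_coeffs UNIV 0 (\<lambda>m i. f m (i - k)) (\<lambda>i. c (i - k))"
proof -
  interpret vir_coeffs UNIV "of_int k" f c by fact
  show ?thesis
  proof
    fix m n i
    show "f m (i - k) * f n (i + m - k) - f n (i - k) * f m (i + n - k) =
       of_int (m - n) * f (m + n) (i - k) + (if n = - m then of_int (n ^ 3 - n) / 12 * c (i - k) else 0)"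
      using bracket[of m "i - k" n] by (simp add: algebra_simps)
    show "f m (i - k) * c (i + m - k) = f m (i - k) * c (i - k)"
      using central[of m "i - k"] by (simp add: algebra_simps)
  qed (simp_all add: weight)
qed

text \<open>
  The last possibility, \<open>jump_coeffs 0 0\<close>, is the sum of a trivial module and \<open>\<A>'\<^sub>0\<^sub>,\<^sub>0\<^sub>,\<^sub>0\<close>.  The shift
  by \<open>k\<close> moves the weight \<open>0\<close> to the index \<open>0\<close>.
\<close>

theorem vir_coeffs_classification:
  assumes "vir_coeffs UNIV \<alpha> f c"
  obtains k F where "gauge_equiv (\<lambda>m i. f m (i - k)) F" "intermediate_series F \<or> F = jump_coeffs 0 0"
    and "\<And>i. c i = 0"
proof -
  interpret vir_coeffs UNIV \<alpha> f c by fact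
  obtain b where inv: "same_invariants f (density_coeffs \<alpha> b)" and c: "\<And>i. c i = 0"
    using same_invariants_density by blast
  show thesis
  proof (cases "b \<in> {0, 1} \<and> \<alpha> \<in> \<int>")
    case False
    then have "gauge_equiv f (density_coeffs \<alpha> b)"
      using density_normal_form[OF assms inv] by blast
    then show thesis using that[of 0 "density_coeffs \<alpha> b"] c
      by (auto simp: intermediate_series_def)
  next
    case True
    then obtain k where k: "\<alpha> = of_int k" by (auto elim: Ints_cases)
    let ?g = "\<lambda>m i. f m (i - k)"
    have g: "vir_coeffs UNIV 0 ?g (\<lambda>i. c (i - k))"
      using vir_coeffs_shift assms unfolding k by blast
    have "same_invariants (density_coeffs \<alpha> 1) (density_coeffs \<alpha> 0)"
      by (simp add: same_invariants_def fun_eq_iff density_invariants transpose_density algebra_simps)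
    then have "same_invariants f (density_coeffs \<alpha> 0)"
      using inv True by (auto simp: same_invariants_def)
    then have "inv11 f (i - k) = inv11 (density_coeffs \<alpha> 0) (i - k)"
      "inv22 f (i - k) = inv22 (density_coeffs \<alpha> 0) (i - k)"
      "inv112 f (i - k) = inv112 (density_coeffs \<alpha> 0) (i - k)"
      "inv112 (transpose_coeffs f) (i - k) = inv112 (density_coeffs \<alpha> 1) (i - k)" for i
      by (simp_all add: same_invariants_def transpose_density)
    moreover have "inv11 ?g i = inv11 f (i - k)" "inv22 ?g i = inv22 f (i - k)"
      "inv112 ?g i = inv112 f (i - k)" "inv112 (transpose_coeffs ?g) i = inv112 (transpose_coeffs f) (i - k)" for i
      unfolding inv112_transpose by (simp_all add: inv11_def inv22_def inv112_def algebra_simps)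
    ultimately have "same_invariants ?g (density_coeffs 0 0)"
      by (simp add: same_invariants_def fun_eq_iff transpose_density) (simp add: density_invariants k)
    then interpret g: singular_coeffs ?g "\<lambda>i. c (i - k)"
      by (intro singular_coeffs.intro g singular_coeffs_axioms.intro)
    show thesis using g.singular_classification that c by blast
  qed
qed

section \<open>Possible supports\<close>

text \<open>
  The automorphism \<open>x\<^sub>m \<mapsto> - x\<^sub>-\<^sub>m\<close>, \<open>C \<mapsto> - C\<close> reverses the order of the weights.
\<close>

lemma vir_coeffs_flip:
  assumes "vir_coeffs S \<alpha> f c"
  shows "vir_coeffs (uminus ` S) (- \<alpha>) (\<lambda>m i. - f (- m) (- i)) (\<lambda>i. - c (- i))"
proof -
  interpret vir_coeffs S \<alpha> f c by fact
  have mem: "i \<in> uminus ` S \<longleftrightarrow> - i \<in> S" for i :: int by force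
  show ?thesis
  proof
    fix m n i
    have "f (- m) (- i) * f (- n) (- i - m) - f (- n) (- i) * f (- m) (- i - n) =
       of_int (n - m) * f (- m - n) (- i) + (if n = - m then - of_int (n ^ 3 - n) / 12 * c (- i) else 0)"
      using bracket[of "- m" "- i" "- n"] by simp
    then show "- f (- m) (- i) * - f (- n) (- (i + m)) - - f (- n) (- i) * - f (- m) (- (i + n)) =
       of_int (m - n) * - f (- (m + n)) (- i) + (if n = - m then of_int (n ^ 3 - n) / 12 * - c (- i) else 0)"
      by (simp add: algebra_simps)
    show "- f (- m) (- i) * - c (- (i + m)) = - f (- m) (- i) * - c (- i)"
      using central[of "- m" "- i"] by simp
  next
    fix i m :: int assume "i + m \<notin> uminus ` S"
    then show "- f (- m) (- i) = 0" using outside_target[of "- i" "- m"] by (simp add: mem)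
  qed (simp_all add: mem weight outside_source)
qed

lemma obtain_left_end:
  fixes S :: "int set"
  assumes "i \<in> S" "k < i" "k \<notin> S"
  obtains l where "l \<le> i" "l - 1 \<notin> S" "\<And>j. l \<le> j \<Longrightarrow> j \<le> i \<Longrightarrow> j \<in> S"
proof -
  let ?M = "Max ({k..i} - S)"
  have "k \<in> {k..i} - S" using assms by simp
  then have M: "?M \<in> {k..i} - S" by (intro Max_in) auto
  have "j \<in> S" if "?M + 1 \<le> j" "j \<le> i" for j
  proof (rule ccontr)
    assume "j \<notin> S"
    then have "j \<le> ?M" using that M by (intro Max_ge) auto
    then show False using that by simp
  qed
  moreover have "?M \<noteq> i" using M assms(1) by auto
  then have "?M + 1 \<le> i" using M by simp
  ultimately show thesis using that[of "?M + 1"] M by auto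
qed

lemma obtain_right_end:
  fixes S :: "int set"
  assumes "i \<in> S" "i < k" "k \<notin> S"
  obtains u where "i \<le> u" "u + 1 \<notin> S" "\<And>j. i \<le> j \<Longrightarrow> j \<le> u \<Longrightarrow> j \<in> S"
proof -
  have mem: "j \<in> uminus ` S \<longleftrightarrow> - j \<in> S" for j :: int by force
  obtain l where l: "l \<le> - i" "l - 1 \<notin> uminus ` S" "\<And>j. l \<le> j \<Longrightarrow> j \<le> - i \<Longrightarrow> j \<in> uminus ` S"
    using obtain_left_end[of "- i" "uminus ` S" "- k"] assms by (auto simp: mem)
  show thesis
  proof (rule that[of "- l"])
    show "j \<in> S" if "i \<le> j" "j \<le> - l" for j using l(3)[of "- j"] that by (simp add: mem)
  qed (use l(1,2) mem in auto)
qed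

lemma complex_eq_neg_self: "x = - x \<Longrightarrow> x = (0::complex)"
  by (simp add: complex_eq_iff)

context vir_coeffs
begin

text \<open>
  A missing weight \<open>l - 1\<close> makes \<open>inv11\<close> and both cubic invariants vanish at \<open>l - 1\<close>.  These initial
  values determine them on the interval above, and the two cubic invariants coincide there.
\<close>

lemma left_end_invariants:
  assumes S: "\<And>k. l \<le> k \<Longrightarrow> k \<le> u \<Longrightarrow> k \<in> S" and l: "l - 1 \<notin> S"
    and \<rho>: "\<rho> = - (wt l - 1) * wt l" and i: "l - 1 \<le> i" "i \<le> u"
  shows "inv11 f i = wt i * (wt i + 1) + \<rho>"
    and "inv112 f i = cubic \<rho> i - cubic \<rho> (l - 1)"
    and "inv112 (transpose_coeffs f) i = cubic \<rho> i - cubic \<rho> (l - 1)"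
proof -
  interpret T: vir_coeffs S \<alpha> "transpose_coeffs f" c
    by (rule vir_coeffs_transpose) (rule vir_coeffs_axioms)
  have z: "f 1 (l - 1) = 0" "transpose_coeffs f 1 (l - 1) = 0"
    using l by (simp_all add: outside_source T.outside_source)
  have p: "inv11 f i = wt i * (wt i + 1) + \<rho>" if "l - 1 \<le> i" "i \<le> u" for i
  proof (rule inv11_interval[OF _ _ that])
    show "inv11 f (l - 1) = wt (l - 1) * (wt (l - 1) + 1) + \<rho>"
      using z by (simp add: inv11_def \<rho> algebra_simps)
  qed (use S in auto)
  then show "inv11 f i = wt i * (wt i + 1) + \<rho>" using i by blast
  have "inv112 f i = cubic \<rho> i + - cubic \<rho> (l - 1)"
    by (rule inv112_interval[OF p _ i]) (use z in \<open>auto simp: inv112_def\<close>)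
  then show "inv112 f i = cubic \<rho> i - cubic \<rho> (l - 1)" by simp
  have "inv112 (transpose_coeffs f) i = cubic \<rho> i + - cubic \<rho> (l - 1)"
    by (rule T.inv112_interval[OF _ _ i]) (use z p in \<open>auto simp: inv112_def\<close>)
  then show "inv112 (transpose_coeffs f) i = cubic \<rho> i - cubic \<rho> (l - 1)" by simp
qed

text \<open>
  Equality of the cubic invariants with \<open>E = - D\<close> gives \<open>D = 0\<close>, so the lowest weight of the half line
  is \<open>0\<close>, \<open>1\<close> or \<open>1/2\<close>.  Now \<open>inv22\<close> is known in two ways, from the relation \<open>inv112_mult_transpose\<close>
  and from its recursion starting at \<open>l - 1\<close> or \<open>l - 2\<close>.  They disagree for the weights \<open>0\<close> and \<open>1/2\<close>.
  For the weight \<open>1\<close> they force \<open>inv22\<close> at \<open>l - 2\<close> to be nonzero: the half line is not the end of the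
  support, only the weight \<open>0\<close> is missing.
\<close>

lemma half_line:
  assumes S: "\<And>k. l \<le> k \<Longrightarrow> k \<in> S" and l: "l - 1 \<notin> S"
  shows "wt l = 1 \<and> l - 2 \<in> S"
proof -
  define h where "h = wt l"
  define \<rho> where "\<rho> = - (h - 1) * h"
  define D where "D = - cubic \<rho> (l - 1)"
  have w: "wt i = h + of_int (i - l)" for i by (simp add: h_def)
  have inv: "inv11 f i = wt i * (wt i + 1) + \<rho>" "inv112 f i = cubic \<rho> i + D"
    "inv112 (transpose_coeffs f) i = cubic \<rho> i + D" if "l - 1 \<le> i" for i
    using left_end_invariants[of l i \<rho> i] S l that by (auto simp: \<rho>_def h_def D_def)
  have tail: "D = - D" "D\<^sup>2 = (1 - 4 * \<rho>) * \<rho>\<^sup>2" "\<And>i. N \<le> i \<Longrightarrow> c i = 0"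
    if "l \<le> N" "\<And>i. N \<le> i \<Longrightarrow> inv11 f i \<noteq> 0" for N
    by (rule tail_invariants[of N \<rho> D D]; use S inv that in auto)+
  obtain N where N: "\<And>i. N \<le> i \<Longrightarrow> wt i * (wt i + 1) + \<rho> \<noteq> 0"
    using quadratic_zeros_bounded by blast
  have "inv11 f i \<noteq> 0" if "max N l \<le> i" for i using N[of i] inv(1)[of i] that by auto
  then have "D = - D" "D\<^sup>2 = (1 - 4 * \<rho>) * \<rho>\<^sup>2"
    using tail(1,2)[of "max N l"] by auto
  then have D: "D = 0" "(1 - 4 * \<rho>) * \<rho>\<^sup>2 = 0" by auto
  have "cubic \<rho> (l - 1) = 0" using D(1) by (simp add: D_def)
  then have "h ^ 3 + (3 * \<rho> - 1) * h = 0" by (simp add: cubic_def h_def)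
  then have hr: "h * ((h - 1) * (2 * h - 1)) = 0" by (simp add: \<rho>_def algebra_simps eval_nat_numeral)
  have Q: "inv22 f i = (wt i + 1)\<^sup>2 + 4 * \<rho> - 1" if "l \<le> i" "inv11 f i \<noteq> 0" "inv11 f (i + 1) \<noteq> 0" for i
  proof -
    have D2: "0\<^sup>2 = (1 - 4 * \<rho>) * \<rho>\<^sup>2" using D(2) by simp
    have p: "inv11 f i = wt i * (wt i + 1) + \<rho>" "inv11 f (i + 1) = wt (i + 1) * (wt (i + 1) + 1) + \<rho>"
      by (rule inv(1), use that(1) in simp)+
    have "inv22 f i * (inv11 f i * inv11 f (i + 1)) = inv112 f i * inv112 (transpose_coeffs f) i"
      by (rule inv112_mult_transpose[symmetric])
    also have "\<dots> = (cubic \<rho> i)\<^sup>2 - 0\<^sup>2"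
      using inv(2,3)[of i] D(1) that(1) by (simp add: power2_eq_square)
    also have "\<dots> = ((wt i + 1)\<^sup>2 + 4 * \<rho> - 1) * (inv11 f i * inv11 f (i + 1))"
      unfolding p by (rule cubic_square[OF D2])
    finally show ?thesis using that by simp
  qed
  \<comment> \<open>The operator \<open>x\<^sub>-\<^sub>2 x\<^sub>2\<close> at \<open>l - 1\<close> starts from a missing weight.\<close>
  have Q0: "inv22 f (l - 1) = 0" using l by (simp add: inv22_def outside_source)
  consider "h = 0" | "h = 1" | "2 * h = 1" using hr by auto
  then show ?thesis
  proof cases
    case 1
    have p: "inv11 f i \<noteq> 0" if "l + 1 \<le> i" for i
    proof -
      have "(i - l) * (i - l + 1) \<noteq> 0" using that by simp
      moreover have "inv11 f i = of_int ((i - l) * (i - l + 1))" using inv(1)[of i] that 1 by (simp add: w \<rho>_def)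
      ultimately show ?thesis by (simp only: of_int_eq_0_iff) simp
    qed
    have "inv22 f (l + 1) = 3"
      by (subst Q[OF _ p p], simp_all only: w \<rho>_def 1, simp_all)
    moreover have "inv22 f (l + 1) = inv22 f (l - 1) + 4 * (h + 1) - c (l + 1) / 2"
      using inv22_step[of "l + 1", unfolded w] S by simp
    moreover have "c (l + 1) = 0" using tail(3)[of "l + 1" "l + 1"] p by simp
    ultimately have "(3::complex) = 4" by (simp add: Q0 1)
    then show ?thesis by simp
  next
    case 2
    have p: "inv11 f i \<noteq> 0" if "l \<le> i" for i
    proof -
      have "(i - l + 1) * (i - l + 2) \<noteq> 0" using that by simp
      moreover have "inv11 f i = of_int ((i - l + 1) * (i - l + 2))" using inv(1)[of i] that 2 by (simp add: w \<rho>_def add.commute)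
      ultimately show ?thesis by (simp only: of_int_eq_0_iff) simp
    qed
    have "inv22 f l = 3"
      by (subst Q[OF _ p p], simp_all only: w \<rho>_def 2, simp_all)
    moreover have "inv22 f l = inv22 f (l - 2) + 4 * h - c l / 2"
      using inv22_step[of l, unfolded w] S by simp
    moreover have "c l = 0" using tail(3)[of l l] p by simp
    ultimately have "3 = inv22 f (l - 2) + 4" by (simp add: 2)
    then have "inv22 f (l - 2) \<noteq> 0" by auto
    then have "l - 2 \<in> S" using outside_source by (auto simp: inv22_def)
    then show ?thesis using 2 by (simp add: h_def)
  next
    case 3
    then have h: "h = 1 / 2" by (simp add: field_simps)
    have p: "inv11 f i \<noteq> 0" if "l \<le> i" for i
    proof -
      have "2 * (i - l) + 2 \<noteq> 0" using that by simp
      moreover have "4 * inv11 f i = (of_int (2 * (i - l) + 2))\<^sup>2"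
        using inv(1)[of i] that h by (simp add: w \<rho>_def power2_eq_square field_simps)
      ultimately show ?thesis by (metis mult_zero_right of_int_eq_0_iff zero_eq_power2)
    qed
    have "inv22 f (l + 1) = (5/2)\<^sup>2"
      by (subst Q[OF _ p p], simp_all only: w \<rho>_def h, simp_all)
    moreover have "inv22 f (l + 1) = inv22 f (l - 1) + 4 * (h + 1) - c (l + 1) / 2"
      using inv22_step[of "l + 1", unfolded w] S by simp
    moreover have "c (l + 1) = 0" using tail(3)[of l "l + 1"] p by simp
    ultimately have "(5/2)\<^sup>2 = (6::complex)" by (simp add: Q0 h)
    then show ?thesis by (simp add: power2_eq_square)
  qed
qed

text \<open>
  By symmetry of \<open>inv11\<close> the weights of the interval are symmetric about \<open>0\<close>.  The cubic invariant has
  to vanish at both ends, which leaves only the interval consisting of the weight \<open>0\<close>.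
\<close>

lemma finite_interval:
  assumes S: "\<And>k. l \<le> k \<Longrightarrow> k \<le> u \<Longrightarrow> k \<in> S" and l: "l - 1 \<notin> S" and u: "u + 1 \<notin> S" and "l \<le> u"
  shows "l = u \<and> wt l = 0"
proof -
  define \<rho> where "\<rho> = - (wt l - 1) * wt l"
  define h where "h = complex_of_int (u - l) / 2"
  note inv = left_end_invariants[of l u \<rho>, OF S l \<rho>_def]
  have z: "f 1 u = 0" using outside_target[of u 1] u by simp
  have "(wt u + wt l) * (1 + of_int (u - l)) = wt u * (wt u + 1) + \<rho>"
    by (simp add: \<rho>_def algebra_simps)
  also have "\<dots> = 0" using inv(1)[of u] z \<open>l \<le> u\<close> by (simp add: inv11_def)
  finally have "wt u + wt l = 0 \<or> complex_of_int (1 + (u - l)) = 0" by simp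
  then have ul: "wt u + wt l = 0" using \<open>l \<le> u\<close> by (simp del: of_int_add of_int_diff)
  have h2: "2 * h = of_int (u - l)" unfolding h_def by (simp del: of_int_diff)
  then have "wt u = wt l + 2 * h" by simp
  with ul have "2 * (wt l + h) = 0" by (simp add: algebra_simps)
  then have "wt l + h = 0" by (metis mult_eq_0_iff zero_neq_numeral)
  then have wl: "wt l = - h" by (simp add: eq_neg_iff_add_eq_0)
  then have wu: "wt u = h" using ul by simp
  have "inv112 f (u - 1) = 0" using z by (simp add: inv112_def)
  then have "cubic \<rho> (u - 1) = cubic \<rho> (l - 1)" using inv(2)[of "u - 1"] \<open>l \<le> u\<close> by simp
  moreover have "cubic \<rho> (u - 1) = h ^ 3 + (3 * \<rho> - 1) * h" "cubic \<rho> (l - 1) = - (h ^ 3 + (3 * \<rho> - 1) * h)"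
    using wl wu by (simp_all add: cubic_def)
  ultimately have "h ^ 3 + (3 * \<rho> - 1) * h = - (h ^ 3 + (3 * \<rho> - 1) * h)" by argo
  then have "h ^ 3 + (3 * \<rho> - 1) * h = 0" by (rule complex_eq_neg_self)
  moreover have "\<rho> = - (h * (h + 1))" by (simp add: \<rho>_def wl algebra_simps)
  moreover have "h * ((2 * h + 1) * (h + 1)) = - (h ^ 3 + (3 * - (h * (h + 1)) - 1) * h)"
    by (simp add: algebra_simps eval_nat_numeral)
  ultimately have "h * ((2 * h + 1) * (h + 1)) = 0" by simp
  moreover have "2 * h + 1 = complex_of_int (u - l + 1)" "2 * (h + 1) = complex_of_int (u - l + 2)"
    using h2 by simp_all
  then have "2 * h + 1 \<noteq> 0" "2 * (h + 1) \<noteq> 0" using \<open>l \<le> u\<close> by (simp_all only: of_int_eq_0_iff)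
  ultimately have "h = 0" by (metis mult_eq_0_iff)
  then show ?thesis using wl by (simp add: h_def)
qed

text \<open>
  Below the single missing weight nothing can be missing: another gap would produce a finite interval
  that contains the weight \<open>-1\<close>.
\<close>

lemma co_singleton_support:
  assumes "S \<noteq> UNIV" and up: "\<And>k. i \<le> k \<Longrightarrow> k \<in> S"
  obtains j where "S = UNIV - {j}" "wt j = 0"
proof -
  obtain k where "k \<notin> S" "k < i" using assms by (metis UNIV_eq_I linorder_not_le)
  then obtain l where l: "l \<le> i" "l - 1 \<notin> S" "\<And>j. l \<le> j \<Longrightarrow> j \<le> i \<Longrightarrow> j \<in> S"
    using obtain_left_end[of i S k] up by blast
  have S: "k \<in> S" if "l \<le> k" for k using l(3)[of k] up[of k] that by (cases "k \<le> i") auto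
  have h: "wt l = 1" "l - 2 \<in> S" using half_line[OF S l(2)] by auto
  have low: "k \<in> S" if "k \<le> l - 2" for k
  proof (rule ccontr)
    assume "k \<notin> S"
    then have "k < l - 2" using that h(2) by (cases "k = l - 2") auto
    then obtain l' where "l' \<le> l - 2" "l' - 1 \<notin> S" "\<And>j. l' \<le> j \<Longrightarrow> j \<le> l - 2 \<Longrightarrow> j \<in> S"
      using obtain_left_end[of "l - 2" S k] h(2) \<open>k \<notin> S\<close> by blast
    then have "l' = l - 2 \<and> wt l' = 0"
      by (intro finite_interval[of l' "l - 2"]) (use l(2) in auto)
    then have "wt (l - 2) = 0" by blast
    moreover have "wt l = wt (l - 2) + 2" by simp
    ultimately show False using h(1) by (simp del: of_int_diff)
  qed
  have "k \<in> S \<longleftrightarrow> k \<noteq> l - 1" for k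
  proof -
    consider "k \<le> l - 2" | "k = l - 1" | "l \<le> k" by linarith
    then show ?thesis using low[of k] S[of k] l(2) by cases auto
  qed
  then have "S = UNIV - {l - 1}" by blast
  moreover have "wt (l - 1) = wt l - 1" by simp
  then have "wt (l - 1) = 0" unfolding h(1) by (simp del: of_int_diff)
  ultimately show thesis by (rule that)
qed

lemma support_cases:
  assumes "i \<in> S"
  obtains "S = UNIV" | j where "S = UNIV - {j}" "wt j = 0" | "S = {i}" "wt i = 0"
proof -
  have isolated: "wt k = 0 \<or> (\<exists>j. S = UNIV - {j} \<and> wt j = 0)" if neq: "S \<noteq> UNIV" and "k \<in> S" for k
  proof -
    consider "\<And>j. k \<le> j \<Longrightarrow> j \<in> S" | "\<And>j. j \<le> k \<Longrightarrow> j \<in> S"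
      | j j' where "j < k" "j \<notin> S" "k < j'" "j' \<notin> S"
      using \<open>k \<in> S\<close> by (metis linorder_not_le order_le_less)
    then show ?thesis
    proof cases
      case 1
      then obtain j where "S = UNIV - {j}" "wt j = 0"
        by (rule co_singleton_support[OF neq])
      then show ?thesis by blast
    next
      case 2
      interpret F: vir_coeffs "uminus ` S" "- \<alpha>" "\<lambda>m i. - f (- m) (- i)" "\<lambda>i. - c (- i)"
        by (rule vir_coeffs_flip) (rule vir_coeffs_axioms)
      have mem: "j \<in> uminus ` S \<longleftrightarrow> - j \<in> S" for j :: int by force
      have ne: "uminus ` S \<noteq> UNIV"
      proof
        assume "uminus ` S = UNIV"
        then have "x \<in> S" for x using mem[of "- x"] by simp
        then show False using neq by blast
      qed
      have up: "x \<in> uminus ` S" if "- k \<le> x" for x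
        unfolding mem using that by (intro 2) simp
      obtain j where j: "uminus ` S = UNIV - {j}" "F.wt j = 0"
        by (rule F.co_singleton_support[OF ne up])
      have "x \<in> S \<longleftrightarrow> x \<noteq> - j" for x
        using mem[of "- x"] unfolding j(1) by (simp add: neg_equal_iff_equal[of x "- j", symmetric])
      then have "S = UNIV - {- j}" by blast
      moreover have "wt (- j) = 0" using j(2) by (simp add: algebra_simps)
      ultimately show ?thesis by blast
    next
      case 3
      obtain l where l: "l \<le> k" "l - 1 \<notin> S" "\<And>j. l \<le> j \<Longrightarrow> j \<le> k \<Longrightarrow> j \<in> S"
        using obtain_left_end[OF \<open>k \<in> S\<close> 3(1,2)] by blast
      obtain u where u: "k \<le> u" "u + 1 \<notin> S" "\<And>j. k \<le> j \<Longrightarrow> j \<le> u \<Longrightarrow> j \<in> S"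
        using obtain_right_end[OF \<open>k \<in> S\<close> 3(3,4)] by blast
      have "l = u \<and> wt l = 0"
        by (rule finite_interval) (use l u in \<open>force+\<close>)
      then have "l = k" "wt l = 0" using l(1) u(1) by auto
      then show ?thesis by blast
    qed
  qed
  show thesis
  proof (cases "S = UNIV \<or> (\<exists>j. S = UNIV - {j} \<and> wt j = 0)")
    case True
    then show thesis using that by blast
  next
    case False
    then have z: "wt k = 0" if "k \<in> S" for k using isolated that by blast
    have "k = i" if "k \<in> S" for k
    proof -
      have "wt k = wt i" using z[OF that] z[OF assms] by simp
      then show ?thesis by simp
    qed
    then have "S = {i}" using assms by blast
    then show thesis using that z[OF assms] by blast
  qed
qed

lemma singleton_support:
  assumes "S = {j}" "wt j = 0"
  shows "f m i = 0" and "c i = 0"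
proof -
  have z: "f m i = 0" for m i
  proof (cases "i = j \<and> m = 0")
    case True
    then show ?thesis using weight[of j] assms by simp
  next
    case False
    then show ?thesis using outside_source[of i m] outside_target[of i m] assms(1) by (cases "i = j") auto
  qed
  show "f m i = 0" by (rule z)
  show "c i = 0" using bracket[of 2 i "- 2"] by (simp add: z)
qed

text \<open>
  A missing weight \<open>0\<close> can be filled by a trivial summand, and this reduces the case to the full support.
\<close>

lemma pad_support:
  assumes "S = UNIV - {j}" "wt j = 0"
  shows "vir_coeffs UNIV \<alpha> f c"
  by unfold_locales (use bracket central weight assms outside_source in \<open>auto, metis Diff_iff UNIV_I singletonD\<close>)

end

text \<open>
  Among the normal forms only \<open>jump_coeffs 0 0\<close> has an index without any maps in or out.
\<close>

lemma isolated_index_normal_form: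
  assumes "gauge_equiv (\<lambda>m i. f m (i - k)) F" "intermediate_series F \<or> F = jump_coeffs 0 0"
    and out: "\<And>m. f m j = 0" and inc: "\<And>m. f m (j - m) = 0"
  shows "F = jump_coeffs 0 0" and "k = - j"
proof -
  define p where "p = j + k"
  obtain \<mu> where "\<And>i. \<mu> i \<noteq> 0" and F: "F = gauge \<mu> (\<lambda>m i. f m (i - k))"
    using assms(1) unfolding gauge_equiv_def by metis
  have F1: "F m p = 0" for m using out by (simp add: F gauge_def p_def)
  have F2: "F m (p - m) = 0" for m using inc[of m] by (simp add: F gauge_def p_def algebra_simps)
  have jump: False if "\<And>m. jump_coeffs \<kappa> a m q = 0" "\<kappa> \<noteq> 0" for \<kappa> a q
    using that(1)[of 1] that(1)[of "- 1"] that(1)[of 2] that(2)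
    by (auto simp: jump_coeffs_def algebra_simps split: if_splits)
  show "F = jump_coeffs 0 0"
  proof (rule ccontr)
    assume "F \<noteq> jump_coeffs 0 0"
    then consider a b where "F = density_coeffs a b" | a where "F = jump_coeffs 1 a"
      | a where "F = transpose_coeffs (jump_coeffs (- 1) a)"
      using assms(2) unfolding intermediate_series_def by blast
    then show False
    proof cases
      case (1 a b)
      have "a + of_int p = 0" using F1[of 0] unfolding 1 by (simp add: density_coeffs_def)
      moreover from this have "b = 0" using F1[of 1] unfolding 1 by (simp add: density_coeffs_def)
      moreover have "a + (of_int p - 1) + b = 0" using F2[of 1] unfolding 1 by (simp add: density_coeffs_def)
      ultimately show False by (simp add: add_diff_eq)
    next
      case (2 a)
      show False using jump[of 1 a p] F1 unfolding 2 by auto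
    next
      case (3 a)
      have "jump_coeffs (- 1) a m p = 0" for m
        using F2[of "- m"] unfolding 3 by (simp add: transpose_coeffs_def)
      then show False using jump[of "- 1" a p] by auto
    qed
  qed
  then have "p = 0" using F1[of "1 - p"] by (auto simp: jump_coeffs_def split: if_splits)
  then show "k = - j" by (simp add: p_def)
qed

section \<open>The modules of the intermediate series\<close>

abbreviation xi :: "int \<Rightarrow> w22" where "xi m \<equiv> Poly_Mapping.single (Xi m) 1"

abbreviation vb :: "int \<Rightarrow> (int \<Rightarrow>\<^sub>0 complex)" where "vb i \<equiv> Poly_Mapping.single i 1"

interpretation pm: vector_space pm_scale
  by (rule vector_space_pm_scale)

lemma linear_series_action_left: "Vector_Spaces.linear pm_scale pm_scale (\<lambda>x. series_action F x v)"
  unfolding series_action_def by (rule linear_bilinear_extension_left)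

lemma linear_series_action_right: "Vector_Spaces.linear pm_scale pm_scale (series_action F x)"
  unfolding series_action_def by (rule linear_bilinear_extension_right)

interpretation series_left: Vector_Spaces.linear pm_scale pm_scale "\<lambda>x. series_action F x v" for F v
  by (rule linear_series_action_left)

interpretation series_right: Vector_Spaces.linear pm_scale pm_scale "series_action F x" for F x
  by (rule linear_series_action_right)

lemma series_action_basis:
  "series_action F (Poly_Mapping.single g 1) (vb i) =
    (case g of Xi m \<Rightarrow> pm_scale (F m i) (vb (m + i)) | _ \<Rightarrow> 0)"
proof -
  have "series_action F (Poly_Mapping.single g 1) (vb i) =
    (case g of Xi m \<Rightarrow> Poly_Mapping.single (m + i) (F m i) | _ \<Rightarrow> 0)"
    unfolding series_action_def by (rule bilinear_extension_basis)
  then show ?thesis by (auto split: w22_index.split intro: single_eq_pm_scale)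
qed

lemma lookup_series_action_xi:
  "Poly_Mapping.lookup (series_action F (xi m) p) j = F m (j - m) * Poly_Mapping.lookup p (j - m)"
proof (induction p rule: pm_basis_induct)
  case (basis i)
  show ?case by (auto simp: series_action_basis lookup_single when_def)
qed (simp_all add: series_right.add series_right.scale series_right.zero lookup_add algebra_simps)

lemma series_action_not_xi:
  assumes "\<And>m. g \<noteq> Xi m" shows "series_action F (Poly_Mapping.single g a) p = 0"
proof (induction p rule: pm_basis_induct)
  case (basis i)
  have "series_action F (Poly_Mapping.single g 1) (vb i) = 0"
    using assms by (simp add: series_action_basis split: w22_index.split)
  then show ?case by (subst single_eq_pm_scale) (simp add: series_left.scale)
qed (simp_all add: series_right.add series_right.scale series_right.zero)

lemma w22_module_series:
  assumes "vir_coeffs UNIV \<alpha> F (\<lambda>_. 0)"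
  shows "w22_module pm_scale (series_action F)"
proof -
  interpret vir_coeffs UNIV \<alpha> F "\<lambda>_. 0" by fact
  note lin = series_left.add series_left.scale series_left.zero series_left.neg series_left.diff
    series_right.add series_right.scale series_right.zero series_right.neg
    w22_bracket_left.add w22_bracket_right.add w22_bracket_left.scale
    w22_bracket_right.scale w22_bracket_left.zero w22_bracket_right.zero
  have basis: "series_action F (w22_basis_bracket g h) (vb i) =
     series_action F (Poly_Mapping.single g 1) (series_action F (Poly_Mapping.single h 1) (vb i)) -
     series_action F (Poly_Mapping.single h 1) (series_action F (Poly_Mapping.single g 1) (vb i))" for g h i
  proof (cases "(\<exists>n. g = Xi n) \<and> (\<exists>m. h = Xi m)")
    case True
    then obtain n m where gh: "g = Xi n" "h = Xi m" by blast
    have "series_action F (w22_basis_bracket g h) (vb i) = pm_scale (of_int (m - n) * F (n + m) i) (vb (n + m + i))"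
    proof -
      have "series_action F (w22_basis_bracket g h) (vb i) = series_action F (Poly_Mapping.single (Xi (n + m)) (of_int (m - n))) (vb i)"
        unfolding gh by (simp add: series_left.add series_left.zero series_action_not_xi)
      then show ?thesis
        by (simp add: single_eq_pm_scale[of "Xi (n + m)" "of_int (m - n)"] series_left.scale series_action_basis del: of_int_diff)
    qed
    moreover have "series_action F (Poly_Mapping.single g 1) (series_action F (Poly_Mapping.single h 1) (vb i)) =
      pm_scale (F m i * F n (i + m)) (vb (n + m + i))"
      unfolding gh by (simp add: lin series_action_basis add_ac)
    moreover have "series_action F (Poly_Mapping.single h 1) (series_action F (Poly_Mapping.single g 1) (vb i)) =
      pm_scale (F n i * F m (i + n)) (vb (n + m + i))"
      unfolding gh by (simp add: lin series_action_basis add_ac)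
    ultimately show ?thesis
      using bracket[of m i n] by (simp add: add.commute flip: pm.scale_left_diff_distrib)
  next
    case False
    then show ?thesis
      by (cases g; cases h) (auto simp: lin series_action_not_xi)
  qed
  have "series_action F (w22_bracket x y) v =
     series_action F x (series_action F y v) - series_action F y (series_action F x v)" for x y v
  proof (induction x rule: pm_basis_induct)
    case (basis g)
    show ?case
    proof (induction y rule: pm_basis_induct)
      case (basis h)
      show ?case
      proof (induction v rule: pm_basis_induct)
        case (basis i)
        show ?case unfolding w22_bracket_basis by (rule \<open>series_action F (w22_basis_bracket g h) (vb i) = _\<close>)
      qed (simp_all add: lin pm.scale_right_diff_distrib add_diff_add)
    qed (simp_all add: lin pm.scale_right_diff_distrib add_diff_add)
  qed (simp_all add: lin pm.scale_right_diff_distrib add_diff_add)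
  then show ?thesis
    by unfold_locales (rule linear_series_action_left linear_series_action_right | simp)+
qed

text \<open>
  The weights \<open>\<alpha> + i\<close> are pairwise different, so an eigenvector of \<open>x\<^sub>0\<close> has a single component.
\<close>

lemma weight_space_series:
  assumes "\<And>i. F 0 i = \<alpha> + of_int i"
  shows "weight_space pm_scale (series_action F) (\<alpha> + of_int i) = range (\<lambda>k. pm_scale k (vb i))"
proof -
  have "p \<in> weight_space pm_scale (series_action F) (\<alpha> + of_int i) \<longleftrightarrow>
     (\<forall>j. (\<alpha> + of_int j) * Poly_Mapping.lookup p j = (\<alpha> + of_int i) * Poly_Mapping.lookup p j)" for p
    unfolding weight_space_def mem_Collect_eq poly_mapping_eq_iff fun_eq_iff x0_def
    by (simp add: lookup_series_action_xi assms)
  also have "\<dots> p \<longleftrightarrow> p = pm_scale (Poly_Mapping.lookup p i) (vb i)" for p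
    unfolding poly_mapping_eq_iff fun_eq_iff by (auto simp: lookup_single when_def)
  finally have *: "p \<in> weight_space pm_scale (series_action F) (\<alpha> + of_int i) \<longleftrightarrow>
    p = pm_scale (Poly_Mapping.lookup p i) (vb i)" for p .
  show ?thesis
  proof (intro set_eqI iffI)
    fix p assume "p \<in> range (\<lambda>k. pm_scale k (vb i))"
    then show "p \<in> weight_space pm_scale (series_action F) (\<alpha> + of_int i)"
      unfolding * by auto
  qed (use * in blast)
qed

lemma pm_sum_keys: "(\<Sum>i\<in>Poly_Mapping.keys p. pm_scale (Poly_Mapping.lookup p i) (vb i)) = (p :: int \<Rightarrow>\<^sub>0 complex)"
  by (rule poly_mapping_eqI) (auto simp: lookup_sum lookup_single when_def in_keys_iff if_distrib cong: if_cong)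

lemma multiplicity_one_series:
  assumes "vir_coeffs UNIV \<alpha> F (\<lambda>_. 0)"
  shows "multiplicity_one_coset_module pm_scale (series_action F)"
proof -
  interpret vir_coeffs UNIV \<alpha> F "\<lambda>_. 0" by fact
  let ?W = "\<lambda>i. weight_space pm_scale (series_action F) (\<alpha> + of_int i)"
  have W: "?W i = range (\<lambda>k. pm_scale k (vb i))" for i
    using weight_space_series[of F \<alpha> i] weight by simp
  have W_lookup: "p = pm_scale (Poly_Mapping.lookup p i) (vb i)" if "p \<in> ?W i" for p i
    using that unfolding W by auto
  have "p \<in> pm.span (\<Union>\<mu>. weight_space pm_scale (series_action F) \<mu>)" for p
  proof (induction p rule: pm_basis_induct)
    case (basis i)
    have "vb i \<in> ?W i" unfolding W by (rule range_eqI[of _ _ 1]) simp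
    then show ?case by (intro pm.span_base) blast
  qed (auto intro: pm.span_zero pm.span_add pm.span_scale)
  then have "weight_module pm_scale (series_action F)" unfolding weight_module_def by auto
  moreover have "is_direct_sum ?W"
    unfolding is_direct_sum_def
  proof (intro allI ex1I conjI)
    fix p :: "int \<Rightarrow>\<^sub>0 complex"
    let ?f = "\<lambda>i. pm_scale (Poly_Mapping.lookup p i) (vb i)"
    have nz: "{i. ?f i \<noteq> 0} = Poly_Mapping.keys p"
      by (auto simp: in_keys_iff poly_mapping_eq_iff fun_eq_iff lookup_single when_def)
    show "?f i \<in> ?W i" for i unfolding W by blast
    show "finite {i. ?f i \<noteq> 0}" unfolding nz by simp
    show "p = (\<Sum>i | ?f i \<noteq> 0. ?f i)" unfolding nz pm_sum_keys ..
  next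
    fix p :: "int \<Rightarrow>\<^sub>0 complex" and f
    assume f: "(\<forall>i. f i \<in> ?W i) \<and> finite {i. f i \<noteq> 0} \<and> p = (\<Sum>i | f i \<noteq> 0. f i)"
    show "f = (\<lambda>i. pm_scale (Poly_Mapping.lookup p i) (vb i))"
    proof
      fix i
      have l: "Poly_Mapping.lookup (f j) i = (if j = i then Poly_Mapping.lookup (f i) i else 0)" for j
        using W_lookup[of "f j" j] f by (metis lookup_pm_scale lookup_single_not_eq mult_zero_right)
      have "Poly_Mapping.lookup p i = (\<Sum>j | f j \<noteq> 0. Poly_Mapping.lookup (f j) i)"
        using f by (simp add: lookup_sum)
      also have "\<dots> = (\<Sum>j | f j \<noteq> 0. if j = i then Poly_Mapping.lookup (f i) i else 0)"
        by (rule sum.cong[OF refl]) (rule l)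
      also have "\<dots> = Poly_Mapping.lookup (f i) i"
        using f by simp
      finally show "f i = pm_scale (Poly_Mapping.lookup p i) (vb i)"
        using W_lookup[of "f i" i] f by simp
    qed
  qed
  moreover have "pm.dim (?W i) = 1" for i
  proof -
    have "?W i = pm.span {vb i}" unfolding W pm.span_singleton ..
    moreover have "\<not> pm.dependent {vb i}" by (simp add: single_zero poly_mapping_eq_iff fun_eq_iff lookup_single when_def)
    ultimately show ?thesis using pm.dim_span_eq_card_independent[of "{vb i}"] by simp
  qed
  ultimately show ?thesis
    unfolding multiplicity_one_coset_module_def using w22_module_series[OF assms] by blast
qed

text \<open>
  In a decomposition into two submodules the components of the weight vector \<open>v\<^sub>i\<close> are weight vectors
  of the same weight, so \<open>v\<^sub>i\<close> lies in one of the two summands.  A nonzero coefficient puts \<open>v\<^sub>i\<close> and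
  \<open>v\<^sub>i\<^sub>+\<^sub>m\<close> into the same summand, so connectedness of the graph of nonzero coefficients suffices.
\<close>

lemma series_indecomposable:
  assumes "vir_coeffs UNIV \<alpha> F (\<lambda>_. 0)"
    and connected: "\<And>P. (\<And>m i. F m i \<noteq> 0 \<Longrightarrow> P i \<longleftrightarrow> P (i + m)) \<Longrightarrow> (\<And>i. P (i + 1) \<longleftrightarrow> P i)"
  shows "w22_indecomposable pm_scale (series_action F)"
  unfolding w22_indecomposable_def
proof (intro conjI allI impI)
  interpret vir_coeffs UNIV \<alpha> F "\<lambda>_. 0" by fact
  have vb0: "vb i \<noteq> 0" for i :: int by (simp add: poly_mapping_eq_iff fun_eq_iff lookup_single when_def)
  then show "(UNIV :: (int \<Rightarrow>\<^sub>0 complex) set) \<noteq> {0}" by blast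
  fix U W
  assume U: "w22_submodule pm_scale (series_action F) U" and W: "w22_submodule pm_scale (series_action F) W"
    and UW: "U \<inter> W = {0}" and sum: "{u + w |u w. u \<in> U \<and> w \<in> W} = UNIV"
  have sub: "pm.subspace U" "pm.subspace W"
    and act: "\<And>x u. u \<in> U \<Longrightarrow> series_action F x u \<in> U" "\<And>x u. u \<in> W \<Longrightarrow> series_action F x u \<in> W"
    using U W unfolding w22_submodule_def by blast+
  have in_or: "vb i \<in> U \<or> vb i \<in> W" for i
  proof -
    obtain u w where u: "u \<in> U" and w: "w \<in> W" and vi: "vb i = u + w" using sum by blast
    let ?w = "\<lambda>i. \<alpha> + of_int i"
    \<comment> \<open>The vector \<open>d\<close> lies in both summands, as \<open>x\<^sub>0\<close> acts on \<open>v\<^sub>i\<close> by its weight.\<close>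
    define d where "d = series_action F (xi 0) u - pm_scale (?w i) u"
    have "d \<in> U" unfolding d_def by (intro pm.subspace_diff pm.subspace_scale sub act u)
    have "series_action F (xi 0) (vb i) = pm_scale (?w i) (vb i)"
      using weight[of i] by (simp add: series_action_basis)
    then have "d = pm_scale (?w i) w - series_action F (xi 0) w"
      unfolding d_def vi by (simp add: series_right.add pm.scale_right_distrib algebra_simps)
    then have "d \<in> W" by (simp only:) (intro pm.subspace_diff pm.subspace_scale sub act w)
    with \<open>d \<in> U\<close> UW have "d = 0" by blast
    then have "?w j * Poly_Mapping.lookup u j = ?w i * Poly_Mapping.lookup u j" for j
    proof -
      have "Poly_Mapping.lookup d j = 0" using \<open>d = 0\<close> by simp
      then show ?thesis
        using weight[of j] by (simp add: d_def lookup_minus lookup_series_action_xi)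
    qed
    then have "u = pm_scale (Poly_Mapping.lookup u i) (vb i)"
      unfolding poly_mapping_eq_iff fun_eq_iff by (auto simp: lookup_single when_def)
    then obtain a where a: "u = pm_scale a (vb i)" by blast
    show ?thesis
    proof (cases "a = 0")
      case True
      then show ?thesis using vi a w by simp
    next
      case False
      then have "vb i = pm_scale (1 / a) u" unfolding a by simp
      then show ?thesis using pm.subspace_scale[OF sub(1) u] by metis
    qed
  qed
  have not_both: "\<not> (vb i \<in> U \<and> vb i \<in> W)" for i using UW vb0 by blast
  have edge: "vb i \<in> Z \<Longrightarrow> vb (i + m) \<in> Z" if "F m i \<noteq> 0" "pm.subspace Z"
    "\<And>x u. u \<in> Z \<Longrightarrow> series_action F x u \<in> Z" for m i Z
  proof -
    assume "vb i \<in> Z"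
    then have "pm_scale (1 / F m i) (series_action F (xi m) (vb i)) \<in> Z"
      using that pm.subspace_scale by blast
    then show "vb (i + m) \<in> Z" using that(1) by (simp add: series_action_basis add.commute)
  qed
  have "vb (i + 1) \<in> U \<longleftrightarrow> vb i \<in> U" for i
  proof (rule connected[of "\<lambda>i. vb i \<in> U"])
    fix m i assume "F m i \<noteq> 0"
    then show "vb i \<in> U \<longleftrightarrow> vb (i + m) \<in> U"
      using edge[of m i U] edge[of m i W] sub act in_or not_both by blast
  qed
  then have const: "vb i \<in> U \<longleftrightarrow> vb 0 \<in> U" for i
    using int_step_const_all[of "\<lambda>i. vb i \<in> U" i] by (metis diff_add_cancel)
  have all: "Z = UNIV" if "pm.subspace Z" "\<And>i. vb i \<in> Z" for Z :: "(int \<Rightarrow>\<^sub>0 complex) set"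
  proof -
    have "p \<in> Z" for p
      by (induction p rule: pm_basis_induct)
        (auto intro: that pm.subspace_0 pm.subspace_add pm.subspace_scale)
    then show ?thesis by blast
  qed
  show "U = {0} \<or> W = {0}"
  proof (cases "vb 0 \<in> U")
    case True
    then have "U = UNIV" using all[OF sub(1)] const by blast
    then show ?thesis using UW by blast
  next
    case False
    then have "W = UNIV" using all[OF sub(2)] const in_or by blast
    then show ?thesis using UW by blast
  qed
qed

lemma vir_coeffs_intermediate_series:
  assumes "intermediate_series F"
  obtains \<alpha> where "vir_coeffs UNIV \<alpha> F (\<lambda>_. 0)"
  using assms vir_coeffs_density vir_coeffs_jump vir_coeffs_transpose[OF vir_coeffs_jump]
  unfolding intermediate_series_def by blast

text \<open>
  Nonzero indices are connected among each other.  The index \<open>0\<close> is linked to \<open>1\<close> or to \<open>2\<close>, because for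
  \<open>\<kappa> \<noteq> 0\<close> the coefficients \<open>\<kappa> + \<rho>\<close> and \<open>2 (2 \<kappa> + \<rho>)\<close> do not vanish together.
\<close>

lemma jump_connected:
  assumes \<kappa>: "\<kappa> \<noteq> 0" and P: "\<And>m i. jump_coeffs \<kappa> \<rho> m i \<noteq> 0 \<Longrightarrow> P i \<longleftrightarrow> P (i + m)"
  shows "P (i + 1) \<longleftrightarrow> P i"
proof -
  have generic: "P (j + m) \<longleftrightarrow> P j" if "j \<noteq> 0" "j + m \<noteq> 0" for j m
    using P[of m j] that by (simp add: jump_coeffs_def del: of_int_add)
  have "\<kappa> + \<rho> \<noteq> 0 \<or> 2 * \<kappa> + \<rho> \<noteq> 0" 
  proof -
    have "\<kappa> = (2 * \<kappa> + \<rho>) - (\<kappa> + \<rho>)" by simp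
    then show ?thesis using \<kappa> by (metis diff_0_right)
  qed
  moreover have "jump_coeffs \<kappa> \<rho> 1 0 = \<kappa> + \<rho>" "jump_coeffs \<kappa> \<rho> 2 0 = 2 * (2 * \<kappa> + \<rho>)"
    by (simp_all add: jump_coeffs_def mult.commute)
  ultimately have "jump_coeffs \<kappa> \<rho> 1 0 \<noteq> 0 \<or> jump_coeffs \<kappa> \<rho> 2 0 \<noteq> 0"
    by (metis mult_eq_0_iff zero_neq_numeral)
  then obtain m :: int where "m \<noteq> 0" "jump_coeffs \<kappa> \<rho> m 0 \<noteq> 0"
    by (metis zero_neq_numeral zero_neq_one)
  then have m: "m \<noteq> 0" "P m \<longleftrightarrow> P 0" using P[of m 0] by simp_all
  then have zero: "P j \<longleftrightarrow> P 0" for j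
    using generic[of m "j - m"] m by (cases "j = 0") auto
  show ?thesis using zero[of i] zero[of "i + 1"] by blast
qed

text \<open>
  Neighbours are linked by \<open>x\<^sub>1\<close> or \<open>x\<^sub>-\<^sub>1\<close> unless \<open>b = 1/2\<close> and \<open>a + i = -1/2\<close>; then the detour through
  \<open>i + 2\<close> works.
\<close>

lemma density_connected:
  assumes P: "\<And>m i. density_coeffs a b m i \<noteq> 0 \<Longrightarrow> P i \<longleftrightarrow> P (i + m)"
  shows "P (i + 1) \<longleftrightarrow> P i"
proof (cases "density_coeffs a b 1 i = 0 \<and> density_coeffs a b (- 1) (i + 1) = 0")
  case False
  then show ?thesis using P[of 1 i] P[of "- 1" "i + 1"] by auto
next
  case True
  then have e: "a + of_int i + b = 0" "a + of_int i + 1 - b = 0"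
    by (simp_all add: density_coeffs_def algebra_simps)
  then have "(a + of_int i + 1 - b) - (a + of_int i + b) = 0" by (simp only: diff_self)
  then have "1 - 2 * b = 0" by (simp add: algebra_simps)
  then have w: "a + of_int i = - b" "b = 1/2" using e(1) by (simp_all add: eq_neg_iff_add_eq_0 field_simps)
  have "density_coeffs a b 2 i \<noteq> 0" "density_coeffs a b 1 (i + 1) \<noteq> 0"
    unfolding density_coeffs_def of_int_add add.assoc[symmetric] w by simp_all
  then show ?thesis using P[of 2 i] P[of 1 "i + 1"] by (simp add: add.assoc)
qed

lemma intermediate_series_module:
  assumes "intermediate_series F"
  shows "multiplicity_one_coset_module pm_scale (series_action F) \<and> w22_indecomposable pm_scale (series_action F)"
proof -
  obtain \<alpha> where F: "vir_coeffs UNIV \<alpha> F (\<lambda>_. 0)"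
    using vir_coeffs_intermediate_series[OF assms] .
  have "w22_indecomposable pm_scale (series_action F)"
  proof (rule series_indecomposable[OF F])
    fix P i assume P: "\<And>m i. F m i \<noteq> 0 \<Longrightarrow> P i \<longleftrightarrow> P (i + m)"
    consider a b where "F = density_coeffs a b" | a where "F = jump_coeffs 1 a"
      | a where "F = transpose_coeffs (jump_coeffs (- 1) a)"
      using assms unfolding intermediate_series_def by blast
    then show "P (i + 1) \<longleftrightarrow> P i"
    proof cases
      case 1
      show ?thesis by (rule density_connected) (use P in \<open>unfold 1\<close>)
    next
      case 2
      show ?thesis by (rule jump_connected[of 1]) (use P in \<open>unfold 2, simp_all\<close>)
    next
      case (3 a)
      show ?thesis
      proof (rule jump_connected[of "- 1" a])
        fix m i assume "jump_coeffs (- 1) a m i \<noteq> 0"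
        then show "P i \<longleftrightarrow> P (i + m)" using P[of "- m" "i + m"] by (simp add: 3 transpose_coeffs_def)
      qed simp
    qed
  qed
  then show ?thesis using multiplicity_one_series[OF F] by blast
qed

lemma act_A_ab0_density: "act_A_ab0 a b = series_action (density_coeffs a b)"
  by (simp add: act_A_ab0_def density_coeffs_def[abs_def])

lemma act_A_a0_jump: "act_A_a0 a = series_action (jump_coeffs 1 a)"
  unfolding act_A_a0_def jump_coeffs_def[abs_def] mult_1 ..

lemma act_B_a0_jump: "act_B_a0 a = series_action (transpose_coeffs (jump_coeffs (- 1) a))"
proof -
  have "transpose_coeffs (jump_coeffs (- 1) a) =
    (\<lambda>m i. if i \<noteq> - m then of_int i else - of_int m * (of_int m + a))"
    by (auto simp: fun_eq_iff transpose_coeffs_def jump_coeffs_def eq_neg_iff_add_eq_0)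
  then show ?thesis by (simp add: act_B_a0_def)
qed

section \<open>Weight modules and their structure constants\<close>

definition basis_degree :: "w22_index \<Rightarrow> int"
  where "basis_degree g = (case g of Xi m \<Rightarrow> m | Ii m \<Rightarrow> m | _ \<Rightarrow> 0)"

lemma bracket_x0: "w22_basis_bracket (Xi 0) g = pm_scale (of_int (basis_degree g)) (Poly_Mapping.single g 1)"
  by (cases g) (auto intro!: poly_mapping_eqI simp: basis_degree_def lookup_add lookup_single when_def)

context w22_module
begin

lemma act_add: "act x (u + v) = act x u + act x v"
  and act_scale: "act x (scale c v) = scale c (act x v)"
  using act_linear_right[of x] by (simp_all add: Vector_Spaces.linear_iff)

lemma add_act: "act (x + y) v = act x v + act y v"
  and scale_act: "act (pm_scale c x) v = scale c (act x v)"
  using act_linear_left[of v] by (simp_all add: Vector_Spaces.linear_iff)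

lemma act_zero: "act x 0 = 0"
  using act_add[of x 0 0] by simp

lemma zero_act: "act 0 v = 0"
  using add_act[of 0 0 v] by simp

lemma single_act: "act (Poly_Mapping.single g a) v = scale a (act (Poly_Mapping.single g 1) v)"
  by (subst single_eq_pm_scale) (rule scale_act)

lemma act_basis_bracket:
  "act (w22_basis_bracket g h) v = act (Poly_Mapping.single g 1) (act (Poly_Mapping.single h 1) v) -
    act (Poly_Mapping.single h 1) (act (Poly_Mapping.single g 1) v)"
  unfolding w22_bracket_basis[symmetric] by (rule act_bracket)

lemma act_weight_space:
  assumes "v \<in> weight_space scale act \<mu>"
  shows "act (Poly_Mapping.single g 1) v \<in> weight_space scale act (\<mu> + of_int (basis_degree g))"
proof -
  have v: "act (xi 0) v = scale \<mu> v" using assms by (simp add: weight_space_def x0_def)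
  have "act (xi 0) (act (Poly_Mapping.single g 1) v) =
    scale (of_int (basis_degree g)) (act (Poly_Mapping.single g 1) v) + scale \<mu> (act (Poly_Mapping.single g 1) v)"
    using act_basis_bracket[of "Xi 0" g v] unfolding bracket_x0 scale_act v act_scale by (simp add: algebra_simps)
  then show ?thesis by (simp add: weight_space_def x0_def scale_left_distrib add.commute)
qed

lemma subspace_weight_space: "subspace (weight_space scale act \<mu>)"
  by (rule subspaceI) (auto simp: weight_space_def act_zero act_add act_scale scale_right_distrib mult.commute)

lemma weight_space_dim_one:
  assumes "dim (weight_space scale act \<mu>) = 1"
  obtains v where "v \<noteq> 0" "weight_space scale act \<mu> = range (\<lambda>k. scale k v)"
proof -
  obtain B where B: "B \<subseteq> weight_space scale act \<mu>" "independent B" "weight_space scale act \<mu> \<subseteq> span B"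
    "card B = dim (weight_space scale act \<mu>)"
    by (rule basis_exists)
  then obtain v where v: "B = {v}" using assms by (metis card_1_singletonE)
  have "v \<noteq> 0" using B(2) unfolding v by simp
  moreover have "span B \<subseteq> weight_space scale act \<mu>"
    by (rule span_minimal[OF B(1) subspace_weight_space])
  then have "weight_space scale act \<mu> = range (\<lambda>k. scale k v)"
    using B(3) unfolding v span_singleton by blast
  ultimately show thesis by (rule that)
qed

text \<open>
  The linear map that sends the basis vector of index \<open>i\<close> to \<open>e i\<close>.
\<close>

definition comb :: "(int \<Rightarrow> 'v) \<Rightarrow> (int \<Rightarrow>\<^sub>0 complex) \<Rightarrow> 'v"
  where "comb e p = (\<Sum>i\<in>Poly_Mapping.keys p. scale (Poly_Mapping.lookup p i) (e i))"

lemma comb_superset: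
  assumes "finite A" "Poly_Mapping.keys p \<subseteq> A"
  shows "comb e p = (\<Sum>i\<in>A. scale (Poly_Mapping.lookup p i) (e i))"
  unfolding comb_def by (rule sum.mono_neutral_left) (use assms in \<open>auto simp: in_keys_iff\<close>)

lemma comb_add: "comb e (p + q) = comb e p + comb e q"
proof -
  let ?A = "Poly_Mapping.keys p \<union> Poly_Mapping.keys q"
  have "Poly_Mapping.keys (p + q) \<subseteq> ?A" by (rule Poly_Mapping.keys_add)
  then show ?thesis
    by (simp add: comb_superset[of ?A] lookup_add scale_left_distrib sum.distrib)
qed

lemma comb_scale: "comb e (pm_scale c p) = scale c (comb e p)"
proof -
  have "Poly_Mapping.keys (pm_scale c p) \<subseteq> Poly_Mapping.keys p" by (auto simp: in_keys_iff)
  then show ?thesis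
    by (simp add: comb_superset[of "Poly_Mapping.keys p"] scale_sum_right)
qed

lemma comb_basis: "comb e (vb i) = e i"
  by (simp add: comb_def)

lemma linear_comb: "Vector_Spaces.linear pm_scale scale (comb e)"
  unfolding Vector_Spaces.linear_iff
  by (simp add: vector_space_pm_scale vector_space_axioms comb_add comb_scale)

lemma comb_zero: "comb e 0 = 0"
  by (simp add: comb_def)

lemma range_comb: "range (comb e) = span (range e)"
proof
  have "comb e p \<in> span (range e)" for p
    unfolding comb_def by (intro span_sum span_scale span_base rangeI)
  then show "range (comb e) \<subseteq> span (range e)" by blast
  have "subspace (range (comb e))"
  proof (rule subspaceI)
    show "0 \<in> range (comb e)" using comb_zero by (metis rangeI)
  next
    fix x y assume "x \<in> range (comb e)" "y \<in> range (comb e)"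
    then obtain p q where "x = comb e p" "y = comb e q" by blast
    then show "x + y \<in> range (comb e)" using comb_add[of e p q] by (metis rangeI)
  next
    fix c x assume "x \<in> range (comb e)"
    then obtain p where "x = comb e p" by blast
    then show "scale c x \<in> range (comb e)" using comb_scale[of e c p] by (metis rangeI)
  qed
  then show "span (range e) \<subseteq> range (comb e)"
    by (intro span_minimal) (auto simp: comb_basis[symmetric, of e])
qed

lemma comb_equivariant:
  assumes "\<And>m i. act (xi m) (e i) = scale (F m i) (e (m + i))"
    and "\<And>g i. (\<And>m. g \<noteq> Xi m) \<Longrightarrow> act (Poly_Mapping.single g 1) (e i) = 0"
  shows "comb e (series_action F x p) = act x (comb e p)"
proof (induction x rule: pm_basis_induct)
  case (basis g)
  show ?case
  proof (induction p rule: pm_basis_induct)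
    case (basis i)
    show ?case using assms
      by (cases g) (simp_all add: series_action_basis comb_scale comb_basis comb_zero)
  qed (simp_all add: series_right.add series_right.scale series_right.zero comb_zero comb_add comb_scale
      act_zero act_add act_scale)
qed (simp_all add: series_left.add series_left.scale series_left.zero comb_zero comb_add comb_scale
      zero_act add_act scale_act)

end

text \<open>
  Weights \<open>\<alpha> + i\<close> of multiplicity at most one: \<open>e i\<close> spans the weight space, and \<open>e i = 0\<close> encodes that
  the weight does not occur.
\<close>

locale weighted_module = w22_module scale act
  for scale :: "complex \<Rightarrow> 'v \<Rightarrow> 'v::ab_group_add" and act +
  fixes \<alpha> :: complex and e :: "int \<Rightarrow> 'v"
  assumes weight_line: "weight_space scale act (\<alpha> + of_int i) = range (\<lambda>k. scale k (e i))"
    and spanning: "span (range e) = UNIV"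
begin

lemma e_weight: "e i \<in> weight_space scale act (\<alpha> + of_int i)"
  unfolding weight_line by (rule range_eqI[of _ _ 1]) simp

lemma act_e: "act (xi 0) (e i) = scale (\<alpha> + of_int i) (e i)"
  using e_weight[of i] by (simp add: weight_space_def x0_def)

text \<open>
  The usual argument for eigenvectors of \<open>x\<^sub>0\<close>.  Since \<open>e i\<close> may be \<open>0\<close>, the conclusion is that the
  summands vanish.
\<close>

lemma independent_e:
  assumes "finite A" "(\<Sum>i\<in>A. scale (a i) (e i)) = 0" "i \<in> A"
  shows "scale (a i) (e i) = 0"
  using assms
proof (induction A arbitrary: a i rule: finite_induct)
  case (insert j A)
  have act_sum: "act x (\<Sum>i\<in>A. g i) = (\<Sum>i\<in>A. act x (g i))" for x and g :: "int \<Rightarrow> 'v"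
    using insert(1) by (induction A) (simp_all add: act_zero act_add)
  have eq: "scale (a j) (e j) + (\<Sum>i\<in>A. scale (a i) (e i)) = 0"
    using insert.prems(1) insert.hyps by simp
  let ?w = "\<lambda>i. \<alpha> + of_int i"
  have "scale (?w j) (scale (a j) (e j)) + (\<Sum>i\<in>A. scale (?w i) (scale (a i) (e i))) =
    act (xi 0) (scale (a j) (e j) + (\<Sum>i\<in>A. scale (a i) (e i)))"
    by (simp add: act_add act_sum act_scale act_e mult.commute)
  also have "\<dots> = scale (?w j) (scale (a j) (e j) + (\<Sum>i\<in>A. scale (a i) (e i)))"
    unfolding eq by (simp add: act_zero)
  finally have "(\<Sum>i\<in>A. scale ((?w i - ?w j) * a i) (e i)) = 0"
    by (simp add: scale_right_distrib scale_sum_right left_diff_distrib scale_left_diff_distrib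
        sum_subtractf distrib_right scale_left_distrib sum.distrib)
  then have "scale ((?w i - ?w j) * a i) (e i) = 0" if "i \<in> A" for i
    using that by (rule insert.IH[of "\<lambda>i. (?w i - ?w j) * a i"])
  then have A: "scale (a i) (e i) = 0" if "i \<in> A" for i
    using insert.hyps(2) that by fastforce
  then have "(\<Sum>i\<in>A. scale (a i) (e i)) = 0" by (intro sum.neutral) blast
  then have "scale (a j) (e j) = 0" using eq by simp
  then show ?case using A insert.prems(2) by blast
qed simp

lemma matrix_coeff_exists:
  "\<exists>k. act (Poly_Mapping.single g 1) (e i) = scale k (e (i + basis_degree g)) \<and>
    (e i = 0 \<or> e (i + basis_degree g) = 0 \<longrightarrow> k = 0)"
proof -
  have "act (Poly_Mapping.single g 1) (e i) \<in> weight_space scale act (\<alpha> + of_int (i + basis_degree g))"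
    using act_weight_space[OF e_weight, of g i] by (simp add: add.assoc)
  then obtain k where k: "act (Poly_Mapping.single g 1) (e i) = scale k (e (i + basis_degree g))"
    unfolding weight_line by blast
  show ?thesis
  proof (cases "e i = 0 \<or> e (i + basis_degree g) = 0")
    case True
    then have "act (Poly_Mapping.single g 1) (e i) = 0" using k by (auto simp: act_zero)
    then show ?thesis by (intro exI[of _ 0]) simp
  qed (use k in blast)
qed

text \<open>
  The choice is unique unless the source or the target is \<open>0\<close>; there the value \<open>0\<close> is imposed, as the
  structure constants require.
\<close>

definition matrix_coeff :: "w22_index \<Rightarrow> int \<Rightarrow> complex"
  where "matrix_coeff g i = (SOME k. act (Poly_Mapping.single g 1) (e i) = scale k (e (i + basis_degree g)) \<and>
    (e i = 0 \<or> e (i + basis_degree g) = 0 \<longrightarrow> k = 0))"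

lemma act_matrix_coeff: "act (Poly_Mapping.single g 1) (e i) = scale (matrix_coeff g i) (e (i + basis_degree g))"
  and matrix_coeff_outside: "e i = 0 \<or> e (i + basis_degree g) = 0 \<Longrightarrow> matrix_coeff g i = 0"
  using someI_ex[OF matrix_coeff_exists[of g i]] unfolding matrix_coeff_def by blast+

abbreviation "supp \<equiv> {i. e i \<noteq> 0}"
abbreviation "xi_coeff m i \<equiv> matrix_coeff (Xi m) i"

lemma act_xi: "act (xi m) (e i) = scale (xi_coeff m i) (e (i + m))"
  using act_matrix_coeff[of "Xi m" i] by (simp add: basis_degree_def)

text \<open>
  The element \<open>I(0)\<close> acts on each weight vector by a scalar \<open>h\<close>.  From \<open>[I(0), x\<^sub>m] = m I(m)\<close> the
  coefficient of \<open>I(m)\<close> is \<open>(h (i + m) - h i) / m\<close> times that of \<open>x\<^sub>m\<close>, and \<open>[I(0), I(m)] = 0\<close> says that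
  \<open>h (i + m) - h i\<close> times the coefficient of \<open>I(m)\<close> vanishes.  So \<open>I(m)\<close> acts by zero for \<open>m \<noteq> 0\<close>, and
  \<open>I(0)\<close> is a multiple of the bracket \<open>[x\<^sub>1, I(-1)]\<close>.
\<close>

lemma I_acts_zero: "act (Poly_Mapping.single (Ii m) 1) (e i) = 0"
proof -
  define h where "h i = matrix_coeff (Ii 0) i" for i
  have I0: "act (Poly_Mapping.single (Ii 0) 1) (e i) = scale (h i) (e i)" for i
    using act_matrix_coeff[of "Ii 0" i] by (simp add: basis_degree_def h_def)
  have I: "act (Poly_Mapping.single (Ii m) 1) (e i) = scale (matrix_coeff (Ii m) i) (e (i + m))" for m i
    using act_matrix_coeff[of "Ii m" i] by (simp add: basis_degree_def)
  have nonzero: "act (Poly_Mapping.single (Ii m) 1) (e i) = 0" if m: "m \<noteq> 0" for m i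
  proof (cases "e (i + m) = 0")
    case False
    have b: "w22_basis_bracket (Ii 0) (Xi m) = Poly_Mapping.single (Ii m) (of_int m)"
      using m by (auto intro!: poly_mapping_eqI simp: lookup_minus lookup_add lookup_single when_def)
    have "scale (of_int m * matrix_coeff (Ii m) i) (e (i + m)) = scale ((h (i + m) - h i) * xi_coeff m i) (e (i + m))"
      using act_basis_bracket[of "Ii 0" "Xi m" "e i"] unfolding b single_act[of "Ii m" "of_int m"]
      by (simp add: I[of m] I0 act_xi act_scale left_diff_distrib right_diff_distrib scale_left_diff_distrib mult.commute)
    then have 1: "of_int m * matrix_coeff (Ii m) i = (h (i + m) - h i) * xi_coeff m i"
      using False by simp
    have "scale ((h (i + m) - h i) * matrix_coeff (Ii m) i) (e (i + m)) = 0"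
      using act_basis_bracket[of "Ii 0" "Ii m" "e i"]
      by (simp add: I[of m] I0 act_scale zero_act left_diff_distrib scale_left_diff_distrib mult.commute)
    then have "h (i + m) - h i = 0 \<or> matrix_coeff (Ii m) i = 0" using False by simp
    then have "matrix_coeff (Ii m) i = 0" using 1 m by (metis mult_eq_0_iff mult_zero_left of_int_eq_0_iff)
    then show ?thesis by (simp add: I)
  qed (simp add: I)
  show ?thesis
  proof (cases "m = 0")
    case True
    have b: "w22_basis_bracket (Xi 1) (Ii (- 1)) = Poly_Mapping.single (Ii 0) (- 2)"
      by (auto intro!: poly_mapping_eqI simp: lookup_minus lookup_add lookup_single when_def)
    have "scale (- 2) (act (Poly_Mapping.single (Ii 0) 1) (e i)) = 0"
      using act_basis_bracket[of "Xi 1" "Ii (- 1)" "e i"] unfolding b single_act[of "Ii 0" "- 2"]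
      by (simp add: nonzero act_xi act_scale act_zero)
    then show ?thesis using True by simp
  qed (rule nonzero)
qed

lemma C1_acts_zero: "act (Poly_Mapping.single C1i 1) (e i) = 0"
proof -
  have b: "w22_basis_bracket (Xi 2) (Ii (- 2)) = Poly_Mapping.single (Ii 0) (- 4) + Poly_Mapping.single C1i (1/2)"
    by (auto intro!: poly_mapping_eqI simp: lookup_minus lookup_add lookup_single when_def)
  have "scale (1/2) (act (Poly_Mapping.single C1i 1) (e i)) = 0"
    using act_basis_bracket[of "Xi 2" "Ii (- 2)" "e i"]
    unfolding b add_act single_act[of "Ii 0" "- 4"] single_act[of C1i "1/2"]
    by (simp add: I_acts_zero act_xi act_scale act_zero)
  then show ?thesis by simp
qed

lemma vir_coeffs_xi_coeff: "vir_coeffs supp \<alpha> (\<lambda>m i. xi_coeff m i) (matrix_coeff Ci)"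
proof
  fix m i
  show "xi_coeff m i = 0" if "i \<notin> supp" using matrix_coeff_outside[of i "Xi m"] that by simp
  show "xi_coeff m i = 0" if "i + m \<notin> supp" using matrix_coeff_outside[of i "Xi m"] that by (simp add: basis_degree_def)
  show "xi_coeff 0 i = \<alpha> + of_int i" if "i \<in> supp" using act_xi[of 0 i] act_e[of i] that by simp
  have C: "act (Poly_Mapping.single Ci 1) (e i) = scale (matrix_coeff Ci i) (e i)" for i
    using act_matrix_coeff[of Ci i] by (simp add: basis_degree_def)
  show "xi_coeff m i * matrix_coeff Ci (i + m) = xi_coeff m i * matrix_coeff Ci i"
  proof (cases "e (i + m) = 0")
    case True
    then show ?thesis using matrix_coeff_outside[of i "Xi m"] by (simp add: basis_degree_def)
  next
    case False
    have "scale (xi_coeff m i * matrix_coeff Ci (i + m)) (e (i + m)) = scale (xi_coeff m i * matrix_coeff Ci i) (e (i + m))"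
      using act_basis_bracket[of Ci "Xi m" "e i"]
      by (simp add: zero_act act_xi C act_scale mult.commute)
    then show ?thesis using False by simp
  qed
  fix n
  show "xi_coeff m i * xi_coeff n (i + m) - xi_coeff n i * xi_coeff m (i + n) =
    of_int (m - n) * xi_coeff (m + n) i + (if n = - m then of_int (n ^ 3 - n) / 12 * matrix_coeff Ci i else 0)"
  proof (cases "e (i + m + n) = 0")
    case True
    have "n = - m \<longrightarrow> matrix_coeff Ci i = 0" using True matrix_coeff_outside[of i Ci] by auto
    moreover have "xi_coeff n (i + m) = 0" "xi_coeff m (i + n) = 0" "xi_coeff (m + n) i = 0" using True
      using matrix_coeff_outside[of "i + m" "Xi n"] matrix_coeff_outside[of "i + n" "Xi m"]
        matrix_coeff_outside[of i "Xi (m + n)"]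
      by (simp_all add: basis_degree_def add_ac)
    ultimately show ?thesis by simp
  next
    case False
    have "scale (xi_coeff m i * xi_coeff n (i + m) - xi_coeff n i * xi_coeff m (i + n)) (e (i + m + n)) =
      act (w22_basis_bracket (Xi n) (Xi m)) (e i)"
      unfolding act_basis_bracket
      by (simp add: act_xi act_scale scale_left_diff_distrib add_ac)
    also have "\<dots> = scale (of_int (m - n) * xi_coeff (m + n) i) (e (i + m + n)) +
       (if n = - m then scale (of_int (n ^ 3 - n) / 12 * matrix_coeff Ci i) (e i) else 0)"
    proof -
      have "act (Poly_Mapping.single (Xi (n + m)) (of_int (m - n))) (e i) =
        scale (of_int (m - n) * xi_coeff (m + n) i) (e (i + m + n))"
        by (subst single_act) (simp add: act_xi add_ac)
      moreover have "act (Poly_Mapping.single Ci a) (e i) = scale (a * matrix_coeff Ci i) (e i)" for a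
        by (subst single_act) (simp add: C)
      ultimately show ?thesis by (simp add: add_act zero_act del: of_int_diff)
    qed
    also have "\<dots> = scale (of_int (m - n) * xi_coeff (m + n) i +
      (if n = - m then of_int (n ^ 3 - n) / 12 * matrix_coeff Ci i else 0)) (e (i + m + n))"
      by (simp add: scale_left_distrib)
    finally show ?thesis using False unfolding scale_cancel_right by blast
  qed
qed

end

section \<open>Submodules, isomorphisms and quotients\<close>

definition series_span :: "int set \<Rightarrow> (int \<Rightarrow>\<^sub>0 complex) set"
  where "series_span A = {p. Poly_Mapping.keys p \<subseteq> A}"

lemma submodule_series_span:
  assumes "\<And>i m. i \<in> A \<Longrightarrow> F m i \<noteq> 0 \<Longrightarrow> i + m \<in> A"
  shows "w22_submodule pm_scale (series_action F) (series_span A)"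
proof -
  have mem: "p \<in> series_span A \<longleftrightarrow> (\<forall>i. i \<notin> A \<longrightarrow> Poly_Mapping.lookup p i = 0)" for p
    by (auto simp: series_span_def in_keys_iff)
  have sub: "pm.subspace (series_span A)"
    by (rule pm.subspaceI) (auto simp: mem lookup_add)
  have basis: "series_action F (Poly_Mapping.single g 1) p \<in> series_span A" if "p \<in> series_span A" for g p
  proof (cases "\<exists>m. g = Xi m")
    case True
    then obtain m where "g = Xi m" ..
    then show ?thesis using that assms[of "_ - m" m] by (auto simp: mem lookup_series_action_xi)
  next
    case False
    then show ?thesis using pm.subspace_0[OF sub] by (simp add: series_action_not_xi)
  qed
  have "series_action F x p \<in> series_span A" if "p \<in> series_span A" for x p
    by (induction x rule: pm_basis_induct)
      (auto simp: series_left.add series_left.scale series_left.zero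
        intro: pm.subspace_0 pm.subspace_add pm.subspace_scale sub basis that)
  then show ?thesis using sub by (simp add: w22_submodule_def)
qed

lemma vb_in_series_span [simp]: "vb i \<in> series_span A \<longleftrightarrow> i \<in> A"
  by (simp add: series_span_def)

lemma vb_nonzero: "vb i \<noteq> 0"
  by (simp add: poly_mapping_eq_iff fun_eq_iff lookup_single when_def)

text \<open>
  The summands are the line of \<open>v\<^sub>0\<close> and the span of all other basis vectors.
\<close>

lemma jump_zero_decomposable: "\<not> w22_indecomposable pm_scale (series_action (jump_coeffs 0 0))"
proof
  assume ind: "w22_indecomposable pm_scale (series_action (jump_coeffs 0 0))"
  let ?U = "series_span {0}" and ?W = "series_span (- {0})"
  have "w22_submodule pm_scale (series_action (jump_coeffs 0 0)) ?U"
    "w22_submodule pm_scale (series_action (jump_coeffs 0 0)) ?W"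
    by (rule submodule_series_span; force simp: jump_coeffs_def simp flip: of_int_add)+
  moreover have "?U \<inter> ?W = {0}"
  proof -
    have "p = 0" if "p \<in> ?U" "p \<in> ?W" for p
    proof -
      have "Poly_Mapping.keys p = {}" using that unfolding series_span_def by blast
      then show ?thesis by simp
    qed
    moreover have "0 \<in> ?U" "0 \<in> ?W" by (simp_all add: series_span_def)
    ultimately show ?thesis by blast
  qed
  moreover have "{u + w |u w. u \<in> ?U \<and> w \<in> ?W} = UNIV"
  proof -
    have "\<exists>u w. p = u + w \<and> u \<in> ?U \<and> w \<in> ?W" for p :: "int \<Rightarrow>\<^sub>0 complex"
    proof (intro exI conjI)
      let ?u = "Poly_Mapping.single 0 (Poly_Mapping.lookup p 0)"
      show "p = ?u + (p - ?u)" by simp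
      show "?u \<in> ?U" by (simp add: series_span_def)
      show "p - ?u \<in> ?W" by (auto simp: series_span_def in_keys_iff lookup_minus)
    qed
    then show ?thesis by blast
  qed
  ultimately have "?U = {0} \<or> ?W = {0}"
    using ind unfolding w22_indecomposable_def by blast
  moreover have "vb 0 \<in> ?U" "vb 1 \<in> ?W" unfolding vb_in_series_span by simp_all
  ultimately show False using vb_nonzero by blast
qed

text \<open>
  In a jump module nothing maps into \<open>v\<^sub>0\<close>, so the other basis vectors span a submodule; after
  transposition nothing leaves the line of \<open>v\<^sub>0\<close>.
\<close>

lemma series_reducible:
  assumes "F = jump_coeffs \<kappa> \<rho> \<or> F = transpose_coeffs (jump_coeffs \<kappa> \<rho>)"
  shows "\<not> w22_irreducible pm_scale (series_action F)"
proof -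
  obtain A :: "int set" where A: "A \<noteq> {}" "A \<noteq> UNIV" "\<And>i m. i \<in> A \<Longrightarrow> F m i \<noteq> 0 \<Longrightarrow> i + m \<in> A"
    using assms
  proof
    assume "F = jump_coeffs \<kappa> \<rho>"
    moreover have "1 \<in> - {0 :: int}" by simp
    ultimately show thesis
      by (intro that[of "- {0}"]) (blast, blast, auto simp: jump_coeffs_def simp del: of_int_add)
  next
    assume "F = transpose_coeffs (jump_coeffs \<kappa> \<rho>)"
    moreover have "1 \<notin> {0 :: int}" by simp
    ultimately show thesis
      by (intro that[of "{0}"]) (blast, blast, auto simp: transpose_coeffs_def jump_coeffs_def split: if_splits)
  qed
  obtain i j where "i \<in> A" "j \<notin> A" using A by blast
  then have "vb i \<in> series_span A" "vb j \<notin> series_span A" by simp_all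
  then have "series_span A \<noteq> {0}" "series_span A \<noteq> UNIV" using vb_nonzero by blast+
  then show ?thesis using submodule_series_span[of A F, OF A(3)] unfolding w22_irreducible_def by blast
qed

lemma submodule_image:
  fixes h :: "'a::ab_group_add \<Rightarrow> 'b::ab_group_add"
  assumes lin: "Vector_Spaces.linear s s' h" and eq: "\<And>x v. h (a x v) = a' x (h v)"
    and U: "w22_submodule s a U"
  shows "w22_submodule s' a' (h ` U)"
proof -
  interpret Vector_Spaces.linear s s' h by fact
  have "a' x u \<in> h ` U" if u: "u \<in> h ` U" for x u
  proof -
    obtain v where v: "v \<in> U" "u = h v" using u by blast
    then have "a x v \<in> U" using U unfolding w22_submodule_def by blast
    then show ?thesis unfolding v(2) eq[symmetric] by blast
  qed
  then show ?thesis using U subspace_image[of U] unfolding w22_submodule_def by blast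
qed

lemma indecomposable_transfer:
  fixes h :: "'a::ab_group_add \<Rightarrow> 'b::ab_group_add"
  assumes lin: "Vector_Spaces.linear s s' h" and eq: "\<And>x v. h (a x v) = a' x (h v)" and bij: "bij h"
    and ind: "w22_indecomposable s' a'"
  shows "w22_indecomposable s a"
  unfolding w22_indecomposable_def
proof (intro conjI allI impI)
  interpret Vector_Spaces.linear s s' h by fact
  have inj: "h x = h y \<longleftrightarrow> x = y" for x y using bij by (simp add: bij_def inj_eq)
  have surj: "\<exists>x. y = h x" for y using bij by (meson bij_pointE)
  show "(UNIV :: 'a set) \<noteq> {0}"
  proof
    assume triv: "(UNIV :: 'a set) = {0}"
    have "y = 0" for y :: 'b
    proof -
      obtain x where "y = h x" using surj by blast
      moreover have "x = 0" using triv by blast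
      ultimately show ?thesis using zero by simp
    qed
    then have "y \<in> {0}" for y :: 'b by (simp only: singleton_iff)
    then have "(UNIV :: 'b set) = {0}" by (intro equalityI subsetI UNIV_I)
    moreover have "(UNIV :: 'b set) \<noteq> {0}"
      using ind unfolding w22_indecomposable_def by (rule conjunct1)
    ultimately show False by contradiction
  qed
  fix U W
  assume U: "w22_submodule s a U" and W: "w22_submodule s a W" and UW: "U \<inter> W = {0}"
    and sum: "{u + w |u w. u \<in> U \<and> w \<in> W} = UNIV"
  have "h ` U \<inter> h ` W = {0}"
    using UW zero by (simp add: image_Int[symmetric] bij_is_inj[OF bij])
  moreover have "{u + w |u w. u \<in> h ` U \<and> w \<in> h ` W} = UNIV"
  proof -
    have "\<exists>u w. y = u + w \<and> u \<in> h ` U \<and> w \<in> h ` W" for y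
    proof -
      obtain x where x: "y = h x" using surj by blast
      obtain u w where "x = u + w" "u \<in> U" "w \<in> W" using sum by blast
      then show ?thesis using x add by blast
    qed
    then show ?thesis by blast
  qed
  ultimately have "h ` U = {0} \<or> h ` W = {0}"
    using ind submodule_image[OF lin eq U] submodule_image[OF lin eq W]
    unfolding w22_indecomposable_def by blast
  then have "h ` U = h ` {0} \<or> h ` W = h ` {0}" using zero by simp
  then show "U = {0} \<or> W = {0}" unfolding inj_image_eq_iff[OF bij_is_inj[OF bij]] .
qed

lemma irreducible_transfer:
  fixes h :: "'a::ab_group_add \<Rightarrow> 'b::ab_group_add"
  assumes lin: "Vector_Spaces.linear s s' h" and eq: "\<And>x v. h (a x v) = a' x (h v)" and bij: "bij h"
    and irr: "w22_irreducible s' a'"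
  shows "w22_irreducible s a"
  unfolding w22_irreducible_def
proof (intro conjI allI impI)
  interpret Vector_Spaces.linear s s' h by fact
  show "(UNIV :: 'a set) \<noteq> {0}"
  proof
    assume triv: "(UNIV :: 'a set) = {0}"
    have "y = 0" for y :: 'b
    proof -
      obtain x where "y = h x" using bij by (rule bij_pointE)
      moreover have "x = 0" using triv by blast
      ultimately show ?thesis using zero by simp
    qed
    then have "y \<in> {0}" for y :: 'b by (simp only: singleton_iff)
    then have "(UNIV :: 'b set) = {0}" by (intro equalityI subsetI UNIV_I)
    moreover have "(UNIV :: 'b set) \<noteq> {0}"
      using irr unfolding w22_irreducible_def by (rule conjunct1)
    ultimately show False by contradiction
  qed
  fix U assume U: "w22_submodule s a U"
  have "h ` U = {0} \<or> h ` U = UNIV"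
    using irr submodule_image[OF lin eq U] unfolding w22_irreducible_def by blast
  then have "h ` U = h ` {0} \<or> h ` U = h ` UNIV" using zero bij_is_surj[OF bij] by simp
  then show "U = {0} \<or> U = UNIV" unfolding inj_image_eq_iff[OF bij_is_inj[OF bij]] .
qed

lemma isomorphic_from_inverse:
  assumes lin: "Vector_Spaces.linear s' s h" and eq: "\<And>x v. h (a' x v) = a x (h v)" and bij: "bij h"
  shows "w22_isomorphic s a s' a'"
proof -
  interpret Vector_Spaces.linear s' s h by fact
  have hi: "h (inv h v) = v" and ih: "inv h (h p) = p" for v p
    using bij by (simp_all add: bij_is_surj surj_f_inv_f bij_is_inj)
  have "Vector_Spaces.linear s s' (inv h)"
    unfolding Vector_Spaces.linear_iff
  proof (intro conjI allI)
    show "vector_space s" "vector_space s'"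
      using lin unfolding Vector_Spaces.linear_iff by blast+
    show "inv h (x + y) = inv h x + inv h y" for x y
      using ih[of "inv h x + inv h y"] by (simp add: add hi)
    show "inv h (s c x) = s' c (inv h x)" for c x
      using ih[of "s' c (inv h x)"] by (simp add: scale hi)
  qed
  moreover have "inv h (a x v) = a' x (inv h v)" for x v
    using ih[of "a' x (inv h v)"] by (simp add: eq hi)
  moreover have "bij (inv h)" by (rule bij_imp_bij_inv[OF bij])
  ultimately show ?thesis unfolding w22_isomorphic_def by blast
qed

text \<open>
  The isomorphism sends \<open>u\<close> to its fibre under \<open>h\<close>, which is a coset of the kernel.
\<close>

lemma isomorphic_quotient_by_kernel:
  assumes lin: "Vector_Spaces.linear s' s h" and eq: "\<And>x v. h (a' x v) = a x (h v)" and surj: "surj h"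
    and zero_a: "\<And>x. a x 0 = 0"
  shows "w22_submodule s' a' {p. h p = 0}"
    and "w22_isomorphic_quotient s a s' a' UNIV {p. h p = 0}"
proof -
  interpret Vector_Spaces.linear s' s h by fact
  let ?N = "{p. h p = 0}"
  let ?f = "\<lambda>u. {p. h p = u}"
  show "w22_submodule s' a' {p. h p = 0}"
    unfolding w22_submodule_def by (auto intro!: vs1.subspaceI simp: add scale zero eq zero_a)
  have coset: "(+) w ` ?N = ?f (h w)" for w
  proof (intro set_eqI iffI)
    fix p assume "p \<in> ?f (h w)"
    then have "p = w + (p - w)" "h (p - w) = 0" by (simp_all add: diff)
    then show "p \<in> (+) w ` ?N" by blast
  qed (auto simp: add)
  have f_eq: "?f u = ?f u' \<longleftrightarrow> u = u'" for u u'
  proof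
    assume eq: "?f u = ?f u'"
    obtain p where "u = h p" using surj by blast
    then have "p \<in> ?f u" by simp
    then show "u = u'" unfolding eq using \<open>u = h p\<close> by simp
  qed simp
  have rep: "?f u = (+) w ` ?N \<longleftrightarrow> u = h w" for u w
    unfolding coset f_eq ..
  have "bij_betw ?f UNIV ((\<lambda>w. (+) w ` ?N) ` UNIV)"
    unfolding bij_betw_def
  proof
    show "inj ?f" using f_eq by (auto intro: injI)
    show "range ?f = (\<lambda>w. (+) w ` ?N) ` UNIV"
      unfolding coset by (simp add: image_image[of ?f h UNIV, symmetric] surj)
  qed
  then show "w22_isomorphic_quotient s a s' a' UNIV ?N"
    unfolding w22_isomorphic_quotient_def rep
    by (intro exI[of _ ?f]) (simp add: rep add scale eq)
qed

section \<open>Classification of the modules\<close>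

lemma (in w22_module) act_eq_zeroI:
  assumes "\<And>g. act (Poly_Mapping.single g 1) v = 0" shows "act x v = 0"
  by (induction x rule: pm_basis_induct) (simp_all add: assms zero_act add_act scale_act)

context weighted_module
begin

lemma other_generators_act_zero:
  assumes "\<And>i. matrix_coeff Ci i = 0" and "\<And>m. g \<noteq> Xi m"
  shows "act (Poly_Mapping.single g 1) (e i) = 0"
proof (cases g)
  case Ci
  then show ?thesis using act_matrix_coeff[of Ci i] assms(1) by simp
qed (use assms(2) I_acts_zero C1_acts_zero in auto)

lemma weighted_module_rescale:
  assumes t: "\<And>i. t i \<noteq> 0"
  shows "weighted_module scale act (\<alpha> - of_int k) (\<lambda>i. scale (t i) (e (i - k)))"
proof
  fix i
  have "weight_space scale act (\<alpha> - of_int k + of_int i) = weight_space scale act (\<alpha> + of_int (i - k))"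
    by (simp add: algebra_simps)
  also have "\<dots> = range (\<lambda>c. scale c (scale (t i) (e (i - k))))"
    unfolding weight_line
  proof (intro equalityI subsetI)
    fix v assume "v \<in> range (\<lambda>c. scale c (e (i - k)))"
    then obtain c where "v = scale c (e (i - k))" by blast
    then have "v = scale (c / t i) (scale (t i) (e (i - k)))" using t by simp
    then show "v \<in> range (\<lambda>c. scale c (scale (t i) (e (i - k))))" by blast
  qed auto
  finally show "weight_space scale act (\<alpha> - of_int k + of_int i) =
    range (\<lambda>c. scale c (scale (t i) (e (i - k))))" .
next
  have "e i \<in> span (range (\<lambda>i. scale (t i) (e (i - k))))" for i
  proof -
    have eq: "e i = scale (1 / t (i + k)) (scale (t (i + k)) (e (i + k - k)))" using t by simp
    have "scale (t (i + k)) (e (i + k - k)) \<in> range (\<lambda>i. scale (t i) (e (i - k)))" by blast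
    then show ?thesis by (subst eq) (intro span_scale span_base)
  qed
  then have "span (range e) \<subseteq> span (range (\<lambda>i. scale (t i) (e (i - k))))"
    by (intro span_minimal) auto
  then show "span (range (\<lambda>i. scale (t i) (e (i - k)))) = UNIV" using spanning by blast
qed

text \<open>
  A gauge transformation of the structure constants is realised by rescaling the weight vectors with
  the inverse scalars.
\<close>

lemma normalized_basis:
  assumes "gauge_equiv (\<lambda>m i. xi_coeff m (i - k)) F" and C: "\<And>i. matrix_coeff Ci i = 0"
  obtains t where "\<And>i. t i \<noteq> 0"
    and "\<And>m i. act (xi m) (scale (t i) (e (i - k))) = scale (F m i) (scale (t (m + i)) (e (m + i - k)))"
    and "\<And>g i. (\<And>m. g \<noteq> Xi m) \<Longrightarrow> act (Poly_Mapping.single g 1) (scale (t i) (e (i - k))) = 0"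
proof -
  obtain \<mu> where \<mu>: "\<And>i. \<mu> i \<noteq> 0" and F: "gauge \<mu> (\<lambda>m i. xi_coeff m (i - k)) = F"
    using assms(1) unfolding gauge_equiv_def by metis
  show thesis
  proof (rule that[of "\<lambda>i. 1 / \<mu> i"])
    fix m i
    have "F m i * (1 / \<mu> (m + i)) = 1 / \<mu> i * xi_coeff m (i - k)"
      unfolding F[symmetric] using \<mu> by (simp add: gauge_def add.commute)
    then show "act (xi m) (scale (1 / \<mu> i) (e (i - k))) = scale (F m i) (scale (1 / \<mu> (m + i)) (e (m + i - k)))"
      unfolding scale_scale act_scale act_xi by (simp add: algebra_simps)
  qed (use \<mu> other_generators_act_zero[OF C] in \<open>simp_all add: act_scale\<close>)
qed

lemma bij_comb:
  assumes "\<And>i. e i \<noteq> 0" shows "bij (comb e)"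
proof (rule bijI)
  show "surj (comb e)" using range_comb[of e] spanning by simp
  show "inj (comb e)"
  proof (rule injI)
    fix p q assume pq: "comb e p = comb e q"
    have "comb e (p + pm_scale (- 1) q) = 0"
      unfolding comb_add comb_scale pq by simp
    then have "scale (Poly_Mapping.lookup (p + pm_scale (- 1) q) i) (e i) = 0"
      if "i \<in> Poly_Mapping.keys (p + pm_scale (- 1) q)" for i
      using that independent_e[OF finite_keys] unfolding comb_def by blast
    then have diff: "Poly_Mapping.lookup (p + pm_scale (- 1) q) i = 0" for i
      using assms by (cases "i \<in> Poly_Mapping.keys (p + pm_scale (- 1) q)") (auto simp: in_keys_iff)
    have "Poly_Mapping.lookup p i = Poly_Mapping.lookup q i" for i
      using diff[of i] by (simp add: lookup_add lookup_minus)
    then show "p = q" by (rule poly_mapping_eqI)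
  qed
qed

lemma full_support_classification:
  assumes nz: "\<And>i. e i \<noteq> 0"
  obtains F h where "intermediate_series F \<or> F = jump_coeffs 0 0"
    "Vector_Spaces.linear pm_scale scale h" "bij h" "\<And>x p. h (series_action F x p) = act x (h p)"
proof -
  have "vir_coeffs UNIV \<alpha> (\<lambda>m i. xi_coeff m i) (matrix_coeff Ci)"
    using vir_coeffs_xi_coeff nz by simp
  then obtain k F where kF: "gauge_equiv (\<lambda>m i. xi_coeff m (i - k)) F" "intermediate_series F \<or> F = jump_coeffs 0 0"
    and C: "\<And>i. matrix_coeff Ci i = 0"
    by (rule vir_coeffs_classification) blast
  obtain t where t: "\<And>i. t i \<noteq> 0"
    and X: "\<And>m i. act (xi m) (scale (t i) (e (i - k))) = scale (F m i) (scale (t (m + i)) (e (m + i - k)))"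
    and others: "\<And>g i. (\<And>m. g \<noteq> Xi m) \<Longrightarrow> act (Poly_Mapping.single g 1) (scale (t i) (e (i - k))) = 0"
    by (rule normalized_basis[OF kF(1) C]) blast
  interpret t: weighted_module scale act "\<alpha> - of_int k" "\<lambda>i. scale (t i) (e (i - k))"
    by (rule weighted_module_rescale) (rule t)
  show thesis
  proof (rule that[OF kF(2) linear_comb])
    show "bij (comb (\<lambda>i. scale (t i) (e (i - k))))" by (rule t.bij_comb) (simp add: t nz)
    show "comb (\<lambda>i. scale (t i) (e (i - k))) (series_action F x p) = act x (comb (\<lambda>i. scale (t i) (e (i - k))) p)" for x p
      by (rule comb_equivariant[OF X others])
  qed
qed

text \<open>
  Filling the missing weight \<open>0\<close> turns the structure constants into \<open>jump_coeffs 0 0\<close>, given by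
  \<open>x\<^sub>m v\<^sub>i = (i + m) v\<^sub>i\<^sub>+\<^sub>m\<close> away from \<open>v\<^sub>0\<close>.  For \<open>u\<^sub>i = i v\<^sub>i\<close> this reads \<open>x\<^sub>m u\<^sub>i = i u\<^sub>i\<^sub>+\<^sub>m\<close>,
  which are the constants of \<open>\<A>\<^sub>0\<^sub>,\<^sub>0\<^sub>,\<^sub>0\<close> with \<open>u\<^sub>0 = 0\<close>.
\<close>

lemma missing_weight_classification:
  assumes supp: "supp = UNIV - {j}" and j: "\<alpha> + of_int j = 0"
  obtains h where "Vector_Spaces.linear pm_scale scale h" "surj h"
    "\<And>x p. h (series_action (density_coeffs 0 0) x p) = act x (h p)"
proof -
  interpret c: vir_coeffs supp \<alpha> "\<lambda>m i. xi_coeff m i" "matrix_coeff Ci" by (rule vir_coeffs_xi_coeff)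
  have "vir_coeffs UNIV \<alpha> (\<lambda>m i. xi_coeff m i) (matrix_coeff Ci)"
    by (rule c.pad_support[OF supp j])
  then obtain k F where kF: "gauge_equiv (\<lambda>m i. xi_coeff m (i - k)) F" "intermediate_series F \<or> F = jump_coeffs 0 0"
    and C: "\<And>i. matrix_coeff Ci i = 0"
    by (rule vir_coeffs_classification) blast
  have ej: "e j = 0" using supp by blast
  have F: "F = jump_coeffs 0 0" and k: "k = - j"
    using isolated_index_normal_form[OF kF, of j] c.outside_source[of j] c.outside_target[of "j - m" m for m] ej
    by simp_all
  obtain t where t: "\<And>i. t i \<noteq> 0"
    and X: "\<And>m i. act (xi m) (scale (t i) (e (i - k))) = scale (F m i) (scale (t (m + i)) (e (m + i - k)))"
    and others: "\<And>g i. (\<And>m. g \<noteq> Xi m) \<Longrightarrow> act (Poly_Mapping.single g 1) (scale (t i) (e (i - k))) = 0"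
    by (rule normalized_basis[OF kF(1) C]) blast
  define u where "u i = scale (of_int i) (scale (t i) (e (i - k)))" for i
  have Xu: "act (xi m) (u i) = scale (density_coeffs 0 0 m i) (u (m + i))" for m i
    unfolding u_def act_scale[of _ "of_int i"] X F by (simp add: jump_coeffs_def density_coeffs_def add.commute)
  have others_u: "act (Poly_Mapping.single g 1) (u i) = 0" if "\<And>m. g \<noteq> Xi m" for g i
    unfolding u_def act_scale[of _ "of_int i"] others[OF that] by simp
  have "e i \<in> span (range u)" for i
  proof (cases "i = j")
    case False
    then have eq: "e i = scale (1 / (of_int (i - j) * t (i - j))) (u (i - j))"
      using t[of "i - j"] by (simp add: u_def k flip: of_int_diff)
    show ?thesis by (subst eq) (intro span_scale span_base rangeI)
  qed (simp add: ej span_zero)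
  then have "span (range e) \<subseteq> span (range u)" by (intro span_minimal) auto
  then have "surj (comb u)" unfolding range_comb spanning by blast
  then show thesis using linear_comb comb_equivariant[OF Xu others_u] that by blast
qed

end

lemma weighted_module_of_coset_module:
  assumes "multiplicity_one_coset_module scale act"
  obtains \<alpha> e where "weighted_module scale act \<alpha> e" "\<And>i. e i \<noteq> 0"
proof -
  interpret w22_module scale act
    using assms unfolding multiplicity_one_coset_module_def by blast
  obtain \<alpha> where sum: "is_direct_sum (\<lambda>i::int. weight_space scale act (\<alpha> + of_int i))"
    and dim: "\<And>i::int. dim (weight_space scale act (\<alpha> + of_int i)) = 1"
    using assms unfolding multiplicity_one_coset_module_def by blast
  have "\<exists>v. v \<noteq> 0 \<and> weight_space scale act (\<alpha> + of_int i) = range (\<lambda>k. scale k v)" for i :: int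
    by (rule weight_space_dim_one[OF dim[of i]]) blast
  then obtain e where e: "\<And>i::int. e i \<noteq> 0"
    "\<And>i::int. weight_space scale act (\<alpha> + of_int i) = range (\<lambda>k. scale k (e i))"
    by metis
  have "v \<in> span (range e)" for v
  proof -
    obtain f where f: "\<And>i::int. f i \<in> weight_space scale act (\<alpha> + of_int i)" "v = (\<Sum>i | f i \<noteq> 0. f i)"
      using sum unfolding is_direct_sum_def by metis
    have "f i \<in> span (range e)" for i
    proof -
      obtain k where "f i = scale k (e i)" using f(1)[of i] unfolding e(2) by blast
      then show ?thesis by (simp only:) (intro span_scale span_base rangeI)
    qed
    then show ?thesis unfolding f(2) by (intro span_sum)
  qed
  then have "weighted_module scale act \<alpha> e"
    by unfold_locales (use e(2) in auto)
  then show thesis using e(1) that by blast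
qed

text \<open>
  The weight spaces in one coset of the integers span a submodule, so by irreducibility a single coset
  contains all weights.
\<close>

lemma weighted_module_of_irreducible:
  fixes scale :: "complex \<Rightarrow> 'v \<Rightarrow> 'v::ab_group_add"
  assumes mod: "w22_module scale act" and irr: "w22_irreducible scale act"
    and weight: "weight_module scale act"
    and dim: "\<And>\<mu>. \<mu> \<in> Supp scale act \<Longrightarrow> vector_space.dim scale (weight_space scale act \<mu>) = 1"
  obtains \<alpha> e where "weighted_module scale act \<alpha> e" "e 0 \<noteq> 0"
proof -
  interpret w22_module scale act by fact
  have "\<exists>\<mu>. weight_space scale act \<mu> \<noteq> {0}"
  proof (rule ccontr)
    assume "\<nexists>\<mu>. weight_space scale act \<mu> \<noteq> {0}"
    then have "(\<Union>\<mu>. weight_space scale act \<mu>) = {0}" by auto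
    then have "span {0} = UNIV" using weight unfolding weight_module_def by simp
    then have "(UNIV :: 'v set) = {0}" using span_insert_0[of "{}"] by simp
    then show False using irr unfolding w22_irreducible_def by blast
  qed
  then obtain \<alpha> where \<alpha>: "weight_space scale act \<alpha> \<noteq> {0}" by blast
  have "\<exists>v. weight_space scale act \<mu> = range (\<lambda>k. scale k v)" for \<mu>
  proof (cases "weight_space scale act \<mu> = {0}")
    case True
    then show ?thesis by (intro exI[of _ 0]) auto
  next
    case False
    then have "dim (weight_space scale act \<mu>) = 1" by (intro dim) (simp add: Supp_def)
    then show ?thesis by (rule weight_space_dim_one) blast
  qed
  then obtain b where b: "\<And>\<mu>. weight_space scale act \<mu> = range (\<lambda>k. scale k (b \<mu>))" by metis
  define e where "e i = b (\<alpha> + of_int i)" for i :: int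
  have e: "weight_space scale act (\<alpha> + of_int i) = range (\<lambda>k. scale k (e i))" for i
    unfolding e_def by (rule b)
  have e0: "e 0 \<noteq> 0" using \<alpha> e[of 0] by auto
  let ?U = "span (range e)"
  have basis: "act (Poly_Mapping.single g 1) v \<in> ?U" if "v \<in> ?U" for g v
    using that
  proof (induction rule: span_induct_alt)
    case (step c w v)
    then obtain i where w: "w = e i" by blast
    have "e i \<in> weight_space scale act (\<alpha> + of_int i)"
      unfolding e by (rule range_eqI[of _ _ 1]) simp
    then have "act (Poly_Mapping.single g 1) (e i) \<in> weight_space scale act (\<alpha> + of_int (i + basis_degree g))"
      using act_weight_space[of "e i" "\<alpha> + of_int i" g] by (simp add: add.assoc)
    then obtain k where "act (Poly_Mapping.single g 1) (e i) = scale k (e (i + basis_degree g))"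
      unfolding e by blast
    then have "act (Poly_Mapping.single g 1) (e i) \<in> ?U"
      by (simp only:) (intro span_scale span_base rangeI)
    then show ?case using step unfolding w by (simp add: act_add act_scale span_add span_scale)
  qed (simp add: act_zero span_zero)
  have "act x v \<in> ?U" if "v \<in> ?U" for x v
    by (induction x rule: pm_basis_induct)
      (simp_all add: zero_act add_act scale_act span_zero span_add span_scale basis that)
  then have "w22_submodule scale act ?U" unfolding w22_submodule_def by simp
  then have "?U = {0} \<or> ?U = UNIV" using irr unfolding w22_irreducible_def by blast
  moreover have "e 0 \<in> ?U" by (simp add: span_base)
  ultimately have "?U = UNIV" using e0 by blast
  then have "weighted_module scale act \<alpha> e"
    by unfold_locales (use e in auto)
  then show thesis using e0 that by blast
qed

text \<open>
  If all weights of the coset occur, the module is one of the full normal forms, and only the densities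
  can be irreducible.  If exactly the weight \<open>0\<close> is missing, it is a quotient of \<open>\<A>\<^sub>0\<^sub>,\<^sub>0\<^sub>,\<^sub>0\<close>.  The
  remaining support consists of the weight \<open>0\<close> alone, where everything acts by zero.
\<close>

lemma irreducible_classification:
  assumes mod: "w22_module scale act" and nontriv: "\<not> w22_trivial act" and irr: "w22_irreducible scale act"
    and weight: "weight_module scale act"
    and dim: "\<And>\<mu>. \<mu> \<in> Supp scale act \<Longrightarrow> vector_space.dim scale (weight_space scale act \<mu>) = 1"
  shows "(\<exists>\<alpha> \<beta>. w22_isomorphic scale act pm_scale (act_A_ab0 \<alpha> \<beta>)) \<or> isomorphic_A'_000 scale act"
proof -
  obtain \<alpha> e where w: "weighted_module scale act \<alpha> e" and e0: "e 0 \<noteq> 0"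
    using weighted_module_of_irreducible[OF mod irr weight dim] by blast
  interpret weighted_module scale act \<alpha> e by (rule w)
  interpret c: vir_coeffs supp \<alpha> "\<lambda>m i. xi_coeff m i" "matrix_coeff Ci" by (rule vir_coeffs_xi_coeff)
  have "0 \<in> supp" using e0 by simp
  then show ?thesis
  proof (cases rule: c.support_cases)
    case 1
    then have "e i \<noteq> 0" for i by blast
    then obtain F h where F: "intermediate_series F \<or> F = jump_coeffs 0 0"
      and h: "Vector_Spaces.linear pm_scale scale h" "bij h" "\<And>x p. h (series_action F x p) = act x (h p)"
      using full_support_classification by blast
    have "w22_irreducible pm_scale (series_action F)"
      by (rule irreducible_transfer[where a = "series_action F" and a' = act, OF h(1,3,2) irr])
    then obtain a b where "F = density_coeffs a b"
      using F series_reducible[of F] unfolding intermediate_series_def by blast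
    then show ?thesis
      using isomorphic_from_inverse[where a = act and a' = "series_action F", OF h(1,3,2)] unfolding act_A_ab0_density by blast
  next
    case (2 j)
    obtain h where h: "Vector_Spaces.linear pm_scale scale h" "surj h"
      "\<And>x p. h (series_action (density_coeffs 0 0) x p) = act x (h p)"
      by (rule missing_weight_classification[OF 2]) blast
    note q = isomorphic_quotient_by_kernel[where a = act and a' = "series_action (density_coeffs 0 0)", OF h(1,3,2) act_zero]
    have "w22_submodule pm_scale (series_action (density_coeffs 0 0)) UNIV"
      by (simp add: w22_submodule_def)
    then have "isomorphic_A'_000 scale act"
      unfolding isomorphic_A'_000_def is_nontrivial_simple_subquotient_def act_A_ab0_density
      using irr nontriv q by blast
    then show ?thesis ..
  next
    case 3
    have "act (Poly_Mapping.single g 1) (e i) = 0" for g i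
    proof (cases g)
      case (Xi m)
      then show ?thesis using act_xi[of m i] c.singleton_support(1)[OF 3] by simp
    qed (use other_generators_act_zero[OF c.singleton_support(2)[OF 3]] in auto)
    then have z: "act x (e i) = 0" for x i by (rule act_eq_zeroI)
    have "act x v = 0" if "v \<in> span (range e)" for x v
      using that by (induction rule: span_induct_alt) (auto simp: z act_zero act_add act_scale)
    then have "w22_trivial act" unfolding w22_trivial_def spanning by blast
    then show ?thesis using nontriv by blast
  qed
qed

lemma indecomposable_classification:
  assumes "multiplicity_one_coset_module scale act" and ind: "w22_indecomposable scale act"
  obtains F where "intermediate_series F" "w22_isomorphic scale act pm_scale (series_action F)"
proof -
  obtain \<alpha> e where w: "weighted_module scale act \<alpha> e" and nz: "\<And>i. e i \<noteq> 0"
    using weighted_module_of_coset_module[OF assms(1)] by blast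
  interpret weighted_module scale act \<alpha> e by (rule w)
  obtain F h where F: "intermediate_series F \<or> F = jump_coeffs 0 0"
    and h: "Vector_Spaces.linear pm_scale scale h" "bij h" "\<And>x p. h (series_action F x p) = act x (h p)"
    using full_support_classification[OF nz] by blast
  have "w22_indecomposable pm_scale (series_action F)"
    by (rule indecomposable_transfer[where a = "series_action F" and a' = act, OF h(1,3,2) ind])
  then have "intermediate_series F" using F jump_zero_decomposable by blast
  then show thesis using isomorphic_from_inverse[where a = act and a' = "series_action F", OF h(1,3,2)] that by blast
qed

theorem theorem3p4:
  fixes scale :: "complex \<Rightarrow> 'v \<Rightarrow> 'v::ab_group_add"
    and act :: "w22 \<Rightarrow> 'v \<Rightarrow> 'v"
  shows
    "(w22_module scale act \<and> \<not> w22_trivial act \<and> w22_irreducible scale act \<and>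
      weight_module scale act \<and>
      (\<forall>\<mu>\<in>Supp scale act. vector_space.dim scale (weight_space scale act \<mu>) = 1)
      \<longrightarrow> (\<exists>\<alpha> \<beta>. w22_isomorphic scale act pm_scale (act_A_ab0 \<alpha> \<beta>)) \<or>
          isomorphic_A'_000 scale act)
     \<and>
     (multiplicity_one_coset_module scale act \<and> w22_indecomposable scale act
      \<longrightarrow> (\<exists>a b. w22_isomorphic scale act pm_scale (act_A_ab0 a b)) \<or>
          (\<exists>a. w22_isomorphic scale act pm_scale (act_A_a0 a)) \<or>
          (\<exists>a. w22_isomorphic scale act pm_scale (act_B_a0 a)))
     \<and>
     (\<forall>a b. multiplicity_one_coset_module pm_scale (act_A_ab0 a b) \<and>
            w22_indecomposable pm_scale (act_A_ab0 a b))
     \<and>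
     (\<forall>a. multiplicity_one_coset_module pm_scale (act_A_a0 a) \<and>
          w22_indecomposable pm_scale (act_A_a0 a))
     \<and>
     (\<forall>a. multiplicity_one_coset_module pm_scale (act_B_a0 a) \<and>
          w22_indecomposable pm_scale (act_B_a0 a))"
proof (intro conjI impI allI)
  assume "w22_module scale act \<and> \<not> w22_trivial act \<and> w22_irreducible scale act \<and>
      weight_module scale act \<and>
      (\<forall>\<mu>\<in>Supp scale act. vector_space.dim scale (weight_space scale act \<mu>) = 1)"
  then show "(\<exists>\<alpha> \<beta>. w22_isomorphic scale act pm_scale (act_A_ab0 \<alpha> \<beta>)) \<or> isomorphic_A'_000 scale act"
    by (intro irreducible_classification) blast+
next
  assume "multiplicity_one_coset_module scale act \<and> w22_indecomposable scale act"
  then obtain F where "intermediate_series F" "w22_isomorphic scale act pm_scale (series_action F)"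
    using indecomposable_classification by blast
  then show "(\<exists>a b. w22_isomorphic scale act pm_scale (act_A_ab0 a b)) \<or>
          (\<exists>a. w22_isomorphic scale act pm_scale (act_A_a0 a)) \<or>
          (\<exists>a. w22_isomorphic scale act pm_scale (act_B_a0 a))"
    unfolding act_A_ab0_density act_A_a0_jump act_B_a0_jump intermediate_series_def by blast
next
  fix a b
  have "intermediate_series (density_coeffs a b)" by (auto simp: intermediate_series_def)
  from intermediate_series_module[OF this]
  show "multiplicity_one_coset_module pm_scale (act_A_ab0 a b)" "w22_indecomposable pm_scale (act_A_ab0 a b)"
    unfolding act_A_ab0_density by blast+
next
  fix a
  have "intermediate_series (jump_coeffs 1 a)" by (auto simp: intermediate_series_def)
  from intermediate_series_module[OF this]
  show "multiplicity_one_coset_module pm_scale (act_A_a0 a)" "w22_indecomposable pm_scale (act_A_a0 a)"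
    unfolding act_A_a0_jump by blast+
next
  fix a
  have "intermediate_series (transpose_coeffs (jump_coeffs (- 1) a))" by (auto simp: intermediate_series_def)
  from intermediate_series_module[OF this]
  show "multiplicity_one_coset_module pm_scale (act_B_a0 a)" "w22_indecomposable pm_scale (act_B_a0 a)"
    unfolding act_B_a0_jump by blast+
qed

end
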